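(* Let $X$ be a non-metrizable stratifiable $k$-space with a compact-countable $k$-network. Then the following statements are equivalent: (1) $A(X)$ is a sequential space; (2) $A(X)$ is a $k_R$-space; (3) each $A_n(X)$ ($n\in\mathbb{N}$) is a $k_R$-space; (4) $A_4(X)$ is a $k_R$-space; (5) the space $X$ is the topological sum of a $k_\omega$-space and a discrete space.
   Context: All spaces are assumed to be Tychonoff; $\mathbb{N}$ is the set of positive integers. For a non-empty Tychonoff space $X$, $A(X)$ is the free Abelian topological group over $X$: an Abelian topological group with a continuous map $i:X\to A(X)$ such that $i(X)$ algebraically generates $A(X)$ and every continuous map $f:X\to G$ to an Abelian topological group $G$ has the form $f=\overline{f}\circ i$ for some continuous homomorphism $\overline{f}:A(X)\to G$; $X$ is identified with $i(X)$, and is a free algebraic basis of $A(X)$. Each non-zero $g\in A(X)$ is uniquely $r_1x_1+\cdots+r_kx_k$ with $x_i\in X$ distinct and $r_i\in\mathbb{Z}\setminus\{0\}$; its reduced length is $\sum|r_i|$, and $0$ has reduced length $0$. $A_n(X)$ is the subspace of $A(X)$ of all elements of reduced length at most $n$. A space $X$ is a $k$-space if a subset $C\subseteq X$ is closed whenever $C\cap K$ is closed in $K$ for every compact $K\subseteq X$. $X$ is a $k_R$-space if $X$ is Tychonoff and every $f:X\to\mathbb{R}$ whose restriction to each compact subset is continuous is continuous. $X$ is a $k_\omega$-space if there is a countable family $\{K_n:n\in\mathbb{N}\}$ of compact subsets of $X$ such that $F\subseteq X$ is closed whenever $F\cap K_n$ is closed in $K_n$ for each $n$. A space is sequential if every sequentially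 open subset is open (a set is sequentially open if every sequence converging to one of its points is eventually in it). $X$ is stratifiable if to each open $U\subseteq X$ one can assign a sequence $\{U_n\}_{n=1}^\infty$ of open subsets of $X$ such that (a) $\overline{U_n}\subseteq U$; (b) $\bigcup_{n}U_n=U$; (c) $U_n\subseteq V_n$ for all $n$ whenever $U\subseteq V$. A family $\mathscr{P}$ of subsets of $X$ is a $k$-network if for every compact $K$ and every open $U\supseteq K$ there is a finite $\mathscr{P}'\subseteq\mathscr{P}$ with $K\subseteq\bigcup\mathscr{P}'\subseteq U$. It is compact-countable if each compact subset of $X$ meets at most countably many of its members. *)

theory Defs
  imports "HOL-Analysis.Analysis" "HOL-Algebra.Free_Abelian_Groups"
begin

definition Tychonoff_space :: "'a topology \<Rightarrow> bool" where
  "Tychonoff_space X \<longleftrightarrow> completely_regular_space X \<and> Hausdorff_space X"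

definition k\<^sub>R_space :: "'a topology \<Rightarrow> bool" where
  "k\<^sub>R_space X \<longleftrightarrow> Tychonoff_space X \<and>
     (\<forall>f :: 'a \<Rightarrow> real.
        (\<forall>K. compactin X K \<longrightarrow> continuous_map (subtopology X K) euclideanreal f)
          \<longrightarrow> continuous_map X euclideanreal f)"

definition k\<^sub>\<omega>_space :: "'a topology \<Rightarrow> bool" where
  "k\<^sub>\<omega>_space X \<longleftrightarrow>
     (\<exists>K :: nat \<Rightarrow> 'a set. (\<forall>n. compactin X (K n)) \<and>
        (\<forall>F \<subseteq> topspace X.
           (\<forall>n. closedin (subtopology X (K n)) (F \<inter> K n)) \<longrightarrow> closedin X F))"

definition sequentially_open_in :: "'a topology \<Rightarrow> 'a set \<Rightarrow> bool" where
  "sequentially_open_in X U \<longleftrightarrow> U \<subseteq> topspace X \<and>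
     (\<forall>s x. range s \<subseteq> topspace X \<and> x \<in> U \<and> limitin X s x sequentially
        \<longrightarrow> (\<forall>\<^sub>F n in sequentially. s n \<in> U))"

definition sequential_space :: "'a topology \<Rightarrow> bool" where
  "sequential_space X \<longleftrightarrow> (\<forall>U. sequentially_open_in X U \<longrightarrow> openin X U)"

definition stratifiable_space :: "'a topology \<Rightarrow> bool" where
  "stratifiable_space X \<longleftrightarrow>
     (\<exists>S :: 'a set \<Rightarrow> nat \<Rightarrow> 'a set.
        (\<forall>U. openin X U \<longrightarrow>
           (\<forall>n. openin X (S U n) \<and> X closure_of (S U n) \<subseteq> U) \<and> (\<Union>n. S U n) = U) \<and>
        (\<forall>U V. openin X U \<and> openin X V \<and> U \<subseteq> V \<longrightarrow> (\<forall>n. S U n \<subseteq> S V n)))"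

definition k_network :: "'a topology \<Rightarrow> 'a set set \<Rightarrow> bool" where
  "k_network X \<P> \<longleftrightarrow> \<P> \<subseteq> Pow (topspace X) \<and>
     (\<forall>K U. compactin X K \<and> openin X U \<and> K \<subseteq> U \<longrightarrow>
        (\<exists>\<F> \<subseteq> \<P>. finite \<F> \<and> K \<subseteq> \<Union>\<F> \<and> \<Union>\<F> \<subseteq> U))"

definition compact_countable :: "'a topology \<Rightarrow> 'a set set \<Rightarrow> bool" where
  "compact_countable X \<P> \<longleftrightarrow> (\<forall>K. compactin X K \<longrightarrow> countable {P \<in> \<P>. P \<inter> K \<noteq> {}})"

definition sum_of_k\<^sub>\<omega>_and_discrete :: "'a topology \<Rightarrow> bool" where
  "sum_of_k\<^sub>\<omega>_and_discrete X \<longleftrightarrow>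
     (\<exists>(Y :: 'a topology) (D :: 'a set). k\<^sub>\<omega>_space Y \<and>
        X homeomorphic_space
          sum_topology (\<lambda>b. if b then Y else discrete_topology D) (UNIV :: bool set))"

text \<open>
  Groups are written multiplicatively, so that \<open>r\<^sub>1 x\<^sub>1 + \<dots> + r\<^sub>k x\<^sub>k\<close> becomes a
  \<^const>\<open>finprod\<close> of powers. All spaces, hence all topological groups, are Tychonoff.
\<close>

definition Abelian_topological_group :: "('g, 'm) monoid_scheme \<Rightarrow> 'g topology \<Rightarrow> bool" where
  "Abelian_topological_group G T \<longleftrightarrow>
     comm_group G \<and> topspace T = carrier G \<and> Tychonoff_space T \<and>
     continuous_map (prod_topology T T) T (\<lambda>(x, y). x \<otimes>\<^bsub>G\<^esub> y) \<and>
     continuous_map T T (\<lambda>x. inv\<^bsub>G\<^esub> x)"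

text \<open>
  \<open>(G, T)\<close> with \<open>i : X \<rightarrow> G\<close> is the free Abelian topological group over \<open>X\<close>. A definition cannot
  quantify over types, so the test groups \<open>H\<close> have carriers inside the type \<^typ>\<open>'a \<Rightarrow>\<^sub>0 int\<close>
  of formal integer combinations of points. This is no restriction: only the subgroup generated by
  the image of \<open>X\<close> matters, and it is a quotient of the free Abelian group on the set \<open>X\<close>. The
  extension property for Abelian topological groups over arbitrary types is proved below as
  \<open>free_Abelian_topological_group_universal\<close>.
\<close>

definition free_Abelian_topological_group ::
  "'a topology \<Rightarrow> ('g, 'm) monoid_scheme \<Rightarrow> 'g topology \<Rightarrow> ('a \<Rightarrow> 'g) \<Rightarrow> bool" where
  "free_Abelian_topological_group X G T i \<longleftrightarrow>
     Abelian_topological_group G T \<and>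
     continuous_map X T i \<and>
     generate G (i ` topspace X) = carrier G \<and>
     (\<forall>(H :: ('a \<Rightarrow>\<^sub>0 int) monoid) T' f.
        Abelian_topological_group H T' \<and> continuous_map X T' f \<longrightarrow>
        (\<exists>h \<in> hom G H. continuous_map T T' h \<and> (\<forall>x \<in> topspace X. h (i x) = f x)))"

text \<open>
  The representation is indexed by points of \<open>X\<close> rather than by their images under \<open>i\<close>. That \<open>X\<close> is
  a free algebraic basis, so that the description in \<open>reduced_length\<close> has exactly one solution, is
  proved below as \<open>reduced_representation_exists\<close> and \<open>reduced_representation_unique\<close>. The identity
  has the empty representation.
\<close>

definition reduced_representation ::
  "'a topology \<Rightarrow> ('g, 'm) monoid_scheme \<Rightarrow> ('a \<Rightarrow> 'g) \<Rightarrow> 'a set \<Rightarrow> ('a \<Rightarrow> int) \<Rightarrow> 'g \<Rightarrow> bool" where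
  "reduced_representation X G i F r g \<longleftrightarrow>
     finite F \<and> F \<subseteq> topspace X \<and> (\<forall>x \<in> F. r x \<noteq> 0) \<and>
     g = finprod G (\<lambda>x. i x [^]\<^bsub>G\<^esub> r x) F"

definition reduced_length ::
  "'a topology \<Rightarrow> ('g, 'm) monoid_scheme \<Rightarrow> ('a \<Rightarrow> 'g) \<Rightarrow> 'g \<Rightarrow> nat" where
  "reduced_length X G i g =
     (THE m. \<exists>F r. reduced_representation X G i F r g \<and> m = (\<Sum>x\<in>F. nat \<bar>r x\<bar>))"

definition A_sub ::
  "'a topology \<Rightarrow> ('g, 'm) monoid_scheme \<Rightarrow> 'g topology \<Rightarrow> ('a \<Rightarrow> 'g) \<Rightarrow> nat \<Rightarrow> 'g topology" where
  "A_sub X G T i n = subtopology T {g \<in> carrier G. reduced_length X G i g \<le> n}"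


lemma free_Abelian_topological_group_universal:
  fixes X :: "'a topology" and G :: "('g, 'm) monoid_scheme" and H :: "('h, 'k) monoid_scheme"
  assumes free: "free_Abelian_topological_group X G T i"
    and H: "Abelian_topological_group H T'" and f: "continuous_map X T' f"
  obtains h where "h \<in> hom G H" "continuous_map T T' h" "\<And>x. x \<in> topspace X \<Longrightarrow> h (i x) = f x"
proof -
  interpret H: comm_group H using H by (simp add: Abelian_topological_group_def)
  have tH: "topspace T' = carrier H" using H by (simp add: Abelian_topological_group_def)
  have fim: "f ` topspace X \<subseteq> carrier H"
    using f tH by (auto simp: continuous_map_def)
  obtain p where p: "p \<in> hom (free_Abelian_group (topspace X)) H"
    and pf: "\<And>x. x \<in> topspace X \<Longrightarrow> p (frag_of x) = f x"
    using H.free_Abelian_group_universal [OF fim] by blast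
  define S where "S = p ` carrier (free_Abelian_group (topspace X))"
  interpret p: group_hom "free_Abelian_group (topspace X)" H p
    using p by (simp add: group_hom_def group_hom_axioms_def)
  have subS: "subgroup S H"
    unfolding S_def by (rule p.img_is_subgroup)
  have SH: "S \<subseteq> carrier H" using subS by (rule subgroup.subset)
  define s where "s = inv_into (carrier (free_Abelian_group (topspace X))) p"
  have ps: "p (s y) = y" if "y \<in> S" for y
    using that unfolding s_def S_def by (rule f_inv_into_f)
  define K :: "('a \<Rightarrow>\<^sub>0 int) monoid"
    where "K = \<lparr>carrier = s ` S, mult = (\<lambda>a b. s (p a \<otimes>\<^bsub>H\<^esub> p b)), one = s \<one>\<^bsub>H\<^esub>\<rparr>"
  have pK: "p a \<in> S" if "a \<in> carrier K" for a
    using that ps by (auto simp: K_def)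
  have sp: "s (p a) = a" if "a \<in> carrier K" for a
    using that ps by (auto simp: K_def)
  have multS: "a \<otimes>\<^bsub>H\<^esub> b \<in> S" if "a \<in> S" "b \<in> S" for a b
    using subS that by (simp add: subgroup.m_closed)
  have oneS: "\<one>\<^bsub>H\<^esub> \<in> S" using subS by (simp add: subgroup.one_closed)
  have invS: "inv\<^bsub>H\<^esub> a \<in> S" if "a \<in> S" for a
    using subS that by (simp add: subgroup.m_inv_closed)
  have gK: "comm_group K"
  proof (rule comm_groupI)
    fix x assume x: "x \<in> carrier K"
    show "\<exists>y\<in>carrier K. y \<otimes>\<^bsub>K\<^esub> x = \<one>\<^bsub>K\<^esub>"
      using pK [OF x] invS SH ps by (intro bexI [of _ "s (inv\<^bsub>H\<^esub> p x)"]) (auto simp: K_def)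
  next
    fix x y z assume "x \<in> carrier K" "y \<in> carrier K" "z \<in> carrier K"
    then have "p x \<in> S" "p y \<in> S" "p z \<in> S" using pK by auto
    then show "x \<otimes>\<^bsub>K\<^esub> y \<otimes>\<^bsub>K\<^esub> z = x \<otimes>\<^bsub>K\<^esub> (y \<otimes>\<^bsub>K\<^esub> z)"
      using SH multS ps by (auto simp: K_def H.m_assoc subset_iff)
  next
    fix x y assume "x \<in> carrier K" "y \<in> carrier K"
    then have "p x \<in> S" "p y \<in> S" using pK by auto
    then show "x \<otimes>\<^bsub>K\<^esub> y = y \<otimes>\<^bsub>K\<^esub> x" using SH by (auto simp: K_def H.m_comm subset_iff)
  next
    fix x assume x: "x \<in> carrier K"
    then have "p x \<in> carrier H" using pK SH by auto
    then show "\<one>\<^bsub>K\<^esub> \<otimes>\<^bsub>K\<^esub> x = x" using sp [OF x] ps [OF oneS] by (simp add: K_def)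
  next
    fix x y assume "x \<in> carrier K" "y \<in> carrier K"
    then show "x \<otimes>\<^bsub>K\<^esub> y \<in> carrier K" using pK multS by (auto simp: K_def)
  next
    show "\<one>\<^bsub>K\<^esub> \<in> carrier K" using oneS by (simp add: K_def)
  qed
  interpret K: comm_group K by (rule gK)
  have invK: "inv\<^bsub>K\<^esub> a = s (inv\<^bsub>H\<^esub> p a)" if a: "a \<in> carrier K" for a
  proof (rule K.inv_equality [OF _ a])
    show "s (inv\<^bsub>H\<^esub> p a) \<otimes>\<^bsub>K\<^esub> a = \<one>\<^bsub>K\<^esub>"
      using pK [OF a] invS SH ps by (auto simp: K_def)
    show "s (inv\<^bsub>H\<^esub> p a) \<in> carrier K" using pK [OF a] invS by (auto simp: K_def)
  qed
  define TS where "TS = subtopology T' S"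
  have tS: "topspace TS = S" using SH tH by (auto simp: TS_def)
  define TK where "TK = pullback_topology (carrier K) p TS"
  have tK: "topspace TK = carrier K"
    using pK by (auto simp: TK_def topspace_pullback_topology tS)
  have cp: "continuous_map TK TS p"
  proof -
    have "continuous_map TK TS (id \<circ> p)"
      unfolding TK_def by (rule continuous_map_pullback [OF continuous_map_id])
    then show ?thesis by simp
  qed
  have cs: "continuous_map TS TK s"
    unfolding TK_def
  proof (rule continuous_map_pullback')
    show "continuous_map TS TS (p \<circ> s)"
      by (rule continuous_map_eq [OF continuous_map_id]) (simp add: ps tS)
    show "topspace TS \<subseteq> s -` carrier K" by (auto simp: tS K_def)
  qed
  have homeo: "TS homeomorphic_space TK"
    unfolding homeomorphic_space_def homeomorphic_maps_def
    using cp cs ps sp tS tK by metis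
  have "Tychonoff_space TS"
    using H unfolding TS_def Abelian_topological_group_def Tychonoff_space_def
    by (simp add: completely_regular_space_subtopology Hausdorff_space_subtopology)
  then have TyK: "Tychonoff_space TK"
    using homeomorphic_completely_regular_space [OF homeo] homeomorphic_Hausdorff_space [OF homeo]
    by (simp add: Tychonoff_space_def)
  have cp': "continuous_map TK T' p"
    using cp by (simp add: TS_def continuous_map_in_subtopology)
  have cmult: "continuous_map (prod_topology TK TK) TK (\<lambda>(x, y). x \<otimes>\<^bsub>K\<^esub> y)"
  proof -
    have "continuous_map (prod_topology TK TK) (prod_topology T' T') (\<lambda>(x, y). (p x, p y))"
      using cp' by (simp add: continuous_map_prod_top)
    from continuous_map_compose [OF this, of T' "\<lambda>(x, y). x \<otimes>\<^bsub>H\<^esub> y"]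
    have "continuous_map (prod_topology TK TK) T' ((\<lambda>(x, y). x \<otimes>\<^bsub>H\<^esub> y) \<circ> (\<lambda>(x, y). (p x, p y)))"
      using H by (simp add: Abelian_topological_group_def)
    then have "continuous_map (prod_topology TK TK) TS ((\<lambda>(x, y). x \<otimes>\<^bsub>H\<^esub> y) \<circ> (\<lambda>(x, y). (p x, p y)))"
      using pK multS by (auto simp: TS_def continuous_map_in_subtopology tK)
    from continuous_map_compose [OF this cs]
    show ?thesis
      by (rule continuous_map_eq) (auto simp: K_def)
  qed
  have cinv: "continuous_map TK TK (\<lambda>x. inv\<^bsub>K\<^esub> x)"
  proof -
    have "continuous_map TK T' ((\<lambda>x. inv\<^bsub>H\<^esub> x) \<circ> p)"
      using H by (intro continuous_map_compose [OF cp']) (simp add: Abelian_topological_group_def)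
    then have "continuous_map TK TS ((\<lambda>x. inv\<^bsub>H\<^esub> x) \<circ> p)"
      using pK invS by (auto simp: TS_def continuous_map_in_subtopology tK)
    from continuous_map_compose [OF this cs]
    show ?thesis
      by (rule continuous_map_eq) (auto simp: tK invK)
  qed
  have K: "Abelian_topological_group K TK"
    using gK tK TyK cmult cinv by (simp add: Abelian_topological_group_def)
  have fS: "f x \<in> S" if "x \<in> topspace X" for x
    using that pf [OF that, symmetric] by (auto simp: S_def simp del: carrier_free_Abelian_group_iff)
  have "continuous_map X TS f"
    using f fS by (auto simp: TS_def continuous_map_in_subtopology)
  then have "continuous_map X TK (s \<circ> f)"
    using cs by (rule continuous_map_compose)
  with free K obtain h where h: "h \<in> hom G K" "continuous_map T TK h"
    and hi: "\<And>x. x \<in> topspace X \<Longrightarrow> h (i x) = (s \<circ> f) x"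
    unfolding free_Abelian_topological_group_def by blast
  show thesis
  proof
    have "p \<in> hom K H"
      using pK SH multS ps by (auto simp: hom_def K_def)
    with h(1) show "p \<circ> h \<in> hom G H" by (rule hom_compose)
    show "continuous_map T T' (p \<circ> h)"
      using h(2) cp' by (rule continuous_map_compose)
    show "(p \<circ> h) (i x) = f x" if "x \<in> topspace X" for x
      using hi [OF that] fS [OF that] ps by simp
  qed
qed

lemma reduced_representation_exists:
  assumes free: "free_Abelian_topological_group X G T i" and g: "g \<in> carrier G"
  obtains F r where "reduced_representation X G i F r g"
proof -
  interpret G: comm_group G
    using free by (simp add: free_Abelian_topological_group_def Abelian_topological_group_def)
  have iG: "i ` topspace X \<subseteq> carrier G"
    using free by (auto simp: free_Abelian_topological_group_def Abelian_topological_group_def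
        continuous_map_def)
  have gen: "g \<in> generate G (i ` topspace X)"
    using free g by (simp add: free_Abelian_topological_group_def)
  then have "\<exists>F r. finite F \<and> F \<subseteq> topspace X \<and> g = finprod G (\<lambda>x. i x [^]\<^bsub>G\<^esub> (r x :: int)) F"
  proof (induction rule: generate.induct)
    case one
    show ?case by (rule exI [of _ "{}"]) simp
  next
    case (incl h)
    then obtain x where x: "x \<in> topspace X" "h = i x" by blast
    show ?case
      using x iG by (intro exI [of _ "{x}"] exI [of _ "\<lambda>_. 1"]) (auto simp: G.int_pow_1)
  next
    case (inv h)
    then obtain x where x: "x \<in> topspace X" "h = i x" by blast
    then have "i x \<in> carrier G" using iG by blast
    then have "inv\<^bsub>G\<^esub> i x = i x [^]\<^bsub>G\<^esub> (-1 :: int)"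
      by (simp add: G.int_pow_neg G.int_pow_1)
    then show ?case
      using x iG by (intro exI [of _ "{x}"] exI [of _ "\<lambda>_. -1"]) auto
  next
    case (eng h1 h2)
    then obtain F1 r1 F2 r2 where
      1: "finite F1" "F1 \<subseteq> topspace X" "h1 = finprod G (\<lambda>x. i x [^]\<^bsub>G\<^esub> (r1 x :: int)) F1" and
      2: "finite F2" "F2 \<subseteq> topspace X" "h2 = finprod G (\<lambda>x. i x [^]\<^bsub>G\<^esub> (r2 x :: int)) F2"
      by blast
    define q1 where "q1 x = (if x \<in> F1 then r1 x else 0)" for x
    define q2 where "q2 x = (if x \<in> F2 then r2 x else 0)" for x
    have c: "i x [^]\<^bsub>G\<^esub> (k :: int) \<in> carrier G" if "x \<in> F1 \<union> F2" for x k
      using that 1 2 iG by (intro G.int_pow_closed) auto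
    have "h1 = finprod G (\<lambda>x. i x [^]\<^bsub>G\<^esub> q1 x) (F1 \<union> F2)"
      unfolding 1(3) using 1 2 c
      by (intro G.finprod_mono_neutral_cong_left) (auto simp: q1_def)
    moreover have "h2 = finprod G (\<lambda>x. i x [^]\<^bsub>G\<^esub> q2 x) (F1 \<union> F2)"
      unfolding 2(3) using 1 2 c
      by (intro G.finprod_mono_neutral_cong_left) (auto simp: q2_def)
    ultimately have "h1 \<otimes>\<^bsub>G\<^esub> h2 =
        finprod G (\<lambda>x. i x [^]\<^bsub>G\<^esub> q1 x \<otimes>\<^bsub>G\<^esub> i x [^]\<^bsub>G\<^esub> q2 x) (F1 \<union> F2)"
      using c by (simp add: G.finprod_multf Pi_iff)
    also have "\<dots> = finprod G (\<lambda>x. i x [^]\<^bsub>G\<^esub> (q1 x + q2 x)) (F1 \<union> F2)"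
    proof (rule G.finprod_cong')
      fix x assume "x \<in> F1 \<union> F2"
      then have "i x \<in> carrier G" using 1 2 iG by auto
      then show "i x [^]\<^bsub>G\<^esub> q1 x \<otimes>\<^bsub>G\<^esub> i x [^]\<^bsub>G\<^esub> q2 x = i x [^]\<^bsub>G\<^esub> (q1 x + q2 x)"
        by (simp add: G.int_pow_mult)
    qed (use c in auto)
    finally show ?case
      using 1 2 by (intro exI [of _ "F1 \<union> F2"] exI [of _ "\<lambda>x. q1 x + q2 x"]) auto
  qed
  then obtain F r where Fr: "finite F" "F \<subseteq> topspace X"
      "g = finprod G (\<lambda>x. i x [^]\<^bsub>G\<^esub> (r x :: int)) F" by blast
  have c: "i x [^]\<^bsub>G\<^esub> (k :: int) \<in> carrier G" if "x \<in> F" for x k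
    using that Fr iG by (intro G.int_pow_closed) auto
  have "g = finprod G (\<lambda>x. i x [^]\<^bsub>G\<^esub> r x) {x \<in> F. r x \<noteq> 0}"
    unfolding Fr(3) using Fr(1) c
    by (intro G.finprod_mono_neutral_cong_right) auto
  with Fr have "reduced_representation X G i {x \<in> F. r x \<noteq> 0} r g"
    by (auto simp: reduced_representation_def)
  then show thesis by (rule that)
qed

lemma reduced_representation_unique:
  assumes free: "free_Abelian_topological_group X G T i" and X: "Tychonoff_space X"
    and r: "reduced_representation X G i F r g" and r': "reduced_representation X G i F' r' g"
  shows "F = F' \<and> (\<forall>x \<in> F. r x = r' x)"
proof -
  interpret G: comm_group G
    using free by (simp add: free_Abelian_topological_group_def Abelian_topological_group_def)
  have iG: "i ` topspace X \<subseteq> carrier G"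
    using free by (auto simp: free_Abelian_topological_group_def Abelian_topological_group_def
        continuous_map_def)
  define R :: "real monoid" where "R = \<lparr>carrier = UNIV, mult = (+), one = 0\<rparr>"
  have Rg: "comm_group R"
    by (rule comm_groupI) (auto simp: R_def intro: exI [of _ "- _"] add.left_inverse)
  interpret R: comm_group R by (rule Rg)
  have Rsimps: "carrier R = UNIV" "x \<otimes>\<^bsub>R\<^esub> y = x + y" "\<one>\<^bsub>R\<^esub> = 0" for x y
    by (simp_all add: R_def)
  have invR: "inv\<^bsub>R\<^esub> a = - a" for a
    by (rule R.inv_equality) (auto simp: R_def)
  have R: "Abelian_topological_group R euclideanreal"
    unfolding Abelian_topological_group_def Tychonoff_space_def
    unfolding invR using Rg
    by (auto simp: metrizable_imp_completely_regular_space metrizable_space_euclidean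
        split_def R_def intro!: continuous_intros)
  have powR: "a [^]\<^bsub>R\<^esub> (k :: int) = of_int k * a" for a k
  proof (induction k rule: int_induct [of _ 0])
    case base show ?case by (simp add: R_def)
  next
    case (step1 k)
    have "a [^]\<^bsub>R\<^esub> (k + 1) = a [^]\<^bsub>R\<^esub> k \<otimes>\<^bsub>R\<^esub> a [^]\<^bsub>R\<^esub> (1 :: int)"
      by (rule R.int_pow_mult) (simp add: R_def)
    also have "\<dots> = a [^]\<^bsub>R\<^esub> k + a" by (subst R.int_pow_1) (simp_all add: R_def)
    finally show ?case using step1 by (simp add: algebra_simps)
  next
    case (step2 k)
    have "a [^]\<^bsub>R\<^esub> k = a [^]\<^bsub>R\<^esub> ((k - 1) + 1)" by simp
    also have "\<dots> = a [^]\<^bsub>R\<^esub> (k - 1) \<otimes>\<^bsub>R\<^esub> a [^]\<^bsub>R\<^esub> (1 :: int)"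
      by (rule R.int_pow_mult) (simp add: R_def)
    also have "\<dots> = a [^]\<^bsub>R\<^esub> (k - 1) + a" by (subst R.int_pow_1) (simp_all add: R_def)
    finally show ?case using step2 by (simp add: algebra_simps)
  qed
  have finR: "finprod R u B = sum u B" if "finite B" for u and B :: "'a set"
    using that by (induction B rule: finite_induct) (simp_all add: Rsimps)
  have coeff: "(if x \<in> F then r x else 0) = (if x \<in> F' then r' x else 0)"
    if x: "x \<in> topspace X" for x
  proof -
    let ?S = "(F \<union> F') - {x}"
    have "finite ?S" "?S \<subseteq> topspace X" using r r' by (auto simp: reduced_representation_def)
    then have "closedin X ?S"
      using X by (simp add: Tychonoff_space_def closedin_Hausdorff_finite)
    then obtain f0 :: "'a \<Rightarrow> real" where f0: "continuous_map X (top_of_set {0..1}) f0"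
        "f0 x = 0" "f0 ` ?S \<subseteq> {1}"
      using X x unfolding Tychonoff_space_def completely_regular_space_def by blast
    define f where "f y = 1 - f0 y" for y
    have "continuous_map X euclideanreal f"
      using f0(1) unfolding f_def
      by (intro continuous_intros) (auto simp: continuous_map_in_subtopology)
    then obtain h where h: "h \<in> hom G R" and hi: "\<And>x. x \<in> topspace X \<Longrightarrow> h (i x) = f x"
      using free_Abelian_topological_group_universal [OF free R] by metis
    interpret h: group_hom G R h
      using h by (simp add: group_hom_def group_hom_axioms_def)
    have *: "h g = (if x \<in> B then of_int (q x) else 0)"
      if q: "reduced_representation X G i B q g" and B: "B \<subseteq> F \<union> F'" for B q
    proof -
      have fin: "finite B" and BX: "B \<subseteq> topspace X"
        and g: "g = finprod G (\<lambda>x. i x [^]\<^bsub>G\<^esub> q x) B"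
        using q by (auto simp: reduced_representation_def)
      have "h (finprod G (\<lambda>x. i x [^]\<^bsub>G\<^esub> q x) B) = (\<Sum>y\<in>B. of_int (q y) * f y)"
        using fin BX
      proof (induction B rule: finite_induct)
        case empty
        show ?case using h.hom_one by (simp add: R_def)
      next
        case (insert b B)
        have "i y [^]\<^bsub>G\<^esub> q y \<in> carrier G" if "y \<in> insert b B" for y
          using that insert iG by (intro G.int_pow_closed) auto
        moreover from this have "finprod G (\<lambda>x. i x [^]\<^bsub>G\<^esub> q x) B \<in> carrier G"
          by (intro G.finprod_closed) auto
        moreover have "h (i b [^]\<^bsub>G\<^esub> q b) = of_int (q b) * f b"
          using insert iG hi by (subst h.hom_int_pow) (auto simp: powR)
        ultimately show ?case
          using insert by (simp add: Pi_iff Rsimps)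
      qed
      also have "\<dots> = (\<Sum>y\<in>B. if y = x then of_int (q x) else 0)"
        using f0(2,3) B by (intro sum.cong) (auto simp: f_def)
      finally show ?thesis using g fin by simp
    qed
    have "real_of_int (if x \<in> F then r x else 0) = of_int (if x \<in> F' then r' x else 0)"
      using * [OF r] * [OF r'] by (auto split: if_splits)
    then show ?thesis by (simp only: of_int_eq_iff)
  qed
  have "F \<subseteq> topspace X" "F' \<subseteq> topspace X" "\<forall>x\<in>F. r x \<noteq> 0" "\<forall>x\<in>F'. r' x \<noteq> 0"
    using r r' by (auto simp: reduced_representation_def)
  with coeff show ?thesis by (metis subset_iff subset_antisym)
qed

lemma reduced_length_eq:
  assumes "free_Abelian_topological_group X G T i" "Tychonoff_space X"
    and r: "reduced_representation X G i F r g"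
  shows "reduced_length X G i g = (\<Sum>x\<in>F. nat \<bar>r x\<bar>)"
  unfolding reduced_length_def
proof (rule the_equality)
  show "\<exists>F' r'. reduced_representation X G i F' r' g \<and>
      (\<Sum>x\<in>F. nat \<bar>r x\<bar>) = (\<Sum>x\<in>F'. nat \<bar>r' x\<bar>)"
    using r by blast
next
  fix m assume "\<exists>F' r'. reduced_representation X G i F' r' g \<and> m = (\<Sum>x\<in>F'. nat \<bar>r' x\<bar>)"
  then obtain F' r' where r': "reduced_representation X G i F' r' g"
      "m = (\<Sum>x\<in>F'. nat \<bar>r' x\<bar>)" by blast
  with reduced_representation_unique [OF assms r'(1)]
  show "m = (\<Sum>x\<in>F. nat \<bar>r x\<bar>)" by simp
qed

end

theory Submission
  imports Defs
begin

text \<open>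
  Two kinds of configurations in \<open>X\<close> prevent \<open>A(X)\<close> and \<open>A\<^sub>4(X)\<close> from being \<open>k\<^sub>R\<close>-spaces. The
  first consists of nontrivial convergent sequences \<open>d n m \<rightarrow> c n\<close> such that points chosen from
  different rows never have a convergent subsequence (a Q-array), together with points \<open>B n m\<close>
  whose rows shrink to a point \<open>b\<close> although no row has a convergent subsequence. Then \<open>0\<close> is in the
  closure of the elements \<open>(B n m - b) + (d n m - c n)\<close>. Bump functions at the points involved
  extend to homomorphisms \<open>A(X) \<rightarrow> \<real>\<close>, and only finitely many products of these extensions are
  nonzero on a given compact set: otherwise a linear combination of bumps, continuous on \<open>X\<close>, would
  have an extension that is unbounded on a compact set. The sum of the products is therefore
  continuous on compact sets, but not at \<open>0\<close>. The second configuration is an uncountable family of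
  convergent sequences \<open>d \<alpha> n \<rightarrow> c \<alpha>\<close> of which every compact set meets only finitely many; here the
  elements \<open>(d \<alpha> n - c \<alpha>) + (d \<beta> n - c \<beta>)\<close> with \<open>n\<close> depending suitably on \<open>\<alpha>\<close> and \<open>\<beta>\<close> do the same.

  A stratifiable \<open>k\<close>-space with a compact-countable \<open>k\<close>-network and no Q-array is metrizable: it is
  Frechet, its non-isolated points form a compact set, and that set has a countable family
  of open sets containing a base at each of its points. If \<open>X\<close> has a Q-array, the absence of the
  first configuration yields a \<open>k\<close>-network of relatively compact sets, and the absence of the second
  one shows that only countably many of them contain nontrivial convergent sequences; the closure
  of these under meeting closures is the \<open>k\<^sub>\<omega>\<close>-summand.

  Conversely, if \<open>X\<close> is the sum of a \<open>k\<^sub>\<omega>\<close>-space and a discrete space, the finest topology on \<open>A(X)\<close>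
  that agrees with the given one on all translates of the sums of the compact sets is a Tychonoff
  group topology, so by the universal property it is the topology of \<open>A(X)\<close>.
\<close>

text \<open>Why products of two extensions, and hence length four: bumps placed at all points of a
  sequence converging to \<open>c n\<close> cannot be compact-finite, because that sequence together
  with its limit is compact. The tested elements are therefore sums of two differences, indexed by
  pairs. On a compact set the bumps at one point confine one coordinate of the index and the bumps
  at the other point confine the other coordinate. Nothing is used of the subspace except that it
  contains all elements of length at most 4, so one argument serves both \<open>A(X)\<close> and
  A_4(X). Stratifiability enters mostly through open sets \<open>g n x\<close> with a single
  property, \<open>g_limit\<close>: points chosen from such sets with growing index converge only to
  limits of the centres. Bumps supported in them thus add no limits of their own. In the converse
  direction the obstacle is joint continuity of the group operation in the topology determined by
  compact sets. It holds because, up to translation, countably many compact sets suffice, so that a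
  neighbourhood of the unit can be thickened along one compact set after the other
  (\<open>weak_split\<close>).\<close>

section \<open>Metrizability from countably many functions\<close>

text \<open>Urysohn's metrization argument, with a countable base required only at the zeros of
  \<open>u\<close>; all other points are isolated. For \<open>u = 0\<close> it gives Urysohn's
  theorem, and in \<open>no_Q_array_imp_metrizable\<close> the function \<open>u\<close> is positive
  exactly at the isolated points.\<close>

lemma metrizable_space_from_countable_functions:
  fixes X :: "'a topology" and u :: "'a \<Rightarrow> real"
  assumes cr: "completely_regular_space X" and haus: "Hausdorff_space X"
    and W: "countable \<W>" "\<And>W. W \<in> \<W> \<Longrightarrow> openin X W"
    and u0: "\<And>x. 0 \<le> u x" and uo: "\<And>e. e > 0 \<Longrightarrow> openin X {x \<in> topspace X. u x < e}"
    and iso: "\<And>x. x \<in> topspace X \<Longrightarrow> u x > 0 \<Longrightarrow> openin X {x}"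
    and base: "\<And>x U. openin X U \<Longrightarrow> x \<in> U \<Longrightarrow> u x = 0 \<Longrightarrow> \<exists>W\<in>\<W>. x \<in> W \<and> W \<subseteq> U"
  shows "metrizable_space X"
proof -
  define sep :: "'a set \<Rightarrow> 'a set \<Rightarrow> ('a \<Rightarrow> real) \<Rightarrow> bool" where
    "sep V W f \<longleftrightarrow> continuous_map X euclideanreal f \<and> (\<forall>x\<in>V. f x = 0) \<and> (\<forall>x\<in>topspace X - W. f x = 1)"
    for V W f
  define Q where "Q = {p \<in> \<W> \<times> \<W>. \<exists>f. sep (fst p) (snd p) f}"
  have cQ: "countable Q"
    unfolding Q_def by (rule countable_subset [of _ "\<W> \<times> \<W>"]) (use W in auto)
  define F where "F p = (SOME f. sep (fst p) (snd p) f)" for p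
  have F: "sep (fst p) (snd p) (F p)" if "p \<in> Q" for p
    using that unfolding Q_def F_def by (metis (mono_tags, lifting) mem_Collect_eq someI_ex)
  define f :: "nat \<Rightarrow> 'a \<Rightarrow> real" where
    "f k = (if Q = {} then (\<lambda>_. 0) else F (from_nat_into Q k))" for k
  have fc: "continuous_map X euclideanreal (f k)" for k
    using F [OF from_nat_into] by (auto simp: f_def sep_def)
  have key: "\<exists>k. f k x = 0 \<and> (\<forall>y\<in>topspace X - U. f k y = 1)"
    if U: "openin X U" "x \<in> U" "u x = 0" for x U
  proof -
    obtain W2 where W2: "W2 \<in> \<W>" "x \<in> W2" "W2 \<subseteq> U" using base U by metis
    have "closedin X (topspace X - W2)" "x \<in> topspace X - (topspace X - W2)"
      using W W2 openin_subset U by fastforce+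
    then obtain h where h: "continuous_map X euclideanreal h" "h x = (0::real)"
        "h ` (topspace X - W2) \<subseteq> {1}"
      using cr unfolding completely_regular_space_alt by meson
    have "openin X {y \<in> topspace X. h y \<in> {..<1/2}}"
      using h(1) by (rule openin_continuous_map_preimage) simp
    moreover have "x \<in> {y \<in> topspace X. h y \<in> {..<1/2}}"
      using h(2) U openin_subset by fastforce
    ultimately obtain W1 where W1: "W1 \<in> \<W>" "x \<in> W1" "W1 \<subseteq> {y \<in> topspace X. h y \<in> {..<1/2}}"
      using base [OF _ _ U(3)] by meson
    \<comment> \<open>\<open>h\<close> is only known to vanish at \<open>x\<close>. Rescaled and
      truncated, it vanishes on all of \<open>W1\<close> and so becomes a witness for the pair
      \<open>(W1, W2)\<close>; one function per pair is a countable supply.\<close>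
    have "sep W1 W2 (\<lambda>y. max 0 (2 * h y - 1))"
      unfolding sep_def
    proof (intro conjI ballI)
      show "continuous_map X euclideanreal (\<lambda>y. max 0 (2 * h y - 1))"
        by (intro continuous_intros h(1))
      show "max 0 (2 * h y - 1) = 0" if "y \<in> W1" for y using W1(3) that by auto
      show "max 0 (2 * h y - 1) = 1" if "y \<in> topspace X - W2" for y
      proof -
        have "h y = 1" using h(3) that by blast
        then show ?thesis by simp
      qed
    qed
    then have "(W1, W2) \<in> Q" using W1 W2 by (auto simp: Q_def)
    then obtain k where "from_nat_into Q k = (W1, W2)" "Q \<noteq> {}"
      using cQ by (metis empty_iff from_nat_into_surj)
    moreover have "sep W1 W2 (F (W1, W2))" using F [OF \<open>(W1, W2) \<in> Q\<close>] by simp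
    ultimately show ?thesis using W1 W2 unfolding sep_def f_def by (intro exI [of _ k]) auto
  qed
  define \<Phi> where "\<Phi> x = (\<lambda>k. f k x)" for x
  have \<Phi>: "continuous_map X euclidean \<Phi>"
  proof -
    have "continuous_map X (product_topology (\<lambda>_. euclideanreal) UNIV) \<Phi>"
      using fc by (simp add: continuous_map_componentwise_UNIV \<Phi>_def)
    then show ?thesis by (simp add: euclidean_product_topology)
  qed
  \<comment> \<open>The term \<open>max (u x) (u y)\<close> isolates the points with \<open>u x > 0\<close>, of which there may be
    uncountably many.\<close>
  define d where "d x y = (if x = y then 0 else dist (\<Phi> x) (\<Phi> y) + max (u x) (u y))" for x y
  have sepx: "\<Phi> x \<noteq> \<Phi> y" if xy: "x \<in> topspace X" "y \<in> topspace X" "x \<noteq> y" "u x = 0" for x y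
  proof -
    have "openin X (topspace X - {y})"
      using haus xy(2) by (simp add: Hausdorff_imp_t1_space closedin_t1_singleton openin_diff)
    then obtain k where "f k x = 0" "f k y = 1" using key [of "topspace X - {y}" x] xy by auto
    then show ?thesis unfolding \<Phi>_def by (metis zero_neq_one)
  qed
  interpret d: Metric_space "topspace X" d
  proof
    show "0 \<le> d x y" for x y using u0 [of x] u0 [of y] by (auto simp: d_def)
    show "d x y = d y x" for x y by (auto simp: d_def dist_commute)
    show "d x y = 0 \<longleftrightarrow> x = y" if "x \<in> topspace X" "y \<in> topspace X" for x y
    proof (cases "x = y")
      case False
      have "dist (\<Phi> x) (\<Phi> y) + max (u x) (u y) \<noteq> 0"
      proof (cases "u x = 0")
        case True
        with sepx that False have "dist (\<Phi> x) (\<Phi> y) > 0" by simp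
        then show ?thesis using u0 [of x] u0 [of y] by linarith
      next
        case nz: False
        then have "u x > 0" using u0 [of x] by linarith
        then show ?thesis using zero_le_dist [of "\<Phi> x" "\<Phi> y"] by linarith
      qed
      then show ?thesis using False by (simp add: d_def)
    qed (simp add: d_def)
    show "d x z \<le> d x y + d y z" for x y z
      using dist_triangle [of "\<Phi> x" "\<Phi> z" "\<Phi> y"] u0 [of x] u0 [of y] u0 [of z]
        zero_le_dist [of "\<Phi> x" "\<Phi> y"] zero_le_dist [of "\<Phi> y" "\<Phi> z"]
      by (auto simp: d_def)
  qed
  have "openin d.mtopology U \<longleftrightarrow> openin X U" for U
  proof
    assume U: "openin d.mtopology U"
    show "openin X U"
    proof (subst openin_subopen, intro ballI)
      fix x assume x: "x \<in> U"
      then obtain r where r: "r > 0" "d.mball x r \<subseteq> U" using U d.openin_mtopology by blast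
      have xX: "x \<in> topspace X" using U x d.openin_mtopology by auto
      show "\<exists>T. openin X T \<and> x \<in> T \<and> T \<subseteq> U"
      proof (cases "u x = 0")
        case False
        then have "openin X {x}" using iso xX u0 [of x] by (simp add: less_eq_real_def)
        with x show ?thesis by blast
      next
        case True
        define T where "T = {y \<in> topspace X. \<Phi> y \<in> ball (\<Phi> x) (r/2)} \<inter> {y \<in> topspace X. u y < r/2}"
        have "openin X T" unfolding T_def
          using \<Phi> uo [of "r/2"] r by (intro openin_Int openin_continuous_map_preimage) auto
        moreover have "x \<in> T" using xX True r by (simp add: T_def)
        moreover have "T \<subseteq> d.mball x r"
          using xX True r by (auto simp: T_def d_def)
        ultimately show ?thesis using r by blast
      qed
    qed
  next
    assume U: "openin X U"
    show "openin d.mtopology U"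
      unfolding d.openin_mtopology
    proof (intro conjI allI impI)
      show "U \<subseteq> topspace X" using U openin_subset by auto
      fix x assume x: "x \<in> U"
      show "\<exists>r>0. d.mball x r \<subseteq> U"
      proof (cases "u x = 0")
        case False
        then have "u x > 0" using u0 [of x] by linarith
        moreover have "d.mball x (u x) \<subseteq> U"
        proof
          fix y assume "y \<in> d.mball x (u x)"
          then have "d x y < u x" by simp
          then have "x = y"
            using zero_le_dist [of "\<Phi> x" "\<Phi> y"] max.cobounded1 [of "u x" "u y"]
            unfolding d_def by (smt (verit))
          then show "y \<in> U" using x by simp
        qed
        ultimately show ?thesis by blast
      next
        case True
        obtain k where k: "f k x = 0" "\<forall>y\<in>topspace X - U. f k y = 1" using key [OF U x True] by blast
        have "open ((\<lambda>\<phi>::nat\<Rightarrow>real. \<phi> k) -` {..<1})"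
          by (intro open_vimage open_lessThan continuous_on_product_coordinates)
        moreover have "\<Phi> x \<in> (\<lambda>\<phi>. \<phi> k) -` {..<1}" using k by (simp add: \<Phi>_def)
        ultimately obtain r where r: "r > 0" "ball (\<Phi> x) r \<subseteq> (\<lambda>\<phi>. \<phi> k) -` {..<1}"
          by (rule openE)
        have "d.mball x r \<subseteq> U"
        proof
          fix y assume y: "y \<in> d.mball x r"
          show "y \<in> U"
          proof (cases "x = y")
            case False
            then have "dist (\<Phi> x) (\<Phi> y) < r" using y u0 [of x] u0 [of y] by (auto simp: d_def)
            then have "f k y < 1" using r(2) by (auto simp: \<Phi>_def subset_iff)
            then show ?thesis using k(2) y by force
          qed (use x in simp)
        qed
        with r show ?thesis by blast
      qed
    qed
  qed
  then have "d.mtopology = X" by (simp add: topology_eq)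
  then show ?thesis using d.metrizable_space_mtopology by simp
qed

lemma regular_space_closure_nbhd:
  assumes X: "regular_space X" and U: "openin X U" "x \<in> U"
  obtains V where "openin X V" "x \<in> V" "X closure_of V \<subseteq> U"
proof -
  have "closedin X (topspace X - U)" "x \<in> topspace X - (topspace X - U)"
    using U openin_subset by fastforce+
  then obtain V W where V: "openin X V" "openin X W" "x \<in> V" "topspace X - U \<subseteq> W" "disjnt V W"
    using X unfolding regular_space_def by metis
  have "X closure_of V \<subseteq> topspace X - W"
    using V openin_subset by (intro closure_of_minimal) (fastforce simp: disjnt_iff)+
  also have "\<dots> \<subseteq> U" using V(4) by auto
  finally show thesis using that V by blast
qed

section \<open>Metrizability of compact sets and its consequences for sequences\<close>

lemma k_networkD:
  assumes "k_network X \<P>" "compactin X K" "openin X U" "K \<subseteq> U"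
  obtains F where "F \<subseteq> \<P>" "finite F" "K \<subseteq> \<Union>F" "\<Union>F \<subseteq> U"
proof -
  have "\<exists>F\<subseteq>\<P>. finite F \<and> K \<subseteq> \<Union>F \<and> \<Union>F \<subseteq> U"
    using assms(1) [unfolded k_network_def, THEN conjunct2, rule_format, of K U] assms by simp
  then show thesis using that by (elim exE conjE)
qed

text \<open>The relative interiors of \<open>K - \<Union>F\<close>, for finite families
  \<open>F\<close> of members meeting \<open>K\<close>, form a base: the compact set
  \<open>K - V\<close> is covered by finitely many members that miss a smaller neighbourhood of the
  given point. Compact-countability makes this base countable.\<close>

lemma second_countable_compact_k_network:
  assumes reg: "regular_space X"
    and P: "k_network X \<P>" "compact_countable X \<P>" and K: "compactin X K"
  shows "second_countable (subtopology X K)"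
proof -
  define PK where "PK = {P \<in> \<P>. P \<inter> K \<noteq> {}}"
  have cPK: "countable PK" using P K by (simp add: PK_def compact_countable_def)
  define \<W> where "\<W> = (\<lambda>F. subtopology X K interior_of (K - \<Union>F)) ` {F. finite F \<and> F \<subseteq> PK}"
  have KX: "K \<subseteq> topspace X" using K compactin_subset_topspace by blast
  show ?thesis
    unfolding second_countable_def
  proof (intro exI [of _ \<W>] conjI ballI allI impI)
    show "countable \<W>"
      unfolding \<W>_def using countable_Collect_finite_subset [OF cPK] by auto
    show "\<exists>W\<in>\<W>. x \<in> W \<and> W \<subseteq> U" if "openin (subtopology X K) U \<and> x \<in> U" for x U
    proof -
      have U: "openin (subtopology X K) U" "x \<in> U" using that by auto
      obtain O' where O': "openin X O'" "U = O' \<inter> K" using U by (auto simp: openin_subtopology)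
      obtain V where V: "openin X V" "x \<in> V" "X closure_of V \<subseteq> O'"
        using regular_space_closure_nbhd [OF reg, of O' x] O' U(2) by blast
      obtain V' where V': "openin X V'" "x \<in> V'" "X closure_of V' \<subseteq> V"
        using regular_space_closure_nbhd [OF reg V(1,2)] by blast
      have VV: "V' \<subseteq> X closure_of V'" "V \<subseteq> X closure_of V"
        using V V' by (simp_all add: closure_of_subset openin_subset)
      define C' where "C' = X closure_of V'"
      have C': "closedin X C'" "V' \<subseteq> C'" "C' \<subseteq> V" using V' VV by (auto simp: C'_def)
      have "compactin X (K - V)"
      proof -
        have "(topspace X - V) \<inter> K = K - V" using KX by auto
        then show ?thesis
          using closed_Int_compactin [of X "topspace X - V" K] K V(1) by (simp add: closedin_diff)
      qed
      moreover have "openin X (topspace X - C')" using C' by (simp add: openin_diff)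
      moreover have "K - V \<subseteq> topspace X - C'" using C' KX by auto
      ultimately obtain F where F: "F \<subseteq> \<P>" "finite F" "K - V \<subseteq> \<Union>F" "\<Union>F \<subseteq> topspace X - C'"
        by (rule k_networkD [OF P(1)])
      define F' where "F' = F \<inter> PK"
      have KF: "K - \<Union>F' = K - \<Union>F" unfolding F'_def PK_def using F(1) by blast
      have "openin (subtopology X K) (V' \<inter> K)" using V' by (auto simp: openin_subtopology)
      moreover have "V' \<inter> K \<subseteq> K - \<Union>F'" unfolding KF using F C' by blast
      ultimately have "V' \<inter> K \<subseteq> subtopology X K interior_of (K - \<Union>F')"
        by (rule interior_of_maximal [rotated])
      moreover have "subtopology X K interior_of (K - \<Union>F') \<subseteq> K - \<Union>F'" by (rule interior_of_subset)
      moreover have "K - \<Union>F' \<subseteq> U" unfolding KF using F VV V O' by blast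
      moreover have "x \<in> V' \<inter> K" using V' U O' by auto
      moreover have "finite F' \<and> F' \<subseteq> PK" using F by (auto simp: F'_def)
      ultimately show ?thesis
        unfolding \<W>_def
        by (intro bexI [of _ "subtopology X K interior_of (K - \<Union>F')"] conjI) (auto dest: subsetD)
    qed
    show "openin (subtopology X K) W" if "W \<in> \<W>" for W using that by (auto simp: \<W>_def)
  qed
qed

lemma second_countable_Tychonoff_imp_metrizable:
  assumes X: "Tychonoff_space X" and sc: "second_countable X"
  shows "metrizable_space X"
proof -
  obtain \<W> where \<W>: "countable \<W>" "\<And>W. W \<in> \<W> \<Longrightarrow> openin X W"
      "\<And>x U. openin X U \<Longrightarrow> x \<in> U \<Longrightarrow> \<exists>W\<in>\<W>. x \<in> W \<and> W \<subseteq> U"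
    using sc unfolding second_countable_def by metis
  show ?thesis
  proof (rule metrizable_space_from_countable_functions [where \<W> = \<W> and u = "\<lambda>_. 0"])
    show "openin X {x \<in> topspace X. 0 < e}" if "e > 0" for e :: real
      using that openin_topspace [of X] by (simp del: openin_topspace)
  qed (use X \<W> in \<open>auto simp: Tychonoff_space_def\<close>)
qed

lemma metrizable_space_compact_k_network:
  assumes X: "Tychonoff_space X" and P: "k_network X \<P>" "compact_countable X \<P>" and K: "compactin X K"
  shows "metrizable_space (subtopology X K)"
proof (rule second_countable_Tychonoff_imp_metrizable)
  show "Tychonoff_space (subtopology X K)"
    using X by (simp add: Tychonoff_space_def completely_regular_space_subtopology Hausdorff_space_subtopology)
  show "second_countable (subtopology X K)"
    using X P K second_countable_compact_k_network
    by (metis Tychonoff_space_def completely_regular_imp_regular_space)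
qed

lemma compact_metrizable_convergent_subsequence:
  assumes K: "compactin X K" and m: "metrizable_space (subtopology X K)" and s: "range s \<subseteq> K"
  obtains r p where "strict_mono (r :: nat \<Rightarrow> nat)" "p \<in> K" "limitin X (\<lambda>k. s (r k)) p sequentially"
proof -
  obtain M d where M: "Metric_space M d" "subtopology X K = Metric_space.mtopology M d"
    using m by (auto simp: metrizable_space_def)
  interpret M: Metric_space M d by (rule M)
  have KX: "K \<subseteq> topspace X" using K compactin_subset_topspace by blast
  have MK: "M = K" using M(2) KX by (metis M.topspace_mtopology topspace_subtopology_subset)
  have "compact_space M.mtopology" using K M(2) compact_space_subtopology by metis
  then have "\<forall>\<sigma>::nat\<Rightarrow>_. range \<sigma> \<subseteq> M \<longrightarrow> (\<exists>l r. l \<in> M \<and> strict_mono r \<and> limitin M.mtopology (\<sigma> \<circ> r) l sequentially)"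
    using M.compact_space_sequentially by blast
  then obtain l r where "l \<in> M" "strict_mono r" "limitin (subtopology X K) (s \<circ> r) l sequentially"
    using s M MK by metis
  then show thesis using that [of r l] by (auto simp: limitin_subtopology MK o_def)
qed

lemma metrizable_sequentially_closed:
  assumes m: "metrizable_space (subtopology X K)" and K: "K \<subseteq> topspace X" and C: "C \<subseteq> K"
    and s: "\<And>s p. range s \<subseteq> C \<Longrightarrow> limitin X s p sequentially \<Longrightarrow> p \<in> K \<Longrightarrow> p \<in> C"
  shows "closedin (subtopology X K) C"
proof -
  obtain M d where M: "Metric_space M d" "subtopology X K = Metric_space.mtopology M d"
    using m by (auto simp: metrizable_space_def)
  interpret M: Metric_space M d by (rule M)
  have MK: "M = K" using M(2) K by (metis M.topspace_mtopology topspace_subtopology_subset)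
  show ?thesis
    unfolding M(2) M.metric_closedin_iff_sequentially_closed
  proof (intro conjI allI impI)
    show "C \<subseteq> M" using C MK by simp
    fix t l assume *: "range t \<subseteq> C \<and> limitin M.mtopology t l sequentially"
    then have "limitin X t l sequentially" "l \<in> K"
      using limitin_subtopology [of X K] unfolding M(2) [symmetric] by auto
    then show "l \<in> C" using s [of t l] * by simp
  qed
qed

text \<open>Compact sets detect closedness in a k-space, and inside metrizable compact sets
  sequences do.\<close>

lemma k_space_sequentially_closed:
  assumes k: "k_space X" and m: "\<And>K. compactin X K \<Longrightarrow> metrizable_space (subtopology X K)"
    and C: "C \<subseteq> topspace X"
    and s: "\<And>s p. range s \<subseteq> C \<Longrightarrow> limitin X s p sequentially \<Longrightarrow> p \<in> C"
  shows "closedin X C"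
proof -
  have "closedin (subtopology X K) (K \<inter> C)" if K: "compactin X K" for K
    by (rule metrizable_sequentially_closed [OF m [OF K] compactin_subset_topspace [OF K]]) (use s in auto)
  then show ?thesis using k C unfolding k_space by metis
qed

section \<open>Stratifications\<close>

locale stratified =
  fixes X :: "'a topology" and S :: "'a set \<Rightarrow> nat \<Rightarrow> 'a set"
  assumes haus: "Hausdorff_space X"
    and S_open: "openin X U \<Longrightarrow> openin X (S U n)"
    and S_closure: "openin X U \<Longrightarrow> X closure_of (S U n) \<subseteq> U"
    and S_cover: "openin X U \<Longrightarrow> (\<Union>n. S U n) = U"
    and S_mono: "openin X U \<Longrightarrow> openin X V \<Longrightarrow> U \<subseteq> V \<Longrightarrow> S U n \<subseteq> S V n"
    and S_incr: "openin X U \<Longrightarrow> m \<le> n \<Longrightarrow> S U m \<subseteq> S U n"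

lemma stratifiable_imp_stratified:
  assumes "Hausdorff_space X" "stratifiable_space X"
  obtains S where "stratified X S"
proof -
  obtain S :: "'a set \<Rightarrow> nat \<Rightarrow> 'a set" where
    S: "\<And>U n. openin X U \<Longrightarrow> openin X (S U n)" "\<And>U n. openin X U \<Longrightarrow> X closure_of (S U n) \<subseteq> U"
      "\<And>U. openin X U \<Longrightarrow> (\<Union>n. S U n) = U"
      "\<And>U V n. openin X U \<Longrightarrow> openin X V \<Longrightarrow> U \<subseteq> V \<Longrightarrow> S U n \<subseteq> S V n"
    using assms(2) unfolding stratifiable_space_def by metis
  \<comment> \<open>Finite unions make the stratification increasing in \<open>n\<close>, as
    \<open>S_incr\<close> requires, and keep the closures inside \<open>U\<close>.\<close>
  have "stratified X (\<lambda>U n. \<Union>k\<le>n. S U k)"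
  proof
    show "Hausdorff_space X" by (rule assms)
    show "openin X (\<Union>k\<le>n. S U k)" if "openin X U" for U n using S(1) [OF that] by blast
    show "X closure_of (\<Union>k\<le>n. S U k) \<subseteq> U" if "openin X U" for U n
      using S(2) [OF that] by (subst closure_of_Union) auto
    show "(\<Union>n. \<Union>k\<le>n. S U k) = U" if "openin X U" for U
      using S(3) [OF that] by fastforce
    show "(\<Union>k\<le>n. S U k) \<subseteq> (\<Union>k\<le>n. S V k)" if "openin X U" "openin X V" "U \<subseteq> V" for U V n
      using S(4) [OF that] by blast
    show "(\<Union>k\<le>m. S U k) \<subseteq> (\<Union>k\<le>n. S U k)" if "m \<le> n" for U m n using that by force
  qed
  then show thesis by (rule that)
qed

definition no_convergent_subsequence :: "'a topology \<Rightarrow> (nat \<Rightarrow> 'a) \<Rightarrow> bool" where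
  "no_convergent_subsequence X s \<longleftrightarrow>
     (\<forall>r p. strict_mono r \<longrightarrow> \<not> limitin X (\<lambda>k. s (r k)) p sequentially)"

context stratified begin

lemma openin_delete: "openin X (topspace X - {x})"
proof (cases "x \<in> topspace X")
  case True
  then show ?thesis using haus by (simp add: Hausdorff_imp_t1_space closedin_t1_singleton openin_diff)
qed simp

text \<open>The neighbourhood assignment associated with a stratification: by monotonicity, deleting
  the single point \<open>x\<close> handles all open sets omitting \<open>x\<close> at once, so that
  \<open>g n x\<close> misses \<open>S U n\<close> for each of them
  (\<open>g_disjoint\<close>).\<close>

definition g :: "nat \<Rightarrow> 'a \<Rightarrow> 'a set" where
  "g n x = topspace X - X closure_of (S (topspace X - {x}) n)"

lemma g_open: "openin X (g n x)"
  by (simp add: g_def openin_diff)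

lemma g_self: "x \<in> topspace X \<Longrightarrow> x \<in> g n x"
  using S_closure [OF openin_delete, of x n] by (auto simp: g_def)

lemma g_disjoint:
  assumes "openin X U" "x \<notin> U" "y \<in> g n x"
  shows "y \<notin> S U n"
proof
  assume y: "y \<in> S U n"
  have "U \<subseteq> topspace X - {x}" using assms openin_subset by blast
  then have "S U n \<subseteq> S (topspace X - {x}) n" using S_mono [OF assms(1) openin_delete] by blast
  also have "\<dots> \<subseteq> X closure_of (S (topspace X - {x}) n)"
    by (intro closure_of_subset openin_subset S_open openin_delete)
  finally show False using y assms(3) by (auto simp: g_def)
qed

text \<open>If \<open>x k\<close> were outside a neighbourhood \<open>U\<close> of \<open>p\<close>,
  then \<open>y k\<close> would miss \<open>S U (r k)\<close>, which for large \<open>k\<close>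
  contains a fixed neighbourhood \<open>S U N\<close> of \<open>p\<close>. This is how centres are
  exchanged for nearby points, or for points in the supports of bumps, without losing control of
  limits.\<close>

lemma g_limit:
  assumes r: "strict_mono r" and y: "\<And>k. y k \<in> g (r k) (x k)" and x: "range x \<subseteq> topspace X"
    and lim: "limitin X y p sequentially"
  shows "limitin X x p sequentially"
  unfolding limitin_sequentially
proof (intro conjI allI impI)
  show "p \<in> topspace X" using lim by (rule limitin_topspace)
  fix U assume U: "openin X U \<and> p \<in> U"
  then obtain N where N: "p \<in> S U N" using S_cover by blast
  have "openin X (S U N)" using U S_open by blast
  then obtain M where M: "\<And>k. k \<ge> M \<Longrightarrow> y k \<in> S U N" using lim N unfolding limitin_sequentially by blast
  have "x k \<in> U" if k: "k \<ge> max M N" for k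
  proof (rule ccontr)
    assume "x k \<notin> U"
    then have "y k \<notin> S U (r k)" using g_disjoint U y by blast
    moreover have "N \<le> r k" using seq_suble [OF r, of k] k by linarith
    ultimately show False using M [of k] S_incr [of U N "r k"] U k by auto
  qed
  then show "\<exists>N. \<forall>k\<ge>N. x k \<in> U" by blast
qed

lemma limit_in_closed:
  assumes "closedin X C" "limitin X s p sequentially" "\<And>k. k \<ge> N \<Longrightarrow> s k \<in> C"
  shows "p \<in> C"
  using limitin_closedin [OF assms(2,1)] assms(3) eventually_sequentially by auto

text \<open>A well-ordering of the cover assigns to each point the first member containing it.
  Sorting these members by the stratum whose closure contains such a point gives finite classes
  \<open>H n\<close>, hence a countable subcover; for countable covers the usual sequence argument
  is enough.\<close>

lemma compactin_if_sequentially_compact: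
  assumes C: "closedin X C"
    and sc: "\<And>s. range s \<subseteq> C \<Longrightarrow> \<not> no_convergent_subsequence X s"
  shows "compactin X C"
  unfolding compactin_def
proof (intro conjI allI impI)
  show "C \<subseteq> topspace X" using C closedin_subset by auto
  fix \<U> assume "Ball \<U> (openin X) \<and> C \<subseteq> \<Union>\<U>"
  then have \<U>: "\<And>U. U \<in> \<U> \<Longrightarrow> openin X U" and cov: "C \<subseteq> \<Union>\<U>" by auto
  obtain ro :: "'a set rel" where ro0: "Well_order ro \<and> Field ro = UNIV" using well_ordering ..
  then have ro: "Well_order ro" "Field ro = UNIV" by auto
  define R where "R = ro - Id"
  have wf: "wf R" using ro unfolding R_def well_order_on_def by blast
  have tot: "(U, V) \<in> R \<or> (V, U) \<in> R" if "U \<noteq> V" for U V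
    using ro that unfolding R_def well_order_on_def linear_order_on_def total_on_def by auto
  have "\<exists>U. U \<in> \<U> \<and> x \<in> U \<and> (\<forall>V. (V, U) \<in> R \<longrightarrow> V \<in> \<U> \<longrightarrow> x \<notin> V)" if "x \<in> C" for x
  proof -
    obtain U0 where "U0 \<in> {U \<in> \<U>. x \<in> U}" using cov \<open>x \<in> C\<close> by auto
    then have "\<exists>U\<in>{U \<in> \<U>. x \<in> U}. \<forall>V. (V, U) \<in> R \<longrightarrow> V \<notin> {U \<in> \<U>. x \<in> U}"
      by (rule wf [unfolded wf_eq_minimal, rule_format])
    then show ?thesis by auto
  qed
  then obtain \<alpha> where \<alpha>: "\<And>x. x \<in> C \<Longrightarrow> \<alpha> x \<in> \<U>" "\<And>x. x \<in> C \<Longrightarrow> x \<in> \<alpha> x"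
    and \<alpha>min: "\<And>x V. x \<in> C \<Longrightarrow> (V, \<alpha> x) \<in> R \<Longrightarrow> V \<in> \<U> \<Longrightarrow> x \<notin> V" by metis
  define H where "H n = {U. \<exists>x\<in>C. \<alpha> x = U \<and> x \<in> X closure_of (S U n)}" for n
  \<comment> \<open>A limit \<open>p\<close> of points witnessing infinitely many members of \<open>H n\<close> would belong to a member of
    the cover preceding \<open>\<alpha> p\<close>.\<close>
  have finH: "finite (H n)" for n
  proof (rule ccontr)
    assume "infinite (H n)"
    then obtain f :: "nat \<Rightarrow> 'a set" where f: "inj f" "range f \<subseteq> H n"
      using infinite_countable_subset by blast
    have "\<forall>k. \<exists>x\<in>C. \<alpha> x = f k \<and> x \<in> X closure_of (S (f k) n)" using f(2) unfolding H_def by blast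
    then obtain x where x: "\<And>k. x k \<in> C" "\<And>k. \<alpha> (x k) = f k" "\<And>k. x k \<in> X closure_of (S (f k) n)"
      by metis
    obtain r p where r: "strict_mono r" and p: "limitin X (\<lambda>k. x (r k)) p sequentially"
      using sc [of x] x(1) unfolding no_convergent_subsequence_def by blast
    have pC: "p \<in> C" using limit_in_closed [OF C p] x(1) by blast
    define V where "V = \<Union>{U \<in> \<U>. (U, \<alpha> p) \<in> R}"
    have V: "openin X V" unfolding V_def using \<U> by blast
    obtain M where M: "\<And>k. k \<ge> M \<Longrightarrow> x (r k) \<in> \<alpha> p"
      using p \<U> \<alpha> pC unfolding limitin_sequentially by meson
    have less: "(f (r k), \<alpha> p) \<in> R" if "k \<ge> M" "f (r k) \<noteq> \<alpha> p" for k
      using tot [OF that(2)] \<alpha>min [OF x(1), of "\<alpha> p" "r k"] x(2) \<alpha>(1) [OF pC] M [OF that(1)] by auto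
    have inC: "x (r k) \<in> X closure_of (S V n)" if "k \<ge> M" "f (r k) \<noteq> \<alpha> p" for k
    proof -
      have "f (r k) \<in> \<U>" using \<alpha>(1) x by metis
      then have "f (r k) \<subseteq> V" using less [OF that] by (auto simp: V_def)
      then have "S (f (r k)) n \<subseteq> S V n" using S_mono \<U> \<open>f (r k) \<in> \<U>\<close> V by blast
      then show ?thesis using x(3) [of "r k"] closure_of_mono by blast
    qed
    have "\<exists>N\<ge>M. \<forall>k\<ge>N. f (r k) \<noteq> \<alpha> p"
    proof (cases "\<exists>k0. f (r k0) = \<alpha> p")
      case True
      then obtain k0 where k0: "f (r k0) = \<alpha> p" by blast
      have "f (r k) \<noteq> \<alpha> p" if "k > k0" for k
        using f(1) r that k0 by (metis injD less_irrefl strict_mono_eq)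
      then show ?thesis by (intro exI [of _ "max M (Suc k0)"]) auto
    qed auto
    then obtain N where N: "N \<ge> M" "\<And>k. k \<ge> N \<Longrightarrow> f (r k) \<noteq> \<alpha> p" by blast
    have "p \<in> X closure_of (S V n)"
      by (rule limit_in_closed [OF closedin_closure_of p, of N]) (use inC N in auto)
    then have "p \<in> V" using S_closure [OF V] by blast
    then show False using \<alpha>min [OF pC] by (auto simp: V_def)
  qed
  define \<V> where "\<V> = (\<Union>n. H n)"
  have \<V>U: "\<V> \<subseteq> \<U>" using \<alpha>(1) by (auto simp: \<V>_def H_def)
  have \<V>c: "countable \<V>" unfolding \<V>_def using finH by (auto intro: countable_finite)
  have \<V>cov: "C \<subseteq> \<Union>\<V>"
  proof
    fix x assume x: "x \<in> C"
    then have "openin X (\<alpha> x)" using \<alpha> \<U> by blast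
    then obtain n where "x \<in> S (\<alpha> x) n" using S_cover \<alpha>(2) [OF x] by blast
    then have "x \<in> X closure_of (S (\<alpha> x) n)"
      using closure_of_subset [OF openin_subset [OF S_open [OF \<open>openin X (\<alpha> x)\<close>]]] by blast
    then have "\<alpha> x \<in> \<V>" using x by (auto simp: \<V>_def H_def)
    then show "x \<in> \<Union>\<V>" using \<alpha>(2) x by blast
  qed
  show "\<exists>\<F>. finite \<F> \<and> \<F> \<subseteq> \<U> \<and> C \<subseteq> \<Union>\<F>"
  proof (cases "C = {}")
    case False
    then have ne: "\<V> \<noteq> {}" using \<V>cov by auto
    define e where "e = from_nat_into \<V>"
    have e: "range e = \<V>" using ne \<V>c by (simp add: e_def range_from_nat_into)
    have "\<exists>k. C \<subseteq> \<Union>(e ` {..k})"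
    proof (rule ccontr)
      assume "\<nexists>k. C \<subseteq> \<Union>(e ` {..k})"
      then have "\<forall>k. \<exists>x. x \<in> C \<and> x \<notin> \<Union>(e ` {..k})" by blast
      then obtain x where x: "\<And>k. x k \<in> C" "\<And>k. x k \<notin> \<Union>(e ` {..k})" by metis
      obtain r p where r: "strict_mono r" and p: "limitin X (\<lambda>k. x (r k)) p sequentially"
        using sc [of x] x(1) unfolding no_convergent_subsequence_def by blast
      have pC: "p \<in> C" using limit_in_closed [OF C p] x(1) by blast
      then obtain i where i: "p \<in> e i" using \<V>cov e by blast
      have "openin X (e i)" using e \<V>U \<U> by blast
      then obtain M where M: "\<And>k. k \<ge> M \<Longrightarrow> x (r k) \<in> e i" using p i unfolding limitin_sequentially by blast
      have "i \<le> r (max M i)" using seq_suble [OF r, of "max M i"] by linarith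
      then show False using M [of "max M i"] x(2) [of "r (max M i)"] by auto
    qed
    then obtain k where "C \<subseteq> \<Union>(e ` {..k})" by blast
    then show ?thesis using e \<V>U by (intro exI [of _ "e ` {..k}"]) auto
  qed auto
qed

definition mu :: "'a \<Rightarrow> 'a set \<Rightarrow> 'a set" where
  "mu x U = (let n = (LEAST n. x \<in> S U n) in S U n \<inter> g n x)"

lemma mu:
  assumes U: "openin X U" "x \<in> U"
  shows "openin X (mu x U)" "x \<in> mu x U" "mu x U \<subseteq> U"
proof -
  have "\<exists>n. x \<in> S U n" using S_cover [OF U(1)] U(2) by blast
  then have "x \<in> S U (LEAST n. x \<in> S U n)" by (rule LeastI_ex)
  moreover have "x \<in> topspace X" using U openin_subset by blast
  ultimately show "x \<in> mu x U" using g_self by (simp add: mu_def Let_def)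
  show "openin X (mu x U)" unfolding mu_def Let_def by (intro openin_Int S_open g_open U)
  show "mu x U \<subseteq> U" unfolding mu_def Let_def using S_cover [OF U(1)] by blast
qed

text \<open>Compare the two least indices in \<open>mu\<close>: the point with the larger one has a
  \<open>g\<close>-neighbourhood that misses the stratum used for the other point, because the
  strata increase.\<close>

lemma monotone_normality:
  assumes U: "openin X U" and V: "openin X V" and xy: "x \<notin> V" "y \<notin> U"
  shows "mu x U \<inter> mu y V = {}"
proof -
  have *: "S V n \<inter> g m x = {}" if "n \<le> m" "x \<notin> V" "openin X V" for V x n m
    using g_disjoint [OF that(3,2)] S_incr [OF that(3,1)] by blast
  show ?thesis
    using * [of "LEAST n. x \<in> S U n" "LEAST n. y \<in> S V n" y U]
      * [of "LEAST n. y \<in> S V n" "LEAST n. x \<in> S U n" x V] U V xy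
      nat_le_linear [of "LEAST n. x \<in> S U n" "LEAST n. y \<in> S V n"]
    unfolding mu_def Let_def by blast
qed

text \<open>Monotone normality is applied twice: to get pairwise disjoint neighbourhoods
  \<open>B1 d\<close>, and to shrink them away from an open set \<open>G\<close> around the
  complement of their union. Then \<open>G\<close> and the sets \<open>B1 d\<close> form an open
  cover, each member of which meets at most one \<open>B d\<close>.\<close>

lemma discrete_expansion:
  assumes D: "\<And>E. E \<subseteq> D \<Longrightarrow> closedin X E"
  obtains B where "\<And>d. d \<in> D \<Longrightarrow> openin X (B d)" "\<And>d. d \<in> D \<Longrightarrow> d \<in> B d"
    "\<And>K. compactin X K \<Longrightarrow> finite {d \<in> D. B d \<inter> K \<noteq> {}}"
proof -
  define V where "V d = topspace X - (D - {d})" for d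
  have DX: "D \<subseteq> topspace X" using D [of D] closedin_subset by auto
  have V: "openin X (V d)" for d unfolding V_def using D [of "D - {d}"] by (auto simp: openin_diff)
  have dV: "d \<in> V d" if "d \<in> D" for d using that DX by (auto simp: V_def)
  define B1 where "B1 d = mu d (V d)" for d
  have B1: "openin X (B1 d)" "d \<in> B1 d" if "d \<in> D" for d
    using mu [OF V dV [OF that]] by (auto simp: B1_def)
  have disj: "B1 d \<inter> B1 d' = {}" if "d \<in> D" "d' \<in> D" "d \<noteq> d'" for d d'
    unfolding B1_def using that by (intro monotone_normality V) (auto simp: V_def)
  define W where "W = (\<Union>d\<in>D. B1 d)"
  have W: "openin X W" "D \<subseteq> W" unfolding W_def using B1 by auto
  define B where "B d = B1 d \<inter> mu d W" for d
  define G where "G = (\<Union>y\<in>topspace X - W. mu y (topspace X - D))"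
  have DD: "openin X (topspace X - D)" using D [of D] by (auto simp: openin_diff)
  have G: "openin X G" "topspace X - W \<subseteq> G"
    unfolding G_def using mu [OF DD] W(2) by blast+
  have GB: "G \<inter> B d = {}" if d: "d \<in> D" for d
  proof -
    have "mu y (topspace X - D) \<inter> mu d W = {}" if "y \<in> topspace X - W" for y
      by (rule monotone_normality [OF DD W(1)]) (use that d in auto)
    then show ?thesis by (auto simp: G_def B_def)
  qed
  show thesis
  proof
    show "openin X (B d)" "d \<in> B d" if "d \<in> D" for d
      using B1 [OF that] mu [OF W(1) subsetD [OF W(2) that]] by (simp_all add: B_def openin_Int)
    fix K assume K: "compactin X K"
    define \<N> where "\<N> = insert G (B1 ` D)"
    have "K \<subseteq> \<Union>\<N>" using G(2) compactin_subset_topspace [OF K] by (auto simp: \<N>_def W_def)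
    moreover have "\<And>N. N \<in> \<N> \<Longrightarrow> openin X N" using G B1 by (auto simp: \<N>_def)
    ultimately obtain F where F: "finite F" "F \<subseteq> \<N>" "K \<subseteq> \<Union>F" using compactinD [OF K] by metis
    have "finite {d \<in> D. B d \<inter> N \<noteq> {}}" if "N \<in> \<N>" for N
    proof (cases "N = G")
      case True
      then have "{d \<in> D. B d \<inter> N \<noteq> {}} = {}" using GB by blast
      then show ?thesis by (metis finite.emptyI)
    next
      case False
      then obtain d0 where d0: "d0 \<in> D" "N = B1 d0" using \<open>N \<in> \<N>\<close> by (auto simp: \<N>_def)
      have "{d \<in> D. B d \<inter> N \<noteq> {}} \<subseteq> {d0}" using disj d0 by (auto simp: B_def)
      then show ?thesis using finite_subset by blast
    qed
    then have "finite (\<Union>N\<in>F. {d \<in> D. B d \<inter> N \<noteq> {}})" using F by blast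
    moreover have "{d \<in> D. B d \<inter> K \<noteq> {}} \<subseteq> (\<Union>N\<in>F. {d \<in> D. B d \<inter> N \<noteq> {}})" using F(3) by blast
    ultimately show "finite {d \<in> D. B d \<inter> K \<noteq> {}}" using finite_subset by blast
  qed
qed

end

section \<open>Q-arrays\<close>

text \<open>The two facts about sequences that metrizable compact sets and the k-property provide;
  the later arguments about sequences in \<open>X\<close> rest on these alone.\<close>

locale sequential_stratified = stratified +
  assumes seq_compact: "compactin X K \<Longrightarrow> range s \<subseteq> K \<Longrightarrow>
      \<exists>r p. strict_mono (r :: nat \<Rightarrow> nat) \<and> p \<in> K \<and> limitin X (\<lambda>k. s (r k)) p sequentially"
    and seq_closed: "C \<subseteq> topspace X \<Longrightarrow>
      (\<And>s p. range s \<subseteq> C \<Longrightarrow> limitin X s p sequentially \<Longrightarrow> p \<in> C) \<Longrightarrow> closedin X C"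

text \<open>A common generalisation of the sequential fan, of Arens' space and of the sum of
  countably many convergent sequences.\<close>
definition Q_array :: "'a topology \<Rightarrow> (nat \<Rightarrow> 'a) \<Rightarrow> (nat \<Rightarrow> nat \<Rightarrow> 'a) \<Rightarrow> bool" where
  "Q_array X c d \<longleftrightarrow>
     (\<forall>n. limitin X (d n) (c n) sequentially) \<and> (\<forall>n m. d n m \<in> topspace X - {c n}) \<and>
     (\<forall>r m p. strict_mono r \<longrightarrow> \<not> limitin X (\<lambda>k. d (r k) (m k)) p sequentially)"

lemma limit_unique:
  "Hausdorff_space X \<Longrightarrow> limitin X s p sequentially \<Longrightarrow> limitin X s q sequentially \<Longrightarrow> p = q"
  using limitin_Hausdorff_unique trivial_limit_sequentially by metis

lemma limit_subseq:
  "strict_mono r \<Longrightarrow> limitin X s p sequentially \<Longrightarrow> limitin X (\<lambda>k. s (r k)) p sequentially"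
  using limitin_subsequence [of r X s p] by (simp add: o_def)

lemma compactin_limit_sequence:
  assumes "limitin X s p sequentially" "range s \<subseteq> topspace X"
  shows "compactin X (insert p (range s))"
  by (rule compactin_sequence_with_limit [OF assms(1) order_refl assms(2)])

context stratified begin

text \<open>After finitely many entries are dropped, row \<open>n\<close> lies in
  \<open>g n (c n)\<close>. Then \<open>g_limit\<close> makes the limits \<open>c (r k)\<close>
  converge together with the points chosen from the rows.\<close>

lemma no_Q_arrayD:
  assumes noQ: "\<And>c d. \<not> Q_array X c d"
    and lim: "\<And>n::nat. limitin X (d n) (c n) sequentially"
    and d: "\<And>n m. d n m \<in> topspace X - {c n}"
  obtains r m p where "strict_mono r" "limitin X (\<lambda>k. d (r k) (m k)) p sequentially"
    "limitin X (\<lambda>k. c (r k)) p sequentially"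
proof -
  have c: "c n \<in> topspace X" for n using lim limitin_topspace by metis
  have "\<exists>N. \<forall>m\<ge>N. d n m \<in> g n (c n)" for n
    using lim [of n] g_open g_self [OF c] unfolding limitin_sequentially by meson
  then obtain N where N: "\<And>n m. m \<ge> N n \<Longrightarrow> d n m \<in> g n (c n)" by metis
  define d' where "d' n m = d n (m + N n)" for n m
  have "limitin X (d' n) (c n) sequentially" for n
    unfolding d'_def using lim by (rule limitin_sequentially_offset)
  moreover have "d' n m \<in> topspace X - {c n}" for n m using d by (simp add: d'_def)
  ultimately obtain r m p where r: "strict_mono r" and p: "limitin X (\<lambda>k. d' (r k) (m k)) p sequentially"
    using noQ [of c d'] unfolding Q_array_def by metis
  have "limitin X (\<lambda>k. c (r k)) p sequentially"
    by (rule g_limit [OF r _ _ p]) (use c N in \<open>auto simp: d'_def\<close>)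
  then show thesis using that [of r "\<lambda>k. m k + N (r k)" p] r p by (simp add: d'_def)
qed

end

context sequential_stratified begin

text \<open>It suffices that the limits of sequences in \<open>A\<close> form a sequentially closed
  set, and \<open>no_Q_arrayD\<close> supplies the diagonal sequences needed for that.\<close>

lemma no_Q_array_Frechet:
  assumes noQ: "\<And>c d. \<not> Q_array X c d" and A: "A \<subseteq> topspace X" and x: "x \<in> X closure_of A"
  obtains s where "range s \<subseteq> A" "limitin X s x sequentially"
proof -
  define B where "B = {x. \<exists>s. range s \<subseteq> A \<and> limitin X s x sequentially}"
  have "closedin X B"
  proof (rule seq_closed)
    show "B \<subseteq> topspace X" unfolding B_def using limitin_topspace by fastforce
    fix s x assume s: "range s \<subseteq> B" and lim: "limitin X s x sequentially"
    show "x \<in> B"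
    \<comment> \<open>\<open>no_Q_arrayD\<close> needs rows that avoid their limits. This is
      automatic when the limits are outside \<open>A\<close>; if infinitely many of them are in
      \<open>A\<close>, they already form the desired sequence.\<close>
    proof (cases "\<forall>N. \<exists>n>N. s n \<in> A")
      case True
      then have "infinite {n. s n \<in> A}" by (metis (no_types, lifting) infinite_nat_iff_unbounded mem_Collect_eq)
      then obtain r :: "nat \<Rightarrow> nat" where "strict_mono r \<and> (\<forall>n. r n \<in> {n. s n \<in> A})"
        using infinite_enumerate [of "{n. s n \<in> A}"] by metis
      then have r: "strict_mono r" "\<And>n. r n \<in> {n. s n \<in> A}" by auto
      then have "range (\<lambda>k. s (r k)) \<subseteq> A" by auto
      then show ?thesis using limit_subseq [OF r(1) lim] unfolding B_def by blast
    next
      case False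
      then obtain N where N: "\<And>n. n > N \<Longrightarrow> s n \<notin> A" by blast
      define c where "c n = s (n + Suc N)" for n
      have c: "limitin X c x sequentially" unfolding c_def by (rule limitin_sequentially_offset [OF lim])
      have "\<forall>n. \<exists>t. range t \<subseteq> A \<and> limitin X t (c n) sequentially"
        using s unfolding B_def c_def by blast
      then obtain d where d: "\<And>n. range (d n) \<subseteq> A" "\<And>n. limitin X (d n) (c n) sequentially" by metis
      have cA: "c n \<notin> A" for n using N [of "n + Suc N"] by (simp add: c_def)
      have dA: "d n m \<in> A" for n m using d(1) by (rule range_subsetD)
      have "d n m \<in> topspace X - {c n}" for n m
        using dA [of n m] subsetD [OF A dA [of n m]] cA [of n] by auto
      then obtain r m p where r: "strict_mono r" "limitin X (\<lambda>k. d (r k) (m k)) p sequentially"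
          "limitin X (\<lambda>k. c (r k)) p sequentially"
        by (rule no_Q_arrayD [OF noQ d(2)])
      have "p = x" by (rule limit_unique [OF haus r(3) limit_subseq [OF r(1) c]])
      moreover have "range (\<lambda>k. d (r k) (m k)) \<subseteq> A" using dA by auto
      ultimately show ?thesis using r(2) unfolding B_def by blast
    qed
  qed
  moreover have "A \<subseteq> B"
  proof
    fix a assume "a \<in> A"
    then have "range (\<lambda>_::nat. a) \<subseteq> A" "limitin X (\<lambda>_::nat. a) a sequentially" using A by auto
    then show "a \<in> B" unfolding B_def by blast
  qed
  ultimately have "X closure_of A \<subseteq> B" by (simp add: closure_of_minimal)
  then show thesis using that x unfolding B_def by blast
qed

lemma no_Q_array_diagonal:
  assumes noQ: "\<And>c d. \<not> Q_array X c d"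
    and d: "\<And>n::nat. limitin X (d n) x sequentially" "\<And>n m. d n m \<in> topspace X - {x}"
  obtains r m where "strict_mono r" "limitin X (\<lambda>k. d (r k) (m k)) x sequentially"
proof -
  obtain r m p where r: "strict_mono r" "limitin X (\<lambda>k. d (r k) (m k)) p sequentially"
      "limitin X (\<lambda>k::nat. x) p sequentially"
    by (rule no_Q_arrayD [OF noQ, of d "\<lambda>_. x"]) (use d in auto)
  have "limitin X (\<lambda>k::nat. x) x sequentially" using limitin_topspace [OF d(1)] by simp
  then have "p = x" using limit_unique [OF haus r(3)] by blast
  then show thesis using that r by blast
qed

lemma interior_of_seq:
  assumes noQ: "\<And>c d. \<not> Q_array X c d" and x: "x \<in> topspace X" "x \<notin> X interior_of A"
  obtains s where "range s \<subseteq> topspace X - A" "limitin X s x sequentially"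
proof -
  have "x \<in> X closure_of (topspace X - A)" using x by (simp add: interior_of_closure_of)
  then show thesis using that by (rule no_Q_array_Frechet [OF noQ Diff_subset])
qed

end

section \<open>Metrizability in the absence of Q-arrays\<close>

locale k_network_stratified = sequential_stratified +
  fixes \<P> :: "'a set set"
  assumes Tych: "Tychonoff_space X"
    and kn: "k_network X \<P>" and cc: "compact_countable X \<P>"
begin

lemma reg: "regular_space X"
  using Tych by (simp add: Tychonoff_space_def completely_regular_imp_regular_space)

lemma point_countable: "x \<in> topspace X \<Longrightarrow> countable {P \<in> \<P>. x \<in> P}"
  using cc [unfolded compact_countable_def, rule_format, of "{x}"] by simp

text \<open>Otherwise pick for every finite \<open>F\<close> a sequence avoiding \<open>\<Union>F\<close>, and let \<open>G\<close> be a countable set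
  closed under adding the members of \<open>\<P>\<close> that meet the sequences chosen for its finite subsets:
  finitely many members of \<open>\<P>\<close> cannot cover a tail of a diagonal sequence.\<close>
lemma interior_cover_point:
  assumes noQ: "\<And>c d. \<not> Q_array X c d" and U: "openin X U" "x \<in> U"
  shows "\<exists>F. finite F \<and> F \<subseteq> \<P> \<and> \<Union>F \<subseteq> U \<and> x \<in> X interior_of (\<Union>F)"
proof (rule ccontr)
  assume none: "\<nexists>F. finite F \<and> F \<subseteq> \<P> \<and> \<Union>F \<subseteq> U \<and> x \<in> X interior_of (\<Union>F)"
  have xX: "x \<in> topspace X" using U openin_subset by blast
  define good where "good F \<longleftrightarrow> finite F \<and> F \<subseteq> \<P> \<and> \<Union>F \<subseteq> U" for F
  have "\<exists>s. range s \<subseteq> topspace X - \<Union>F \<and> limitin X s x sequentially" if "good F" for F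
  proof -
    have "x \<notin> X interior_of (\<Union>F)" using none that by (auto simp: good_def)
    then obtain s where "range s \<subseteq> topspace X - \<Union>F" "limitin X s x sequentially"
      by (rule interior_of_seq [OF noQ xX])
    then show ?thesis by blast
  qed
  then obtain Y where Y: "\<And>F. good F \<Longrightarrow> range (Y F) \<subseteq> topspace X - \<Union>F"
      "\<And>F. good F \<Longrightarrow> limitin X (Y F) x sequentially" by metis
  have cx: "compactin X {x}" "{x} \<subseteq> U" using xX U by simp_all
  obtain F0 where F0: "F0 \<subseteq> \<P>" "finite F0" "{x} \<subseteq> \<Union>F0" "\<Union>F0 \<subseteq> U"
    by (rule k_networkD [OF kn cx(1) U(1) cx(2)])
  from F0(3) obtain P0 where P0F: "P0 \<in> F0" "x \<in> P0" by auto
  have P0: "P0 \<in> \<P>" "x \<in> P0" "P0 \<subseteq> U" using P0F F0(1,4) by auto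
  define H where "H = rec_nat {P0} (\<lambda>_ A. A \<union> {P \<in> \<P>. P \<subseteq> U \<and> (\<exists>F\<in>{F. finite F \<and> F \<subseteq> A}. \<exists>j. Y F j \<in> P)})"
  have H0: "H 0 = {P0}" by (simp add: H_def)
  have HS: "H (Suc n) = H n \<union> {P \<in> \<P>. P \<subseteq> U \<and> (\<exists>F\<in>{F. finite F \<and> F \<subseteq> H n}. \<exists>j. Y F j \<in> P)}" for n
    by (simp add: H_def)
  have HU: "H n \<subseteq> {P \<in> \<P>. P \<subseteq> U}" for n by (induction n) (use P0 in \<open>auto simp: H0 HS\<close>)
  have good: "good F" if "finite F" "F \<subseteq> H n" for F n
    using that HU [of n] by (auto simp: good_def)
  have Hc: "countable (H n)" for n
  proof (induction n)
    case (Suc n)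
    have "{P \<in> \<P>. P \<subseteq> U \<and> (\<exists>F\<in>{F. finite F \<and> F \<subseteq> H n}. \<exists>j. Y F j \<in> P)}
        \<subseteq> (\<Union>F\<in>{F. finite F \<and> F \<subseteq> H n}. \<Union>j. {P \<in> \<P>. Y F j \<in> P})" by blast
    moreover have "countable (\<Union>F\<in>{F. finite F \<and> F \<subseteq> H n}. \<Union>j. {P \<in> \<P>. Y F j \<in> P})"
    proof (intro countable_UN countable_Collect_finite_subset Suc)
      fix F and j :: nat assume "F \<in> {F. finite F \<and> F \<subseteq> H n}"
      then have "Y F j \<in> topspace X" using Y(1) [OF good] by blast
      then show "countable {P \<in> \<P>. Y F j \<in> P}" by (rule point_countable)
    qed simp
    ultimately show ?case using Suc by (simp add: HS countable_subset)
  qed (simp add: H0)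
  have Hmono: "H m \<subseteq> H n" if "m \<le> n" for m n
    using that by (induction rule: dec_induct) (auto simp: HS)
  define G where "G = (\<Union>n. H n)"
  have Gc: "countable G" unfolding G_def using Hc by blast
  have finG: "\<exists>n. F \<subseteq> H n" if "finite F" "F \<subseteq> G" for F
    using that
  proof (induction F rule: finite_induct)
    case (insert P F)
    then obtain n m where "F \<subseteq> H n" "P \<in> H m" by (auto simp: G_def)
    then have "insert P F \<subseteq> H (max n m)" using Hmono [of n "max n m"] Hmono [of m "max n m"] by auto
    then show ?case by blast
  qed simp
  have goodG: "good F" if "finite F" "F \<subseteq> G" for F using finG [OF that] good that by blast
  have Gcl: "P \<in> G" if h: "finite F" "F \<subseteq> G" "P \<in> \<P>" "P \<subseteq> U" "Y F j \<in> P" for F P j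
  proof -
    obtain n where "F \<subseteq> H n" using finG [OF h(1,2)] ..
    then have "P \<in> H (Suc n)" unfolding HS using h by auto
    then show ?thesis unfolding G_def by blast
  qed
  have P0G: "P0 \<in> G" unfolding G_def using H0 by blast
  define e where "e = from_nat_into G"
  have e: "range e = G" using P0G Gc by (auto simp: e_def intro!: range_from_nat_into)
  \<comment> \<open>\<open>P0\<close> contains \<open>x\<close>, so including it makes the sequences
    \<open>Y (Fn n)\<close> avoid \<open>x\<close>, which \<open>no_Q_array_diagonal\<close>
    requires.\<close>
  define Fn where "Fn n = insert P0 (e ` {..n})" for n
  have Fn: "finite (Fn n)" "Fn n \<subseteq> G" for n using e P0G by (auto simp: Fn_def)
  have Yn: "range (Y (Fn n)) \<subseteq> topspace X - \<Union>(Fn n)" "limitin X (Y (Fn n)) x sequentially" for n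
    using Y goodG [OF Fn] by blast+
  have "Y (Fn n) m \<in> topspace X - {x}" for n m
    using Yn(1) [of n] P0(2) by (auto simp: Fn_def)
  then obtain r m where r: "strict_mono r" and zx: "limitin X (\<lambda>k. Y (Fn (r k)) (m k)) x sequentially"
    by (rule no_Q_array_diagonal [OF noQ Yn(2)])
  define z where "z k = Y (Fn (r k)) (m k)" for k
  obtain N where N: "\<And>k. k \<ge> N \<Longrightarrow> z k \<in> U"
    using zx U unfolding limitin_sequentially z_def by meson
  define K where "K = insert x (range (\<lambda>k. z (k + N)))"
  have "range (\<lambda>k. z (k + N)) \<subseteq> topspace X" using Yn(1) unfolding z_def by blast
  then have KK: "compactin X K"
    unfolding K_def using limitin_sequentially_offset [OF zx, of N]
    by (intro compactin_limit_sequence) (simp_all add: z_def)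
  have KU: "K \<subseteq> U" using U N by (auto simp: K_def)
  obtain F where F: "F \<subseteq> \<P>" "finite F" "K \<subseteq> \<Union>F" "\<Union>F \<subseteq> U"
    by (rule k_networkD [OF kn KK U(1) KU])
  have "\<exists>P\<in>F. infinite {k. z (k + N) \<in> P}"
  proof (rule ccontr)
    assume "\<not> (\<exists>P\<in>F. infinite {k. z (k + N) \<in> P})"
    then have "finite (\<Union>P\<in>F. {k. z (k + N) \<in> P})" using F(2) by blast
    moreover have "(\<Union>P\<in>F. {k. z (k + N) \<in> P}) = UNIV" using F(3) by (auto simp: K_def)
    ultimately show False by simp
  qed
  then obtain P where P: "P \<in> F" "infinite {k. z (k + N) \<in> P}" by blast
  then obtain k0 where "z (k0 + N) \<in> P" using not_finite_existsD by blast
  then have "P \<in> G"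
    unfolding z_def by (intro Gcl [OF Fn(1) Fn(2)]) (use F P in auto)
  then obtain i where i: "e i = P" using e by blast
  obtain k where k: "k \<ge> i" "z (k + N) \<in> P" using P(2) unfolding infinite_nat_iff_unbounded_le by blast
  have "i \<le> r (k + N)" using seq_suble [OF r, of "k + N"] k by linarith
  then have "P \<in> Fn (r (k + N))" using i by (auto simp: Fn_def)
  then show False using Yn(1) [of "r (k + N)"] k(2) unfolding z_def by blast
qed

definition min_covers :: "'a set \<Rightarrow> 'a set set set" where
  "min_covers K = {F. finite F \<and> F \<subseteq> \<P> \<and> K \<subseteq> X interior_of (\<Union>F) \<and>
      (\<forall>F'. F' \<subset> F \<longrightarrow> \<not> K \<subseteq> X interior_of (\<Union>F'))}"

text \<open>Mishchenko's counting argument.\<close>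
lemma countable_min_covers:
  assumes noQ: "\<And>c d. \<not> Q_array X c d" and K: "K \<subseteq> topspace X"
  shows "countable (min_covers K)"
proof (rule ccontr)
  assume unc: "uncountable (min_covers K)"
  have "min_covers K = (\<Union>n. {F \<in> min_covers K. card F = n})" by auto
  moreover have "countable (\<Union>n. {F \<in> min_covers K. card F = n})"
    if "\<And>n. countable {F \<in> min_covers K. card F = n}"
    using that by (intro countable_UN) auto
  ultimately have "\<exists>n. uncountable {F \<in> min_covers K. card F = n}"
    using unc by auto
  then obtain n where n: "uncountable {F \<in> min_covers K. card F = n}" ..
  define M where "M R = {F \<in> min_covers K. card F = n \<and> R \<subseteq> F}" for R
  define ok where "ok m \<longleftrightarrow> (\<exists>R. finite R \<and> card R = m \<and> uncountable (M R))" for m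
  have "ok 0" unfolding ok_def using n by (intro exI [of _ "{}"]) (simp add: M_def)
  moreover have "m \<le> n" if "ok m" for m
  proof -
    obtain R where R: "card R = m" "uncountable (M R)" using \<open>ok m\<close> unfolding ok_def by blast
    then have "M R \<noteq> {}" by auto
    then obtain F where "F \<in> M R" by blast
    then have "finite F" "R \<subseteq> F" "card F = n" by (auto simp: M_def min_covers_def)
    then show ?thesis using R card_mono by blast
  qed
  ultimately obtain m where m: "ok m" "\<And>m'. ok m' \<Longrightarrow> m' \<le> m"
    using ex_has_greatest_nat [of ok 0 "\<lambda>m. m" "Suc n"] by (auto simp: less_Suc_eq_le)
  obtain R where R: "finite R" "card R = m" "uncountable (M R)" using m(1) unfolding ok_def by blast
  have "\<exists>F\<in>M R. F \<noteq> R"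
  proof (rule ccontr)
    assume "\<not> (\<exists>F\<in>M R. F \<noteq> R)"
    then have "M R \<subseteq> {R}" by blast
    then have "countable (M R)" by (rule countable_subset) simp
    then show False using R(3) by simp
  qed
  then obtain F where F: "F \<in> M R" "R \<subset> F" by (auto simp: M_def)
  then have "\<not> K \<subseteq> X interior_of (\<Union>R)" by (auto simp: M_def min_covers_def)
  then obtain x where x: "x \<in> K" "x \<notin> X interior_of (\<Union>R)" by blast
  then obtain y where y: "range y \<subseteq> topspace X - \<Union>R" "limitin X y x sequentially"
    using interior_of_seq [OF noQ, of x "\<Union>R"] K by blast
  \<comment> \<open>The union of each \<open>F\<close> in \<open>M R\<close> is a neighbourhood of
    \<open>x\<close>, so some member of \<open>F\<close> meets the sequence \<open>y\<close>, while
    no member of \<open>R\<close> does. Only countably many candidates exist, so one of them can be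
    added to \<open>R\<close> with uncountably many covers left, against the maximality of
    \<open>m\<close>.\<close>
  define Z where "Z = (\<Union>k. {P \<in> \<P>. y k \<in> P})"
  have "countable Z" unfolding Z_def using y(1) by (intro countable_UN point_countable) auto
  moreover have "M R \<subseteq> (\<Union>P\<in>Z. M (insert P R) \<inter> {F. P \<notin> R})"
  proof
    fix F assume F: "F \<in> M R"
    then have "x \<in> X interior_of (\<Union>F)" using x(1) by (auto simp: M_def min_covers_def)
    moreover have "openin X (X interior_of (\<Union>F))" by simp
    ultimately obtain k where "y k \<in> X interior_of (\<Union>F)" using y(2) unfolding limitin_sequentially by blast
    then have "y k \<in> \<Union>F" using interior_of_subset [of X "\<Union>F"] by blast
    then obtain P where P: "P \<in> F" "y k \<in> P" by blast
    have "P \<notin> R" using P y(1) by blast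
    moreover have "P \<in> Z" using P F unfolding Z_def M_def min_covers_def by blast
    moreover have "F \<in> M (insert P R)" using P F by (auto simp: M_def)
    ultimately show "F \<in> (\<Union>P\<in>Z. M (insert P R) \<inter> {F. P \<notin> R})" by blast
  qed
  ultimately have "\<exists>P\<in>Z. uncountable (M (insert P R) \<inter> {F. P \<notin> R})"
    using R(3) by (meson countable_UN countable_subset)
  then obtain P where P: "uncountable (M (insert P R) \<inter> {F. P \<notin> R})" by blast
  then have "P \<notin> R" by (metis (mono_tags, lifting) Int_emptyI countable_empty mem_Collect_eq)
  moreover have "uncountable (M (insert P R))" using P countable_Int1 by blast
  ultimately have "ok (Suc m)" unfolding ok_def using R by (intro exI [of _ "insert P R"]) auto
  then show False using m(2) by fastforce
qed

lemma min_cover_exists: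
  assumes noQ: "\<And>c d. \<not> Q_array X c d" and K: "compactin X K" and U: "openin X U" "K \<subseteq> U"
  obtains F where "F \<in> min_covers K" "\<Union>F \<subseteq> U"
proof -
  obtain Fx where Fx: "\<And>x. x \<in> K \<Longrightarrow> finite (Fx x) \<and> Fx x \<subseteq> \<P> \<and> \<Union>(Fx x) \<subseteq> U \<and> x \<in> X interior_of (\<Union>(Fx x))"
    using interior_cover_point [OF noQ U(1)] U(2) by (metis subsetD)
  define \<C> where "\<C> = (\<lambda>x. X interior_of (\<Union>(Fx x))) ` K"
  have "\<And>C. C \<in> \<C> \<Longrightarrow> openin X C" "K \<subseteq> \<Union>\<C>" using Fx by (auto simp: \<C>_def)
  then obtain \<D> where \<D>: "finite \<D>" "\<D> \<subseteq> \<C>" "K \<subseteq> \<Union>\<D>" using compactinD [OF K, of \<C>] by metis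
  then obtain L where L: "finite L" "L \<subseteq> K" "\<D> = (\<lambda>x. X interior_of (\<Union>(Fx x))) ` L"
    unfolding \<C>_def using finite_subset_image by metis
  define F0 where "F0 = (\<Union>x\<in>L. Fx x)"
  have F0: "finite F0" "F0 \<subseteq> \<P>" "\<Union>F0 \<subseteq> U" using L Fx by (auto simp: F0_def) blast+
  have "X interior_of (\<Union>(Fx x)) \<subseteq> X interior_of (\<Union>F0)" if "x \<in> L" for x
    using that by (intro interior_of_mono) (auto simp: F0_def)
  then have KF0: "K \<subseteq> X interior_of (\<Union>F0)" using \<D>(3) L(3) by blast
  define \<A> where "\<A> = {F. F \<subseteq> F0 \<and> K \<subseteq> X interior_of (\<Union>F)}"
  have "finite \<A>" unfolding \<A>_def using F0(1) by simp
  moreover have "F0 \<in> \<A>" using KF0 by (simp add: \<A>_def)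
  ultimately obtain F where F: "F \<in> \<A>" "\<And>F'. F' \<in> \<A> \<Longrightarrow> F' \<subseteq> F \<Longrightarrow> F = F'"
    using finite_has_minimal2 [of \<A> F0] by metis
  have FF0: "F \<subseteq> F0" "K \<subseteq> X interior_of (\<Union>F)" using F(1) by (auto simp: \<A>_def)
  have "\<not> K \<subseteq> X interior_of (\<Union>F')" if "F' \<subset> F" for F'
    using F(2) [of F'] that FF0(1) unfolding \<A>_def by auto
  moreover have "finite F" using FF0(1) F0(1) by (rule finite_subset)
  ultimately have "F \<in> min_covers K"
    unfolding min_covers_def using FF0 F0(2) by auto
  moreover have "\<Union>F \<subseteq> U" using Union_mono [OF FF0(1)] F0(3) by (rule subset_trans)
  ultimately show thesis by (rule that)
qed

text \<open>Choosing a finite cover for every non-isolated point would give too many sets. Instead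
  the countable base of the compact set \<open>D\<close> is used: the closure of a basic set has
  only countably many minimal covers, and the interiors of their unions make up
  \<open>\<W>\<close>.\<close>

lemma no_Q_array_imp_metrizable:
  assumes noQ: "\<And>c d. \<not> Q_array X c d"
  shows "metrizable_space X"
proof -
  define I where "I = {x \<in> topspace X. openin X {x}}"
  define D where "D = topspace X - I"
  have Isub: "openin X J" if "J \<subseteq> I" for J
  proof -
    have "openin X (\<Union>x\<in>J. {x})" using that unfolding I_def by (intro openin_Union) auto
    then show ?thesis by simp
  qed
  have closedD: "closedin X D" unfolding D_def using Isub by (simp add: openin_closedin_eq [symmetric] closedin_diff)
  \<comment> \<open>Every sequence of non-isolated points is a sequence of limits of nontrivial
    rows, so \<open>no_Q_arrayD\<close> gives it a convergent subsequence.\<close>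
  have compD: "compactin X D"
  proof (rule compactin_if_sequentially_compact [OF closedD])
    fix c :: "nat \<Rightarrow> 'a" assume c: "range c \<subseteq> D"
    have "\<exists>s. range s \<subseteq> topspace X - {c n} \<and> limitin X s (c n) sequentially" for n
    proof -
      have cn: "c n \<in> topspace X" "\<not> openin X {c n}" using c unfolding D_def I_def by blast+
      have "c n \<notin> X interior_of {c n}"
      proof
        assume "c n \<in> X interior_of {c n}"
        then have "X interior_of {c n} = {c n}" using interior_of_subset [of X "{c n}"] by blast
        then show False using cn(2) openin_interior_of [of X "{c n}"] by simp
      qed
      then show ?thesis using interior_of_seq [OF noQ cn(1)] by metis
    qed
    then obtain d where d: "\<And>n. range (d n) \<subseteq> topspace X - {c n}" "\<And>n. limitin X (d n) (c n) sequentially"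
      by metis
    have "d n m \<in> topspace X - {c n}" for n m using d(1) by (rule range_subsetD)
    then obtain r m p where "strict_mono r" "limitin X (\<lambda>k. d (r k) (m k)) p sequentially"
        "limitin X (\<lambda>k. c (r k)) p sequentially"
      by (rule no_Q_arrayD [OF noQ d(2)])
    then show "\<not> no_convergent_subsequence X c" unfolding no_convergent_subsequence_def by blast
  qed
  obtain \<B> where \<B>: "countable \<B>" "\<And>B. B \<in> \<B> \<Longrightarrow> openin (subtopology X D) B"
    "\<And>U x. openin (subtopology X D) U \<Longrightarrow> x \<in> U \<Longrightarrow> \<exists>B\<in>\<B>. x \<in> B \<and> B \<subseteq> U"
    using second_countable_compact_k_network [OF reg kn cc compD] unfolding second_countable_def by metis
  define \<W> where "\<W> = (\<Union>B\<in>\<B>. (\<lambda>F. X interior_of (\<Union>F)) ` min_covers (X closure_of B))"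
  have openI: "openin X I" using Isub by simp
  \<comment> \<open>The stratification of the open set \<open>I\<close> measures the closeness of an
    isolated point to \<open>D\<close>: the complement of the closure of \<open>S I N\<close> is an
    open set containing \<open>D\<close> on which \<open>u\<close> is small, and any further points
    with small \<open>u\<close> are isolated.\<close>
  define v where "v x = (LEAST n. x \<in> X closure_of (S I n))" for x
  define u where "u x = (if x \<in> I then 1 / (1 + real (v x)) else 0)" for x
  show ?thesis
  proof (rule metrizable_space_from_countable_functions [where \<W> = \<W> and u = u])
    show "completely_regular_space X" "Hausdorff_space X" using Tych by (auto simp: Tychonoff_space_def)
    show "countable \<W>" unfolding \<W>_def
      by (intro countable_UN \<B> countable_image countable_min_covers noQ closure_of_subset_topspace)
    show "openin X W" if "W \<in> \<W>" for W using that by (auto simp: \<W>_def)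
    show "0 \<le> u x" for x by (simp add: u_def)
    show "openin X {x}" if "x \<in> topspace X" "u x > 0" for x
      using that by (auto simp: u_def I_def split: if_splits)
    show "openin X {x \<in> topspace X. u x < e}" if e: "e > 0" for e
    proof -
      obtain N where N: "1 / (1 + real N) < e"
        using e nat_approx_posE [of e] by (metis of_nat_Suc)
      have "u x < e" if x: "x \<notin> X closure_of (S I N)" for x
      proof (cases "x \<in> I")
        case True
        then obtain n where "x \<in> S I n" using S_cover [OF openI] by blast
        then have "x \<in> X closure_of (S I n)"
          using closure_of_subset [OF openin_subset [OF S_open [OF openI]]] by blast
        then have vx: "x \<in> X closure_of (S I (v x))" unfolding v_def by (rule LeastI)
        have "\<not> v x \<le> N"
        proof
          assume "v x \<le> N"
          then have "X closure_of (S I (v x)) \<subseteq> X closure_of (S I N)"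
            by (intro closure_of_mono S_incr openI)
          then show False using vx x by blast
        qed
        then have "1 / (1 + real (v x)) \<le> 1 / (1 + real N)" by (intro divide_left_mono) auto
        then show ?thesis using N True by (simp add: u_def)
      qed (use e in \<open>simp add: u_def\<close>)
      then have eq: "{x \<in> topspace X. u x < e} =
          (topspace X - X closure_of (S I N)) \<union> ({x \<in> topspace X. u x < e} \<inter> I)"
        using S_closure [OF openI, of N] by auto
      moreover have "openin X (topspace X - X closure_of (S I N))" by (simp add: openin_diff)
      moreover have "openin X ({x \<in> topspace X. u x < e} \<inter> I)" by (intro Isub) auto
      ultimately show ?thesis by (subst eq) (rule openin_Un)
    qed
    show "\<exists>W\<in>\<W>. x \<in> W \<and> W \<subseteq> U" if U: "openin X U" "x \<in> U" "u x = 0" for x U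
    proof -
      have "x \<notin> I" using U(3) by (auto simp: u_def split: if_splits)
      then have xD: "x \<in> D" using U openin_subset unfolding D_def by blast
      obtain V where V: "openin X V" "x \<in> V" "X closure_of V \<subseteq> U"
        using regular_space_closure_nbhd [OF reg U(1,2)] by blast
      have "openin (subtopology X D) (V \<inter> D)" using V by (auto simp: openin_subtopology)
      then obtain B where B: "B \<in> \<B>" "x \<in> B" "B \<subseteq> V \<inter> D" using \<B>(3) [of "V \<inter> D" x] V xD by blast
      have BK: "X closure_of B \<subseteq> X closure_of V" "X closure_of B \<subseteq> D"
        using B closure_of_mono [of B V X] closure_of_minimal [OF _ closedD] by auto
      have "compactin X (X closure_of B)"
        using closed_compactin [OF compD BK(2)] by simp
      then obtain F where F: "F \<in> min_covers (X closure_of B)" "\<Union>F \<subseteq> U"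
        using min_cover_exists [OF noQ _ U(1)] BK(1) V(3) by (metis subset_trans)
      have "B \<subseteq> topspace X" using B V openin_subset by blast
      then have "x \<in> X closure_of B" using B closure_of_subset by blast
      then have "x \<in> X interior_of (\<Union>F)" using F by (auto simp: min_covers_def)
      moreover have "X interior_of (\<Union>F) \<subseteq> U" using F(2) interior_of_subset [of X "\<Union>F"] by blast
      moreover have "X interior_of (\<Union>F) \<in> \<W>" using B(1) F(1) unfolding \<W>_def by blast
      ultimately show ?thesis by blast
    qed
  qed
qed

end

section \<open>Free Abelian topological groups\<close>

locale abelian_top_group = comm_group G
  for G :: "('g, 'm) monoid_scheme" (structure) and T :: "'g topology" +
  assumes top_group: "Abelian_topological_group G T"
begin

lemma topspace_T [simp]: "topspace T = carrier G"
  using top_group by (simp add: Abelian_topological_group_def)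

lemma TychT: "Tychonoff_space T"
  using top_group by (simp add: Abelian_topological_group_def)

lemma hausT: "Hausdorff_space T"
  using TychT by (simp add: Tychonoff_space_def)

lemma continuous_map_mult:
  assumes "continuous_map Y T u" "continuous_map Y T v"
  shows "continuous_map Y T (\<lambda>y. u y \<otimes> v y)"
proof -
  have "continuous_map (prod_topology T T) T (\<lambda>(x, y). x \<otimes> y)"
    using top_group by (simp add: Abelian_topological_group_def)
  moreover have "continuous_map Y (prod_topology T T) (\<lambda>y. (u y, v y))"
    using assms by (simp add: continuous_map_paired)
  ultimately show ?thesis
    using continuous_map_compose [of Y "prod_topology T T" "\<lambda>y. (u y, v y)" T "\<lambda>(x, y). x \<otimes> y"]
    by (simp add: o_def)
qed

lemma continuous_map_inv:
  assumes "continuous_map Y T u"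
  shows "continuous_map Y T (\<lambda>y. inv (u y))"
proof -
  have "continuous_map T T (\<lambda>x. inv x)"
    using top_group by (simp add: Abelian_topological_group_def)
  then show ?thesis using continuous_map_compose [OF assms] by (simp add: o_def)
qed

end

locale free_abelian_top_group = abelian_top_group G T
  for X :: "'a topology" and G :: "('g, 'm) monoid_scheme" (structure) and T :: "'g topology"
    and i :: "'a \<Rightarrow> 'g" +
  assumes free: "free_Abelian_topological_group X G T i" and TychX: "Tychonoff_space X"
begin

lemma i_cont: "continuous_map X T i"
  using free by (simp add: free_Abelian_topological_group_def)

lemma i_closed [simp]: "x \<in> topspace X \<Longrightarrow> i x \<in> carrier G"
  using continuous_map_image_subset_topspace [OF i_cont] by auto

definition rep :: "'g \<Rightarrow> 'a set \<Rightarrow> ('a \<Rightarrow> int) \<Rightarrow> bool" where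
  "rep a F r \<longleftrightarrow> finite F \<and> F \<subseteq> topspace X \<and> a = finprod G (\<lambda>x. i x [^] r x) F"

lemma rep_superset:
  assumes "rep a F r" "finite F'" "F \<subseteq> F'" "F' \<subseteq> topspace X"
  shows "rep a F' (\<lambda>x. if x \<in> F then r x else 0)"
  unfolding rep_def
proof (intro conjI assms)
  have "a = finprod G (\<lambda>x. i x [^] r x) F" using assms(1) by (simp add: rep_def)
  also have "\<dots> = finprod G (\<lambda>x. i x [^] (if x \<in> F then r x else 0)) F'"
    using assms by (intro finprod_mono_neutral_cong_left) auto
  finally show "a = finprod G (\<lambda>x. i x [^] (if x \<in> F then r x else 0)) F'" .
qed

lemma rep_mult:
  assumes "rep a F r" "rep b F q"
  shows "rep (a \<otimes> b) F (\<lambda>x. r x + q x)"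
proof -
  have F: "finite F" "F \<subseteq> topspace X" using assms by (auto simp: rep_def)
  have "a \<otimes> b = finprod G (\<lambda>x. i x [^] r x \<otimes> i x [^] q x) F"
    using assms F by (subst finprod_multf) (auto simp: rep_def)
  also have "\<dots> = finprod G (\<lambda>x. i x [^] (r x + q x)) F"
    using F by (intro finprod_cong') (auto simp: int_pow_mult)
  finally show ?thesis using F by (simp add: rep_def)
qed

text \<open>Any representation may witness the bound, reduced or not, which makes subadditivity
  easy; \<open>reduced_length_le_iff\<close> returns to the reduced length.\<close>

definition length_le :: "nat \<Rightarrow> 'g \<Rightarrow> bool" where
  "length_le n a \<longleftrightarrow> (\<exists>F r. rep a F r \<and> (\<Sum>x\<in>F. nat \<bar>r x\<bar>) \<le> n)"

lemma length_le_mult: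
  assumes "length_le n a" "length_le m b"
  shows "length_le (n + m) (a \<otimes> b)"
proof -
  obtain F r where F: "rep a F r" "(\<Sum>x\<in>F. nat \<bar>r x\<bar>) \<le> n" using assms(1) by (auto simp: length_le_def)
  obtain E q where E: "rep b E q" "(\<Sum>x\<in>E. nat \<bar>q x\<bar>) \<le> m" using assms(2) by (auto simp: length_le_def)
  define r' where "r' x = (if x \<in> F then r x else 0)" for x
  define q' where "q' x = (if x \<in> E then q x else 0)" for x
  have fin: "finite F" "finite E" "F \<union> E \<subseteq> topspace X" using E F by (auto simp: rep_def)
  have "rep a (F \<union> E) r'" unfolding r'_def by (rule rep_superset [OF F(1)]) (use fin in auto)
  moreover have "rep b (F \<union> E) q'" unfolding q'_def by (rule rep_superset [OF E(1)]) (use fin in auto)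
  ultimately have "rep (a \<otimes> b) (F \<union> E) (\<lambda>x. r' x + q' x)" by (rule rep_mult)
  moreover have "(\<Sum>x\<in>F \<union> E. nat \<bar>r' x + q' x\<bar>) \<le> n + m"
  proof -
    have "(\<Sum>x\<in>F \<union> E. nat \<bar>r' x + q' x\<bar>) \<le> (\<Sum>x\<in>F \<union> E. nat \<bar>r' x\<bar> + nat \<bar>q' x\<bar>)"
      by (intro sum_mono) linarith
    also have "\<dots> = (\<Sum>x\<in>F \<union> E. nat \<bar>r' x\<bar>) + (\<Sum>x\<in>F \<union> E. nat \<bar>q' x\<bar>)" by (rule sum.distrib)
    also have "(\<Sum>x\<in>F \<union> E. nat \<bar>r' x\<bar>) = (\<Sum>x\<in>F. nat \<bar>r x\<bar>)"
      using fin by (intro sum.mono_neutral_cong_right) (auto simp: r'_def)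
    also have "(\<Sum>x\<in>F \<union> E. nat \<bar>q' x\<bar>) = (\<Sum>x\<in>E. nat \<bar>q x\<bar>)"
      using fin by (intro sum.mono_neutral_cong_right) (auto simp: q'_def)
    finally show ?thesis using F(2) E(2) by linarith
  qed
  ultimately show ?thesis unfolding length_le_def by blast
qed

lemma length_le_generator: "x \<in> topspace X \<Longrightarrow> length_le 1 (i x)"
  unfolding length_le_def by (intro exI [of _ "{x}"] exI [of _ "\<lambda>_. 1"]) (auto simp: rep_def int_pow_1)

lemma length_le_inv_generator: "x \<in> topspace X \<Longrightarrow> length_le 1 (inv (i x))"
  unfolding length_le_def
  by (intro exI [of _ "{x}"] exI [of _ "\<lambda>_. -1"]) (auto simp: rep_def int_pow_neg int_pow_1)

lemma length_le_one: "length_le n \<one>"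
  unfolding length_le_def by (intro exI [of _ "{}"]) (simp add: rep_def)

lemma reduced_length_le_iff:
  assumes a: "a \<in> carrier G"
  shows "reduced_length X G i a \<le> n \<longleftrightarrow> length_le n a"
proof
  obtain F r where r: "reduced_representation X G i F r a"
    using reduced_representation_exists [OF free a] .
  have eq: "reduced_length X G i a = (\<Sum>x\<in>F. nat \<bar>r x\<bar>)" by (rule reduced_length_eq [OF free TychX r])
  {
    assume "reduced_length X G i a \<le> n"
    with eq r show "length_le n a" unfolding length_le_def rep_def reduced_representation_def by metis
  }
  assume "length_le n a"
  then obtain E q where q: "rep a E q" "(\<Sum>x\<in>E. nat \<bar>q x\<bar>) \<le> n" by (auto simp: length_le_def)
  define E' where "E' = {x \<in> E. q x \<noteq> 0}"
  have E: "finite E" "E \<subseteq> topspace X" using q by (auto simp: rep_def)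
  have "a = finprod G (\<lambda>x. i x [^] q x) E" using q by (simp add: rep_def)
  also have "\<dots> = finprod G (\<lambda>x. i x [^] q x) E'"
    using E by (intro finprod_mono_neutral_cong_right) (auto simp: E'_def)
  finally have "reduced_representation X G i E' q a"
    using E by (auto simp: reduced_representation_def E'_def)
  then have "reduced_length X G i a = (\<Sum>x\<in>E'. nat \<bar>q x\<bar>)" by (rule reduced_length_eq [OF free TychX])
  also have "\<dots> = (\<Sum>x\<in>E. nat \<bar>q x\<bar>)"
    using E by (intro sum.mono_neutral_cong_left) (auto simp: E'_def)
  finally show "reduced_length X G i a \<le> n" using q by simp
qed

definition real_extension :: "('a \<Rightarrow> real) \<Rightarrow> ('g \<Rightarrow> real) \<Rightarrow> bool" where
  "real_extension f h \<longleftrightarrow> continuous_map T euclideanreal h \<and>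
     (\<forall>a\<in>carrier G. \<forall>b\<in>carrier G. h (a \<otimes> b) = h a + h b) \<and> (\<forall>x\<in>topspace X. h (i x) = f x)"

lemma real_extension_exists:
  assumes f: "continuous_map X euclideanreal f"
  shows "\<exists>h. real_extension f h"
proof -
  define R :: "real monoid" where "R = \<lparr>carrier = UNIV, mult = (+), one = 0\<rparr>"
  have Rg: "comm_group R"
    by (rule comm_groupI) (auto simp: R_def intro: exI [of _ "- _"] add.left_inverse)
  interpret R: comm_group R by (rule Rg)
  have invR: "inv\<^bsub>R\<^esub> a = - a" for a
    by (rule R.inv_equality) (auto simp: R_def)
  have R: "Abelian_topological_group R euclideanreal"
    unfolding Abelian_topological_group_def Tychonoff_space_def invR
    using Rg by (auto simp: metrizable_imp_completely_regular_space metrizable_space_euclidean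
        split_def R_def intro!: continuous_intros)
  obtain h where "h \<in> hom G R" "continuous_map T euclideanreal h" "\<And>x. x \<in> topspace X \<Longrightarrow> h (i x) = f x"
    using free_Abelian_topological_group_universal [OF free R f] by metis
  then show ?thesis unfolding real_extension_def by (intro exI [of _ h]) (auto simp: hom_def R_def)
qed

definition ext :: "('a \<Rightarrow> real) \<Rightarrow> 'g \<Rightarrow> real" where
  "ext f = (SOME h. real_extension f h)"

lemma ext: "continuous_map X euclideanreal f \<Longrightarrow> real_extension f (ext f)"
  unfolding ext_def using real_extension_exists by (metis someI_ex)

context
  fixes f assumes f: "continuous_map X euclideanreal f"
begin

lemma ext_cont: "continuous_map T euclideanreal (ext f)"
  and ext_mult: "a \<in> carrier G \<Longrightarrow> b \<in> carrier G \<Longrightarrow> ext f (a \<otimes> b) = ext f a + ext f b"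
  and ext_i: "x \<in> topspace X \<Longrightarrow> ext f (i x) = f x"
  using ext [OF f] by (auto simp: real_extension_def)

lemma ext_one: "ext f \<one> = 0"
  using ext_mult [of \<one> \<one>] by simp

lemma ext_inv: "a \<in> carrier G \<Longrightarrow> ext f (inv a) = - ext f a"
  using ext_mult [of a "inv a"] ext_one by simp

lemma ext_int_pow: "a \<in> carrier G \<Longrightarrow> ext f (a [^] (k::int)) = of_int k * ext f a"
proof (induction k rule: int_induct [of _ 0])
  case base then show ?case by (simp add: ext_one)
next
  case (step1 k)
  have "a [^] (k + 1) = a [^] k \<otimes> a" using step1 by (simp add: int_pow_mult int_pow_1)
  then show ?case using step1 by (simp add: ext_mult algebra_simps)
next
  case (step2 k)
  have "a [^] k = a [^] ((k - 1) + 1)" by simp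
  also have "\<dots> = a [^] (k - 1) \<otimes> a" using step2 by (subst int_pow_mult) (simp_all add: int_pow_1)
  finally have "ext f (a [^] k) = ext f (a [^] (k - 1)) + ext f a" using step2 by (simp add: ext_mult)
  then show ?case using step2 by (simp add: algebra_simps)
qed

lemma ext_rep:
  assumes "rep a F r"
  shows "ext f a = (\<Sum>x\<in>F. of_int (r x) * f x)"
proof -
  have F: "finite F" "F \<subseteq> topspace X" and a: "a = finprod G (\<lambda>x. i x [^] r x) F"
    using assms by (auto simp: rep_def)
  from F have "ext f (finprod G (\<lambda>x. i x [^] r x) F) = (\<Sum>x\<in>F. of_int (r x) * f x)"
  proof (induction F rule: finite_induct)
    case (insert x F)
    then have "finprod G (\<lambda>x. i x [^] r x) F \<in> carrier G" by (intro finprod_closed) auto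
    then show ?case using insert by (simp add: Pi_iff ext_mult ext_int_pow ext_i subset_iff)
  qed (simp add: ext_one)
  then show ?thesis using a by simp
qed

end

lemma rep_exists:
  assumes "a \<in> carrier G"
  obtains F r where "rep a F r" "reduced_length X G i a = (\<Sum>x\<in>F. nat \<bar>r x\<bar>)"
proof -
  obtain F r where r: "reduced_representation X G i F r a"
    using reduced_representation_exists [OF free assms] .
  show thesis
    by (rule that [of F r]) (use r reduced_length_eq [OF free TychX r] in
        \<open>auto simp: rep_def reduced_representation_def\<close>)
qed

lemma bump:
  assumes "openin X U" "a \<in> U"
  obtains \<phi> where "continuous_map X euclideanreal \<phi>" "\<phi> a = 1" "\<And>x. x \<in> topspace X - U \<Longrightarrow> \<phi> x = 0"
    "\<And>x. 0 \<le> \<phi> x"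
proof -
  obtain h where h: "continuous_map X euclideanreal h" "h a = 1" "h ` (topspace X - U) \<subseteq> {0}"
    using TychX assms completely_regular_space_gen_alt' [of "1::real" 0 X]
    unfolding Tychonoff_space_def by force
  show thesis
  proof (rule that [of "\<lambda>x. max 0 (h x)"])
    show "continuous_map X euclideanreal (\<lambda>x. max 0 (h x))" by (intro continuous_intros h(1))
    show "max 0 (h x) = 0" if "x \<in> topspace X - U" for x
    proof -
      have "h x = 0" using h(3) that by auto
      then show ?thesis by simp
    qed
  qed (use h in auto)
qed

lemma finite_interpolation:
  fixes s :: "'a \<Rightarrow> real"
  assumes F: "finite F" "F \<subseteq> topspace X" and s: "\<And>x. x \<in> F \<Longrightarrow> \<bar>s x\<bar> \<le> 1"
  obtains f where "continuous_map X euclideanreal f" "\<And>x. x \<in> F \<Longrightarrow> f x = s x" "\<And>x. \<bar>f x\<bar> \<le> 1"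
proof -
  have "\<exists>\<phi>. continuous_map X euclideanreal \<phi> \<and> \<phi> x = 1 \<and> (\<forall>y\<in>F - {x}. \<phi> y = 0)" if x: "x \<in> F" for x
  proof -
    have "closedin X (F - {x})"
      using TychX F by (intro closedin_Hausdorff_finite) (auto simp: Tychonoff_space_def)
    then have U: "openin X (topspace X - (F - {x}))" by (simp add: openin_diff)
    have xU: "x \<in> topspace X - (F - {x})" using x F by auto
    obtain \<phi> where "continuous_map X euclideanreal \<phi>" "\<phi> x = 1"
        "\<And>y. y \<in> topspace X - (topspace X - (F - {x})) \<Longrightarrow> \<phi> y = 0" "\<And>y. 0 \<le> \<phi> y"
      using bump [OF U xU] by metis
    then show ?thesis using F by (intro exI [of _ \<phi>]) auto
  qed
  then obtain \<phi> where \<phi>: "\<And>x. x \<in> F \<Longrightarrow> continuous_map X euclideanreal (\<phi> x)"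
      "\<And>x. x \<in> F \<Longrightarrow> \<phi> x x = 1" "\<And>x y. x \<in> F \<Longrightarrow> y \<in> F - {x} \<Longrightarrow> \<phi> x y = 0" by metis
  define h where "h y = (\<Sum>x\<in>F. s x * \<phi> x y)" for y
  have hc: "continuous_map X euclideanreal h"
    unfolding h_def by (intro continuous_map_sum F continuous_map_real_mult \<phi>) simp
  have hs: "h y = s y" if "y \<in> F" for y
  proof -
    have "h y = (\<Sum>x\<in>F. if x = y then s y else 0)"
      unfolding h_def using \<phi> that by (intro sum.cong) auto
    then show ?thesis using F that by simp
  qed
  show thesis
  proof (rule that [of "\<lambda>y. max (-1) (min 1 (h y))"])
    show "continuous_map X euclideanreal (\<lambda>y. max (-1) (min 1 (h y)))" by (intro continuous_intros hc)
    show "max (-1) (min 1 (h y)) = s y" if "y \<in> F" for y using hs [OF that] s [OF that] by auto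
  qed auto
qed

text \<open>The reduced length is lower semicontinuous, being a supremum of continuous functions:
  \<open>ext f b\<close> is at most the length of \<open>b\<close> whenever \<open>f\<close> is
  bounded by 1 in absolute value, with equality if \<open>f\<close> interpolates the signs of the
  coefficients of \<open>b\<close>.\<close>

lemma closedin_length_le: "closedin T {a \<in> carrier G. reduced_length X G i a \<le> n}"
proof -
  have "openin T {a \<in> carrier G. \<not> reduced_length X G i a \<le> n}"
  proof (subst openin_subopen, intro ballI)
    fix a assume a: "a \<in> {a \<in> carrier G. \<not> reduced_length X G i a \<le> n}"
    then have aG: "a \<in> carrier G" by simp
    obtain F r where r: "rep a F r" "reduced_length X G i a = (\<Sum>x\<in>F. nat \<bar>r x\<bar>)"
      by (rule rep_exists [OF aG])
    have F: "finite F" "F \<subseteq> topspace X" using r by (auto simp: rep_def)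
    have sgn1: "\<bar>real_of_int (sgn (r x))\<bar> \<le> 1" for x by (simp add: sgn_if)
    obtain f where f: "continuous_map X euclideanreal f" "\<And>x. x \<in> F \<Longrightarrow> f x = of_int (sgn (r x))"
        "\<And>x. \<bar>f x\<bar> \<le> 1"
      using finite_interpolation [OF F, of "\<lambda>x. of_int (sgn (r x))"] sgn1 by metis
    have "ext f a = (\<Sum>x\<in>F. of_int (r x) * f x)" by (rule ext_rep [OF f(1) r(1)])
    also have "\<dots> = (\<Sum>x\<in>F. real (nat \<bar>r x\<bar>))"
    proof (rule sum.cong)
      fix x assume "x \<in> F"
      then have "of_int (r x) * f x = of_int (r x * sgn (r x))" using f(2) by simp
      also have "r x * sgn (r x) = \<bar>r x\<bar>" by (simp add: mult.commute mult_sgn_abs abs_sgn)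
      finally show "of_int (r x) * f x = real (nat \<bar>r x\<bar>)" by simp
    qed simp
    also have "\<dots> = real (reduced_length X G i a)" by (simp only: r(2) of_nat_sum)
    finally have fa: "ext f a > real n" using a by simp
    have "openin T {b \<in> topspace T. ext f b \<in> {real n<..}}"
      using ext_cont [OF f(1)] by (rule openin_continuous_map_preimage) simp
    moreover have "{b \<in> topspace T. ext f b \<in> {real n<..}} \<subseteq> {a \<in> carrier G. \<not> reduced_length X G i a \<le> n}"
    proof clarsimp
      fix b assume b: "b \<in> carrier G" "real n < ext f b" "reduced_length X G i b \<le> n"
      obtain E q where q: "rep b E q" "reduced_length X G i b = (\<Sum>x\<in>E. nat \<bar>q x\<bar>)"
        by (rule rep_exists [OF b(1)])
      have "ext f b = (\<Sum>x\<in>E. of_int (q x) * f x)" by (rule ext_rep [OF f(1) q(1)])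
      also have "\<dots> \<le> (\<Sum>x\<in>E. real (nat \<bar>q x\<bar>))"
      proof (rule sum_mono)
        fix x
        have "of_int (q x) * f x \<le> \<bar>of_int (q x)\<bar> * \<bar>f x\<bar>" by (metis abs_ge_self abs_mult)
        also have "\<dots> \<le> \<bar>of_int (q x)\<bar> * 1" by (intro mult_left_mono f(3)) simp
        finally show "of_int (q x) * f x \<le> real (nat \<bar>q x\<bar>)" by simp
      qed
      also have "\<dots> \<le> n" using b(3) q(2) by (metis of_nat_sum of_nat_le_iff)
      finally show False using b(2) by simp
    qed
    ultimately show "\<exists>U. openin T U \<and> a \<in> U \<and> U \<subseteq> {a \<in> carrier G. \<not> reduced_length X G i a \<le> n}"
      using a fa by (intro exI [of _ "{b \<in> topspace T. ext f b \<in> {real n<..}}"]) auto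
  qed
  moreover have "carrier G - {a \<in> carrier G. reduced_length X G i a \<le> n} = {a \<in> carrier G. \<not> reduced_length X G i a \<le> n}"
    by auto
  ultimately show ?thesis unfolding closedin_def by auto
qed

end

section \<open>Compact-finite families of functions and their extensions\<close>

fun triangular_solution :: "(nat \<Rightarrow> nat \<Rightarrow> real) \<Rightarrow> nat \<Rightarrow> real" where
  "triangular_solution M b = (real b - (\<Sum>a<b. triangular_solution M a * M a b)) / M b b"

declare triangular_solution.simps [simp del]

text \<open>Substitution in a triangular system with right-hand side 0, 1, 2, and so on; the growth
  of the right-hand side is what yields an unbounded function in
  \<open>compact_finite_ext_seq\<close>.\<close>

lemma triangular_solution: "M b b \<noteq> 0 \<Longrightarrow> (\<Sum>a\<le>b. triangular_solution M a * M a b) = real b"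
  unfolding lessThan_Suc_atMost [symmetric] sum.lessThan_Suc
  by (subst (2) triangular_solution.simps) simp

definition compact_finite :: "'a topology \<Rightarrow> 'j set \<Rightarrow> ('j \<Rightarrow> 'a \<Rightarrow> real) \<Rightarrow> bool" where
  "compact_finite X J \<phi> \<longleftrightarrow> (\<forall>K. compactin X K \<longrightarrow> finite {j \<in> J. \<exists>x\<in>K. \<phi> j x \<noteq> 0})"

text \<open>Assumption \<open>k\<close> is the common consequence of being a k-space and of being a
  k_R-space: the lemma is applied to \<open>X\<close> and to subspaces of \<open>A(X)\<close>.
  Summing over the nonzero terms only keeps the sum finite at every point even if \<open>J\<close>
  is infinite.\<close>

lemma continuous_map_compact_finite_sum:
  assumes k: "\<And>f. (\<And>K. compactin Y K \<Longrightarrow> continuous_map (subtopology Y K) euclideanreal f) \<Longrightarrow>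
      continuous_map Y euclideanreal f"
    and cf: "compact_finite Y J \<phi>" and \<phi>: "\<And>j. j \<in> J \<Longrightarrow> continuous_map Y euclideanreal (\<phi> j)"
  shows "continuous_map Y euclideanreal (\<lambda>x. \<Sum>j\<in>{j \<in> J. \<phi> j x \<noteq> 0}. \<phi> j x)"
proof (rule k)
  fix K assume K: "compactin Y K"
  define L where "L = {j \<in> J. \<exists>x\<in>K. \<phi> j x \<noteq> 0}"
  have L: "finite L" using cf K by (simp add: compact_finite_def L_def)
  have "continuous_map (subtopology Y K) euclideanreal (\<lambda>x. \<Sum>j\<in>L. \<phi> j x)"
    by (intro continuous_map_sum L continuous_map_from_subtopology \<phi>) (auto simp: L_def)
  then show "continuous_map (subtopology Y K) euclideanreal (\<lambda>x. \<Sum>j\<in>{j \<in> J. \<phi> j x \<noteq> 0}. \<phi> j x)"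
  proof (rule continuous_map_eq)
    fix x assume "x \<in> topspace (subtopology Y K)"
    then show "(\<Sum>j\<in>L. \<phi> j x) = (\<Sum>j\<in>{j \<in> J. \<phi> j x \<noteq> 0}. \<phi> j x)"
      using L by (intro sum.mono_neutral_right) (auto simp: L_def)
  qed
qed

context free_abelian_top_group begin

text \<open>Each \<open>a n\<close> has finite support, so almost all extensions vanish there. Along
  a fast enough subsequence \<open>s\<close> the values form a triangular matrix with nonzero
  diagonal, and the coefficients \<open>c\<close> can be chosen so that the extension of the
  combination \<open>f\<close> takes the value \<open>b\<close> at \<open>a (s b)\<close>. A
  continuous function cannot do this on the compact set \<open>K\<close>.\<close>

lemma compact_finite_ext_seq:
  fixes \<phi> :: "nat \<Rightarrow> 'a \<Rightarrow> real"
  assumes k: "k_space X" and cf: "compact_finite X UNIV \<phi>"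
    and \<phi>: "\<And>j. continuous_map X euclideanreal (\<phi> j)"
    and K: "compactin T K" and a: "\<And>j. a j \<in> K"
  shows "\<exists>j. ext (\<phi> j) (a j) = 0"
proof (rule ccontr)
  assume "\<nexists>j. ext (\<phi> j) (a j) = 0"
  then have nz: "ext (\<phi> j) (a j) \<noteq> 0" for j by blast
  have aG: "a j \<in> carrier G" for j using a compactin_subset_topspace [OF K] by auto
  have "\<exists>N. \<forall>j\<ge>N. ext (\<phi> j) (a n) = 0" for n
  proof -
    obtain F r where r: "rep (a n) F r" by (rule rep_exists [OF aG])
    then have "compactin X F" by (intro finite_imp_compactin) (auto simp: rep_def)
    then have "finite {j. \<exists>x\<in>F. \<phi> j x \<noteq> 0}" using cf by (simp add: compact_finite_def)
    then obtain N where N: "\<And>j. j \<in> {j. \<exists>x\<in>F. \<phi> j x \<noteq> 0} \<Longrightarrow> j < N"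
      using finite_nat_set_iff_bounded by (metis (no_types, lifting))
    have "ext (\<phi> j) (a n) = 0" if "j \<ge> N" for j
    proof -
      have "\<forall>x\<in>F. \<phi> j x = 0" using N [of j] that by force
      then show ?thesis using ext_rep [OF \<phi> r] by simp
    qed
    then show ?thesis by blast
  qed
  then obtain N where N: "\<And>n j. j \<ge> N n \<Longrightarrow> ext (\<phi> j) (a n) = 0" by metis
  define s where "s = rec_nat 0 (\<lambda>_ m. max (Suc m) (N m))"
  have sS: "s (Suc n) = max (Suc (s n)) (N (s n))" for n by (simp add: s_def)
  have sm: "strict_mono s" unfolding strict_mono_Suc_iff using sS by (simp add: less_max_iff_disj)
  have s0: "ext (\<phi> (s b)) (a (s m)) = 0" if "m < b" for m b
  proof -
    have "s (Suc m) \<le> s b" using that sm by (simp add: strict_mono_less_eq Suc_le_eq)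
    then have "N (s m) \<le> s b" using sS [of m] by linarith
    then show ?thesis by (rule N)
  qed
  define M where "M m b = ext (\<phi> (s m)) (a (s b))" for m b
  define c where "c = triangular_solution M"
  have c: "(\<Sum>m\<le>b. c m * M m b) = real b" for b
    unfolding c_def by (rule triangular_solution) (simp add: M_def nz)
  define \<psi> where "\<psi> m x = c m * \<phi> (s m) x" for m x
  have \<psi>c: "continuous_map X euclideanreal (\<psi> m)" for m
    unfolding \<psi>_def by (intro continuous_map_real_mult_left \<phi>)
  have \<psi>f: "compact_finite X UNIV \<psi>"
    unfolding compact_finite_def
  proof (intro allI impI)
    fix C assume "compactin X C"
    then have "finite {j. \<exists>x\<in>C. \<phi> j x \<noteq> 0}" using cf by (simp add: compact_finite_def)
    then have "finite (s -` {j. \<exists>x\<in>C. \<phi> j x \<noteq> 0})"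
      using sm by (intro finite_vimageI) (auto simp: strict_mono_imp_inj_on)
    then show "finite {m \<in> UNIV. \<exists>x\<in>C. \<psi> m x \<noteq> 0}"
      by (rule rev_finite_subset) (auto simp: \<psi>_def)
  qed
  define f where "f x = (\<Sum>m\<in>{m \<in> UNIV. \<psi> m x \<noteq> 0}. \<psi> m x)" for x
  have fc: "continuous_map X euclideanreal f"
    unfolding f_def
    by (rule continuous_map_compact_finite_sum [OF _ \<psi>f \<psi>c]) (use k continuous_map_from_k_space in blast)
  have "ext f (a (s b)) = real b" for b
  proof -
    obtain F r where r: "rep (a (s b)) F r" by (rule rep_exists [OF aG])
    have F: "finite F" "F \<subseteq> topspace X" using r by (auto simp: rep_def)
    have "finite {m. \<exists>x\<in>F. \<psi> m x \<noteq> 0}"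
      using \<psi>f finite_imp_compactin [OF F(2,1)] by (simp add: compact_finite_def)
    then obtain B0 where B0: "\<And>m. m \<in> {m. \<exists>x\<in>F. \<psi> m x \<noteq> 0} \<Longrightarrow> m < B0"
      using finite_nat_set_iff_bounded by (metis (no_types, lifting))
    \<comment> \<open>\<open>B\<close> exceeds \<open>b\<close> and all indices active on
      \<open>F\<close>, so the series can first be cut off below \<open>B\<close> and then, by
      triangularity, after \<open>b\<close>.\<close>
    define B where "B = max B0 (Suc b)"
    have fx: "f x = (\<Sum>m<B. \<psi> m x)" if x: "x \<in> F" for x
      unfolding f_def
    proof (rule sum.mono_neutral_left)
      show "{m \<in> UNIV. \<psi> m x \<noteq> 0} \<subseteq> {..<B}" using B0 x by (force simp: B_def)
    qed auto
    have "ext f (a (s b)) = (\<Sum>x\<in>F. of_int (r x) * f x)" by (rule ext_rep [OF fc r])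
    also have "\<dots> = (\<Sum>x\<in>F. \<Sum>m<B. of_int (r x) * \<psi> m x)"
      by (intro sum.cong) (simp_all add: fx sum_distrib_left)
    also have "\<dots> = (\<Sum>m<B. \<Sum>x\<in>F. of_int (r x) * \<psi> m x)" by (rule sum.swap)
    also have "\<dots> = (\<Sum>m<B. c m * M m b)"
    proof (rule sum.cong)
      fix m
      have "M m b = (\<Sum>x\<in>F. of_int (r x) * \<phi> (s m) x)" unfolding M_def by (rule ext_rep [OF \<phi> r])
      then show "(\<Sum>x\<in>F. of_int (r x) * \<psi> m x) = c m * M m b"
        by (simp add: \<psi>_def sum_distrib_left algebra_simps)
    qed simp
    also have "\<dots> = (\<Sum>m\<le>b. c m * M m b)"
    proof (rule sum.mono_neutral_right)
      show "\<forall>m\<in>{..<B} - {..b}. c m * M m b = 0" using s0 by (auto simp: M_def)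
    qed (auto simp: B_def)
    finally show ?thesis using c by simp
  qed
  then have unb: "\<exists>g\<in>K. ext f g = real b" for b using a by metis
  have "compactin euclideanreal (ext f ` K)" using K ext_cont [OF fc] by (rule image_compactin)
  then have "bounded (ext f ` K)" using compact_imp_bounded by (simp add: compactin_euclidean_iff)
  then obtain B where B: "\<And>g. g \<in> K \<Longrightarrow> \<bar>ext f g\<bar> \<le> B" unfolding bounded_iff by auto
  obtain b where "real b > B" using reals_Archimedean2 by blast
  then show False using unb [of b] B by fastforce
qed

text \<open>If infinitely many of the extended functions were nonzero on a compact set, a suitable
  linear combination of them would be unbounded on it.\<close>
lemma compact_finite_ext:
  assumes k: "k_space X" and cf: "compact_finite X J \<phi>"
    and \<phi>: "\<And>j. j \<in> J \<Longrightarrow> continuous_map X euclideanreal (\<phi> j)" and K: "compactin T K"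
  shows "finite {j \<in> J. \<exists>a\<in>K. ext (\<phi> j) a \<noteq> 0}"
proof (rule ccontr)
  assume "infinite {j \<in> J. \<exists>a\<in>K. ext (\<phi> j) a \<noteq> 0}"
  then obtain e :: "nat \<Rightarrow> _" where e: "inj e" "range e \<subseteq> {j \<in> J. \<exists>a\<in>K. ext (\<phi> j) a \<noteq> 0}"
    using infinite_countable_subset by blast
  have eJ: "e n \<in> J" for n using e(2) by auto
  have "\<forall>n. \<exists>a\<in>K. ext (\<phi> (e n)) a \<noteq> 0" using e(2) by auto
  then obtain a where a: "\<And>n. a n \<in> K" "\<And>n. ext (\<phi> (e n)) (a n) \<noteq> 0" by metis
  have "compact_finite X UNIV (\<lambda>n. \<phi> (e n))"
    unfolding compact_finite_def
  proof (intro allI impI)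
    fix C assume "compactin X C"
    then have "finite {j \<in> J. \<exists>x\<in>C. \<phi> j x \<noteq> 0}" using cf by (simp add: compact_finite_def)
    then have "finite (e -` {j \<in> J. \<exists>x\<in>C. \<phi> j x \<noteq> 0})" using e(1) by (intro finite_vimageI)
    then show "finite {n \<in> UNIV. \<exists>x\<in>C. \<phi> (e n) x \<noteq> 0}"
      by (rule rev_finite_subset) (use eJ in auto)
  qed
  then have "\<exists>n. ext (\<phi> (e n)) (a n) = 0"
    using compact_finite_ext_seq [OF k _ _ K, of "\<lambda>n. \<phi> (e n)" a] \<phi> eJ a(1) by blast
  then show False using a(2) by blast
qed

lemma not_kR_space:
  assumes S: "\<one> \<in> S" "S \<subseteq> carrier G"
    and \<phi>: "\<And>j. j \<in> J \<Longrightarrow> continuous_map X euclideanreal (\<phi> j)"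
    and \<psi>: "\<And>j. j \<in> J \<Longrightarrow> continuous_map X euclideanreal (\<psi> j)"
    and e: "\<And>j. j \<in> J \<Longrightarrow> e j \<in> S" "\<And>j. j \<in> J \<Longrightarrow> ext (\<phi> j) (e j) \<ge> 1" "\<And>j. j \<in> J \<Longrightarrow> ext (\<psi> j) (e j) \<ge> 1"
    and fin: "\<And>K. compactin T K \<Longrightarrow> finite {j \<in> J. \<exists>a\<in>K. ext (\<phi> j) a \<noteq> 0 \<and> ext (\<psi> j) a \<noteq> 0}"
    and acc: "\<And>U. openin T U \<Longrightarrow> \<one> \<in> U \<Longrightarrow> \<exists>j\<in>J. e j \<in> U"
  shows "\<not> k\<^sub>R_space (subtopology T S)"
proof
  assume kR: "k\<^sub>R_space (subtopology T S)"
  \<comment> \<open>Truncation makes all terms nonnegative. No cancellation is possible then, and at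
    \<open>e j\<close> the term with index \<open>j\<close> alone contributes 1.\<close>
  define p where "p j a = min 1 (max 0 (ext (\<phi> j) a)) * min 1 (max 0 (ext (\<psi> j) a))" for j a
  have p0: "0 \<le> p j a" for j a by (simp add: p_def)
  have pnz: "ext (\<phi> j) a \<noteq> 0 \<and> ext (\<psi> j) a \<noteq> 0" if "p j a \<noteq> 0" for j a
    using that by (auto simp: p_def)
  have cf: "compact_finite (subtopology T S) J p"
    unfolding compact_finite_def
  proof (intro allI impI)
    fix K assume "compactin (subtopology T S) K"
    then have "finite {j \<in> J. \<exists>a\<in>K. ext (\<phi> j) a \<noteq> 0 \<and> ext (\<psi> j) a \<noteq> 0}"
      by (intro fin) (simp add: compactin_subtopology)
    then show "finite {j \<in> J. \<exists>a\<in>K. p j a \<noteq> 0}"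
      by (rule rev_finite_subset) (use pnz in blast)
  qed
  define f where "f a = (\<Sum>j\<in>{j \<in> J. p j a \<noteq> 0}. p j a)" for a
  have fc: "continuous_map (subtopology T S) euclideanreal f"
    unfolding f_def
  proof (rule continuous_map_compact_finite_sum [OF _ cf])
    show "continuous_map (subtopology T S) euclideanreal (p j)" if j: "j \<in> J" for j
      unfolding p_def
      by (intro continuous_intros continuous_map_from_subtopology ext_cont \<phi> \<psi> j)
    show "continuous_map (subtopology T S) euclideanreal h"
      if "\<And>K. compactin (subtopology T S) K \<Longrightarrow> continuous_map (subtopology (subtopology T S) K) euclideanreal h"
      for h using kR that by (simp add: k\<^sub>R_space_def)
  qed
  have f1: "f \<one> = 0"
    unfolding f_def using \<phi> by (intro sum.neutral) (auto simp: p_def ext_one)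
  have fe: "f (e j) \<ge> 1" if j: "j \<in> J" for j
  proof -
    have pj: "p j (e j) = 1" using e(2,3) [OF j] by (simp add: p_def)
    have "compactin (subtopology T S) {e j}"
      using e(1) [OF j] S(2) by (simp add: subset_iff)
    then have "finite {k \<in> J. \<exists>a\<in>{e j}. p k a \<noteq> 0}" by (rule cf [unfolded compact_finite_def, rule_format])
    then have "finite {k \<in> J. p k (e j) \<noteq> 0}" by simp
    then have "p j (e j) \<le> f (e j)"
      unfolding f_def using j pj p0 by (intro member_le_sum) auto
    then show ?thesis using pj by simp
  qed
  have "openin (subtopology T S) {a \<in> topspace (subtopology T S). f a \<in> {..<1}}"
    using fc by (rule openin_continuous_map_preimage) simp
  then obtain U where U: "openin T U" "{a \<in> topspace (subtopology T S). f a \<in> {..<1}} = U \<inter> S"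
    by (auto simp: openin_subtopology)
  have "\<one> \<in> {a \<in> topspace (subtopology T S). f a \<in> {..<1}}" using f1 S by auto
  then have "\<one> \<in> U" using U(2) by blast
  then obtain j where j: "j \<in> J" "e j \<in> U" using acc [OF U(1)] by blast
  then have "e j \<in> {a \<in> topspace (subtopology T S). f a \<in> {..<1}}" using U(2) e(1) by blast
  then show False using fe [OF j(1)] by simp
qed

end

section \<open>Obstructions to the \<open>k\<^sub>R\<close>-property\<close>

lemma infinite_nat_subseq:
  assumes "infinite (I :: nat set)"
  obtains r :: "nat \<Rightarrow> nat" where "strict_mono r" "\<And>k. r k \<in> I"
  using infinite_enumerate [OF assms] by metis

context sequential_stratified begin

text \<open>If infinitely many of these functions were nonzero somewhere on a compact set, a
  subsequence of the witnessing points would converge, and \<open>g_limit\<close> would pass its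
  limit on to the centres \<open>y n\<close>.\<close>

lemma compact_finite_g:
  assumes y: "\<And>n. n \<in> I \<Longrightarrow> y n \<in> topspace X"
    and nc: "\<And>r p. strict_mono r \<Longrightarrow> range r \<subseteq> I \<Longrightarrow> \<not> limitin X (\<lambda>k. y (r k)) p sequentially"
    and \<phi>: "\<And>n x. n \<in> I \<Longrightarrow> x \<in> topspace X - g n (y n) \<Longrightarrow> \<phi> n x = 0"
  shows "compact_finite X I \<phi>"
  unfolding compact_finite_def
proof (intro allI impI, rule ccontr)
  fix K assume K: "compactin X K" and inf: "infinite {n \<in> I. \<exists>x\<in>K. \<phi> n x \<noteq> 0}"
  define L where "L = {n \<in> I. \<exists>x\<in>K. \<phi> n x \<noteq> 0}"
  obtain r :: "nat \<Rightarrow> nat" where r0: "strict_mono r" "\<And>k. r k \<in> L"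
    using infinite_nat_subseq [of L] inf unfolding L_def [symmetric] by metis
  have r: "strict_mono r" "\<And>k. r k \<in> I" "\<forall>k. \<exists>x\<in>K. \<phi> (r k) x \<noteq> 0" using r0 by (auto simp: L_def)
  then obtain x where x: "\<And>k. x k \<in> K" "\<And>k. \<phi> (r k) (x k) \<noteq> 0" by metis
  have xg: "x k \<in> g (r k) (y (r k))" for k
    using \<phi> [OF r(2)] x compactin_subset_topspace [OF K] by blast
  have xK: "range x \<subseteq> K" using x by auto
  obtain s p where s: "strict_mono s" and p: "limitin X (\<lambda>k. x (s k)) p sequentially"
    using seq_compact [OF K xK] by metis
  have rs: "strict_mono (\<lambda>k. r (s k))" using r(1) s by (simp add: strict_mono_def)
  have "limitin X (\<lambda>k. y (r (s k))) p sequentially"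
    by (rule g_limit [OF rs _ _ p]) (use xg y r(2) in auto)
  then show False using nc [OF rs] r(2) by auto
qed

end

context free_abelian_top_group begin

lemma split_nbhd_one:
  assumes U: "openin T U" "\<one> \<in> U"
  obtains V where "openin T V" "\<one> \<in> V" "\<And>a b. a \<in> V \<Longrightarrow> b \<in> V \<Longrightarrow> a \<otimes> b \<in> U"
proof -
  have c: "continuous_map (prod_topology T T) T (\<lambda>p. fst p \<otimes> snd p)"
    by (intro continuous_map_mult continuous_map_fst continuous_map_snd)
  have "openin (prod_topology T T) {p \<in> topspace (prod_topology T T). fst p \<otimes> snd p \<in> U}"
    using c U(1) by (rule openin_continuous_map_preimage)
  moreover have "(\<one>, \<one>) \<in> {p \<in> topspace (prod_topology T T). fst p \<otimes> snd p \<in> U}"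
    using U by simp
  ultimately have "\<exists>V W. openin T V \<and> openin T W \<and> \<one> \<in> V \<and> \<one> \<in> W \<and>
      V \<times> W \<subseteq> {p \<in> topspace (prod_topology T T). fst p \<otimes> snd p \<in> U}"
    unfolding openin_prod_topology_alt by simp
  then obtain V W where V: "openin T V" "openin T W" "\<one> \<in> V" "\<one> \<in> W"
      "V \<times> W \<subseteq> {p \<in> topspace (prod_topology T T). fst p \<otimes> snd p \<in> U}"
    by (elim exE conjE)
  show thesis
    by (rule that [of "V \<inter> W"]) (use V in auto)
qed

lemma openin_difference_nbhd:
  assumes "openin T V" "y \<in> topspace X"
  shows "openin X {x \<in> topspace X. i x \<otimes> inv (i y) \<in> V}"
proof (rule openin_continuous_map_preimage [OF _ assms(1)])
  show "continuous_map X T (\<lambda>x. i x \<otimes> inv (i y))"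
    using assms(2) by (intro continuous_map_mult i_cont) simp
qed

abbreviation diffs :: "'a \<Rightarrow> 'a \<Rightarrow> 'a \<Rightarrow> 'a \<Rightarrow> 'g" where
  "diffs x y z w \<equiv> (i x \<otimes> inv (i y)) \<otimes> (i z \<otimes> inv (i w))"

lemma diffs_length:
  assumes "x \<in> topspace X" "y \<in> topspace X" "z \<in> topspace X" "w \<in> topspace X"
  shows "diffs x y z w \<in> carrier G \<and> reduced_length X G i (diffs x y z w) \<le> 4"
proof
  show c: "diffs x y z w \<in> carrier G" using assms by simp
  have "length_le ((1 + 1) + (1 + 1)) (diffs x y z w)"
    by (intro length_le_mult length_le_generator length_le_inv_generator assms)
  then have "length_le 4 (diffs x y z w)" by (simp add: numeral_eq_Suc)
  then show "reduced_length X G i (diffs x y z w) \<le> 4" using reduced_length_le_iff [OF c] by simp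
qed

lemma ext_diffs:
  assumes "continuous_map X euclideanreal f"
    and "x \<in> topspace X" "y \<in> topspace X" "z \<in> topspace X" "w \<in> topspace X"
  shows "ext f (diffs x y z w) = f x - f y + (f z - f w)"
  using assms by (simp add: ext_mult ext_inv ext_i)

end

text \<open>This replaces an indexing by the first uncountable ordinal: a well-ordering is cut at
  the first element of \<open>A\<close> with uncountably many predecessors in \<open>A\<close>, if
  there is one.\<close>

lemma countable_initial_segments:
  assumes A: "uncountable (A :: 'j set)"
  shows "\<exists>B R. B \<subseteq> A \<and> uncountable B \<and> (\<forall>a\<in>B. countable {b \<in> B. (b, a) \<in> R}) \<and>
    (\<forall>a b. a \<noteq> b \<longrightarrow> (a, b) \<in> R \<or> (b, a) \<in> R)"
proof -
  obtain ro :: "'j rel" where ro0: "Well_order ro \<and> Field ro = UNIV" using well_ordering ..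
  then have ro: "Well_order ro" "Field ro = UNIV" by auto
  define R where "R = ro - Id"
  have wf: "wf R" using ro unfolding R_def well_order_on_def by blast
  have tot: "(a, b) \<in> R \<or> (b, a) \<in> R" if "a \<noteq> b" for a b
    using ro that unfolding R_def well_order_on_def linear_order_on_def total_on_def by auto
  show ?thesis
  proof (cases "\<forall>a\<in>A. countable {b \<in> A. (b, a) \<in> R}")
    case True
    then show ?thesis using A tot by (intro exI [of _ A] exI [of _ R]) auto
  next
    case False
    then obtain a1 where "a1 \<in> {a \<in> A. uncountable {b \<in> A. (b, a) \<in> R}}" by auto
    then have "\<exists>a0\<in>{a \<in> A. uncountable {b \<in> A. (b, a) \<in> R}}.
        \<forall>a. (a, a0) \<in> R \<longrightarrow> a \<notin> {a \<in> A. uncountable {b \<in> A. (b, a) \<in> R}}"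
      by (rule wf [unfolded wf_eq_minimal, rule_format])
    then obtain a0 where a0: "uncountable {b \<in> A. (b, a0) \<in> R}"
      "\<And>a. (a, a0) \<in> R \<Longrightarrow> a \<in> A \<Longrightarrow> countable {b \<in> A. (b, a) \<in> R}" by auto
    show ?thesis
    proof (intro exI [of _ "{b \<in> A. (b, a0) \<in> R}"] exI [of _ R] conjI ballI)
      show "countable {b \<in> {b \<in> A. (b, a0) \<in> R}. (b, a) \<in> R}" if "a \<in> {b \<in> A. (b, a0) \<in> R}" for a
        by (rule countable_subset [of _ "{b \<in> A. (b, a) \<in> R}"]) (use that a0(2) in auto)
    qed (use a0 tot in auto)
  qed
qed

locale k_network_free_group = k_network_stratified X S \<P> + free_abelian_top_group X G T i
  for X :: "'a topology" and S \<P> and G :: "('g, 'm) monoid_scheme" (structure)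
    and T :: "'g topology" and i +
  assumes kX: "k_space X"
begin

text \<open>Here \<open>y\<close> and \<open>z\<close> will be the two points that occur with a
  minus sign in \<open>diffs\<close>. Since the bump vanishes there and is nonnegative at the
  remaining point, its extension is at least 1 at the whole element.\<close>

definition avoiding_bump :: "'a set \<Rightarrow> 'a \<Rightarrow> 'a \<Rightarrow> 'a \<Rightarrow> ('a \<Rightarrow> real) \<Rightarrow> bool" where
  "avoiding_bump U a y z \<phi> \<longleftrightarrow> continuous_map X euclideanreal \<phi> \<and> \<phi> a = 1 \<and>
     (\<forall>x\<in>topspace X - U. \<phi> x = 0) \<and> \<phi> y = 0 \<and> \<phi> z = 0 \<and> (\<forall>x. 0 \<le> \<phi> x)"

lemma avoiding_bump_exists:
  assumes "openin X U" "a \<in> U" "a \<noteq> y" "a \<noteq> z" "y \<in> topspace X" "z \<in> topspace X"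
  shows "\<exists>\<phi>. avoiding_bump U a y z \<phi>"
proof -
  have U': "openin X (U \<inter> (topspace X - {y}) \<inter> (topspace X - {z}))"
    by (intro openin_Int assms openin_delete)
  have "a \<in> topspace X" using assms openin_subset by blast
  then have a: "a \<in> U \<inter> (topspace X - {y}) \<inter> (topspace X - {z})" using assms by simp
  obtain \<phi> where "continuous_map X euclideanreal \<phi>" "\<phi> a = 1"
    "\<And>x. x \<in> topspace X - (U \<inter> (topspace X - {y}) \<inter> (topspace X - {z})) \<Longrightarrow> \<phi> x = 0" "\<And>x. 0 \<le> \<phi> x"
    using bump [OF U' a] by metis
  then show ?thesis unfolding avoiding_bump_def using assms(5,6) by (intro exI [of _ \<phi>]) auto
qed

text \<open>On a compact set the bumps at the \<open>d n m\<close> can be active for finitely many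
  rows \<open>n\<close> only, because entries from different rows do not accumulate; within one row
  the bumps at the \<open>B n m\<close> leave finitely many \<open>m\<close>. \<open>Sub\<close>
  stands for both \<open>A(X)\<close> and A_4(X).\<close>

lemma fan_obstruction:
  fixes B :: "nat \<Rightarrow> nat \<Rightarrow> 'a"
  assumes Q: "Q_array X c d"
    and b: "b \<in> topspace X" and B: "\<And>n m. B n m \<in> topspace X"
    and nbhd: "\<And>V. openin X V \<Longrightarrow> b \<in> V \<Longrightarrow> \<exists>n. \<forall>m. B n m \<in> V"
    and nc: "\<And>n. no_convergent_subsequence X (B n)"
    and Sub: "Sub \<subseteq> carrier G" "{a \<in> carrier G. reduced_length X G i a \<le> 4} \<subseteq> Sub"
  shows "\<not> k\<^sub>R_space (subtopology T Sub)"
proof -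
  have lim: "limitin X (d n) (c n) sequentially" and d: "d n m \<in> topspace X" "d n m \<noteq> c n"
    and nlim: "strict_mono r \<Longrightarrow> \<not> limitin X (\<lambda>k. d (r k) (f k)) p sequentially" for n m r f p
    using Q unfolding Q_array_def by auto
  have c: "c n \<in> topspace X" for n using limitin_topspace [OF lim] .
  \<comment> \<open>The bumps have to vanish at \<open>b\<close> and at \<open>c n\<close>, so pairs
    with coincidences are left out. In every row these are finitely many, since neither
    \<open>d n\<close> (which avoids \<open>c n\<close>) nor \<open>B n\<close> takes an excluded
    value infinitely often.\<close>
  define J where "J = {(n, m). d n m \<noteq> b \<and> B n m \<noteq> b \<and> B n m \<noteq> c n}"
  \<comment> \<open>The index of \<open>g\<close> is the row here and the column for
    \<open>\<psi>\<close> below, because \<open>compact_finite_g\<close> is applied across the rows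
    to the former and along a single row to the latter.\<close>
  have "\<forall>j\<in>J. \<exists>\<phi>. avoiding_bump (g (fst j) (d (fst j) (snd j))) (d (fst j) (snd j)) b (c (fst j)) \<phi>"
    by (intro ballI avoiding_bump_exists g_open g_self b c) (auto simp: J_def d)
  then obtain \<phi> where "\<forall>j\<in>J. avoiding_bump (g (fst j) (d (fst j) (snd j))) (d (fst j) (snd j)) b (c (fst j)) (\<phi> j)" by metis
  then have \<phi>: "\<And>j. j \<in> J \<Longrightarrow> continuous_map X euclideanreal (\<phi> j)"
      "\<And>j. j \<in> J \<Longrightarrow> \<phi> j (d (fst j) (snd j)) = 1"
      "\<And>j x. j \<in> J \<Longrightarrow> x \<in> topspace X - g (fst j) (d (fst j) (snd j)) \<Longrightarrow> \<phi> j x = 0"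
      "\<And>j. j \<in> J \<Longrightarrow> \<phi> j b = 0" "\<And>j. j \<in> J \<Longrightarrow> \<phi> j (c (fst j)) = 0"
      "\<And>j x. j \<in> J \<Longrightarrow> 0 \<le> \<phi> j x"
    by (simp_all add: avoiding_bump_def)
  have "\<forall>j\<in>J. \<exists>\<psi>. avoiding_bump (g (snd j) (B (fst j) (snd j))) (B (fst j) (snd j)) b (c (fst j)) \<psi>"
    by (intro ballI avoiding_bump_exists g_open g_self b c) (auto simp: J_def B)
  then obtain \<psi> where "\<forall>j\<in>J. avoiding_bump (g (snd j) (B (fst j) (snd j))) (B (fst j) (snd j)) b (c (fst j)) (\<psi> j)" by metis
  then have \<psi>: "\<And>j. j \<in> J \<Longrightarrow> continuous_map X euclideanreal (\<psi> j)"
      "\<And>j. j \<in> J \<Longrightarrow> \<psi> j (B (fst j) (snd j)) = 1"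
      "\<And>j x. j \<in> J \<Longrightarrow> x \<in> topspace X - g (snd j) (B (fst j) (snd j)) \<Longrightarrow> \<psi> j x = 0"
      "\<And>j. j \<in> J \<Longrightarrow> \<psi> j b = 0" "\<And>j. j \<in> J \<Longrightarrow> \<psi> j (c (fst j)) = 0"
      "\<And>j x. j \<in> J \<Longrightarrow> 0 \<le> \<psi> j x"
    by (simp_all add: avoiding_bump_def)
  define e where "e j = diffs (B (fst j) (snd j)) b (d (fst j) (snd j)) (c (fst j))" for j
  show ?thesis
  proof (rule not_kR_space [where J = J and \<phi> = \<phi> and \<psi> = \<psi> and e = e])
    show "\<one> \<in> Sub" using Sub(2) reduced_length_le_iff [of \<one> 4] length_le_one by auto
    show "Sub \<subseteq> carrier G" by (rule Sub)
    show "continuous_map X euclideanreal (\<phi> j)" "continuous_map X euclideanreal (\<psi> j)" if "j \<in> J" for j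
      using \<phi>(1) \<psi>(1) that by auto
    show "e j \<in> Sub" for j
      using diffs_length [OF B b d(1) c] Sub(2) unfolding e_def by auto
    show "1 \<le> ext (\<phi> j) (e j)" "1 \<le> ext (\<psi> j) (e j)" if j: "j \<in> J" for j
      using \<phi> [OF j] \<psi> [OF j] B b d(1) c by (simp_all add: e_def ext_diffs)
  next
    fix K assume K: "compactin T K"
    define N where "N = {n. \<exists>m. (n, m) \<in> J \<and> (\<exists>a\<in>K. ext (\<phi> (n, m)) a \<noteq> 0)}"
    have "\<forall>n\<in>N. \<exists>m. (n, m) \<in> J \<and> (\<exists>a\<in>K. ext (\<phi> (n, m)) a \<noteq> 0)" by (simp add: N_def)
    then obtain \<mu> where \<mu>: "\<And>n. n \<in> N \<Longrightarrow> (n, \<mu> n) \<in> J" "\<And>n. n \<in> N \<Longrightarrow> \<exists>a\<in>K. ext (\<phi> (n, \<mu> n)) a \<noteq> 0"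
      by metis
    have "compact_finite X N (\<lambda>n. \<phi> (n, \<mu> n))"
    proof (rule compact_finite_g [where y = "\<lambda>n. d n (\<mu> n)"])
      show "\<phi> (n, \<mu> n) x = 0" if "n \<in> N" "x \<in> topspace X - g n (d n (\<mu> n))" for n x
        using \<phi>(3) [OF \<mu>(1), of n x] that by simp
    qed (use d nlim in auto)
    then have "finite {n \<in> N. \<exists>a\<in>K. ext (\<phi> (n, \<mu> n)) a \<noteq> 0}"
      by (rule compact_finite_ext [OF kX _ _ K]) (use \<phi>(1) \<mu>(1) in auto)
    then have "finite {n \<in> N. True}" using \<mu>(2) by (simp cong: conj_cong)
    then have finN: "finite N" by simp
    define M where "M n = {m \<in> {m. (n, m) \<in> J}. \<exists>a\<in>K. ext (\<psi> (n, m)) a \<noteq> 0}" for n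
    have finM: "finite (M n)" for n
      unfolding M_def
    proof (rule compact_finite_ext [OF kX _ _ K, where \<phi> = "\<lambda>m. \<psi> (n, m)"])
      show "compact_finite X {m. (n, m) \<in> J} (\<lambda>m. \<psi> (n, m))"
      proof (rule compact_finite_g [where y = "B n"])
        show "\<psi> (n, m) x = 0" if "m \<in> {m. (n, m) \<in> J}" "x \<in> topspace X - g m (B n m)" for m x
          using \<psi>(3) [of "(n, m)" x] that by simp
      qed (use B nc [of n] in \<open>auto simp: no_convergent_subsequence_def\<close>)
    qed (use \<psi>(1) in auto)
    show "finite {j \<in> J. \<exists>a\<in>K. ext (\<phi> j) a \<noteq> 0 \<and> ext (\<psi> j) a \<noteq> 0}"
    proof (rule finite_subset)
      show "{j \<in> J. \<exists>a\<in>K. ext (\<phi> j) a \<noteq> 0 \<and> ext (\<psi> j) a \<noteq> 0} \<subseteq> (SIGMA n:N. M n)"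
        by (auto simp: N_def M_def)
    qed (use finN finM in auto)
  next
    fix U assume U: "openin T U" "\<one> \<in> U"
    obtain V where V: "openin T V" "\<one> \<in> V" "\<And>a b. a \<in> V \<Longrightarrow> b \<in> V \<Longrightarrow> a \<otimes> b \<in> U"
      using split_nbhd_one [OF U] by metis
    \<comment> \<open>The order of choices matters: the row \<open>n\<close> is chosen first and
      brings all \<open>B n m\<close> close to \<open>b\<close>; then \<open>m\<close> may be taken
      large enough for \<open>d n m\<close>.\<close>
    have "openin X {x \<in> topspace X. i x \<otimes> inv (i b) \<in> V}" by (rule openin_difference_nbhd [OF V(1) b])
    then obtain n where n: "\<And>m. B n m \<in> {x \<in> topspace X. i x \<otimes> inv (i b) \<in> V}"
      using nbhd b V(2) by fastforce
    have "openin X {x \<in> topspace X. i x \<otimes> inv (i (c n)) \<in> V}"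
      by (rule openin_difference_nbhd [OF V(1) c])
    moreover have "c n \<in> {x \<in> topspace X. i x \<otimes> inv (i (c n)) \<in> V}" using c V(2) by simp
    ultimately have 1: "\<forall>\<^sub>F m in sequentially. d n m \<in> {x \<in> topspace X. i x \<otimes> inv (i (c n)) \<in> V}"
      using lim [of n] by (auto simp: limitin_def)
    have 2: "\<forall>\<^sub>F m in sequentially. d n m \<noteq> b"
    proof (cases "c n = b")
      case False
      then have "\<forall>\<^sub>F m in sequentially. d n m \<in> topspace X - {b}"
        using lim [of n] openin_delete [of b] c [of n] by (auto simp: limitin_def)
      then show ?thesis by (rule eventually_mono) auto
    qed (use d in auto)
    have 3: "\<forall>\<^sub>F m in sequentially. B n m \<noteq> y" for y
    proof (rule ccontr)
      assume "\<not> ?thesis"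
      then have "infinite {m. B n m = y}"
        unfolding eventually_sequentially infinite_nat_iff_unbounded_le by auto
      then obtain r :: "nat \<Rightarrow> nat" where r: "strict_mono r" "\<And>k. r k \<in> {m. B n m = y}"
        using infinite_nat_subseq [of "{m. B n m = y}"] by metis
      then have "(\<lambda>k. B n (r k)) = (\<lambda>k. y)" by auto
      moreover have "y \<in> topspace X" using r(2) [of 0] B [of n "r 0"] by auto
      ultimately have "limitin X (\<lambda>k. B n (r k)) y sequentially" by simp
      with nc [of n, unfolded no_convergent_subsequence_def, rule_format, OF r(1)]
      show False by (rule notE)
    qed
    obtain m where m: "d n m \<in> {x \<in> topspace X. i x \<otimes> inv (i (c n)) \<in> V}" "d n m \<noteq> b" "B n m \<noteq> b" "B n m \<noteq> c n"
      using eventually_happens' [OF _ eventually_conj [OF 1 eventually_conj [OF 2 eventually_conj [OF 3 [of b] 3 [of "c n"]]]]]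
      by auto
    show "\<exists>j\<in>J. e j \<in> U"
    proof
      show "(n, m) \<in> J" using m by (simp add: J_def)
      show "e (n, m) \<in> U" unfolding e_def using n [of m] m by (auto intro!: V(3))
    qed
  qed
qed

text \<open>In the index pair one coordinate is confined by each of the two bumps. Accumulation at
  the unit is a counting argument: whatever rates of convergence a neighbourhood demands,
  uncountably many sequences share one rate, and the numbering of predecessors forces some pair to
  use a position beyond it.\<close>

lemma uncountable_obstruction:
  fixes c :: "'j \<Rightarrow> 'a" and d :: "'j \<Rightarrow> nat \<Rightarrow> 'a"
  assumes unc: "uncountable \<A>"
    and lim: "\<And>\<alpha>. \<alpha> \<in> \<A> \<Longrightarrow> limitin X (d \<alpha>) (c \<alpha>) sequentially"
    and d: "\<And>\<alpha> m. \<alpha> \<in> \<A> \<Longrightarrow> d \<alpha> m \<in> topspace X - {c \<alpha>}"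
    and cf: "\<And>K. compactin X K \<Longrightarrow> finite {\<alpha> \<in> \<A>. \<exists>m. d \<alpha> m \<in> K}"
    and Sub: "Sub \<subseteq> carrier G" "{a \<in> carrier G. reduced_length X G i a \<le> 4} \<subseteq> Sub"
  shows "\<not> k\<^sub>R_space (subtopology T Sub)"
proof -
  obtain A R where AR: "A \<subseteq> \<A> \<and> uncountable A \<and> (\<forall>a\<in>A. countable {b \<in> A. (b, a) \<in> R}) \<and>
      (\<forall>a b. a \<noteq> b \<longrightarrow> (a, b) \<in> R \<or> (b, a) \<in> R)"
    using countable_initial_segments [OF unc] by (elim exE)
  then have A: "A \<subseteq> \<A>" "uncountable A" and seg: "\<And>a. a \<in> A \<Longrightarrow> countable {b \<in> A. (b, a) \<in> R}"
    and tot: "\<And>a b. a \<noteq> b \<Longrightarrow> (a, b) \<in> R \<or> (b, a) \<in> R" by auto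
  have lim: "limitin X (d \<alpha>) (c \<alpha>) sequentially" and dX: "d \<alpha> m \<in> topspace X" and dc: "d \<alpha> m \<noteq> c \<alpha>"
    if "\<alpha> \<in> A" for \<alpha> m
    using lim [of \<alpha>] d [of \<alpha> m] A(1) that by auto
  have cX: "c \<alpha> \<in> topspace X" if "\<alpha> \<in> A" for \<alpha> using limitin_topspace [OF lim [OF that]] .
  have cf: "finite {\<alpha> \<in> A. \<exists>m. d \<alpha> m \<in> K}" if "compactin X K" for K
    by (rule finite_subset [OF _ cf [OF that]]) (use A in auto)
  \<comment> \<open>The points at position \<open>n\<close> form a closed discrete set: a convergent
    sequence in it is contained in a compact set, which meets only finitely many of the given
    sequences, so it has finite range.\<close>
  define D where "D n = (\<lambda>\<alpha>. d \<alpha> n) ` A" for n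
  have clD: "closedin X E" if E: "E \<subseteq> D n" for E n
  proof (rule seq_closed)
    show EX: "E \<subseteq> topspace X" using E dX by (auto simp: D_def)
    fix s p assume s: "range s \<subseteq> E" and p: "limitin X s p sequentially"
    define K where "K = insert p (range s)"
    have K: "compactin X K" unfolding K_def by (rule compactin_limit_sequence [OF p]) (use s EX in auto)
    have "range s \<subseteq> (\<lambda>\<alpha>. d \<alpha> n) ` {\<alpha> \<in> A. \<exists>m. d \<alpha> m \<in> K}"
    proof
      fix x assume x: "x \<in> range s"
      then have "x \<in> D n" using s E by auto
      then obtain \<alpha> where "\<alpha> \<in> A" "x = d \<alpha> n" by (auto simp: D_def)
      moreover have "x \<in> K" using x by (simp add: K_def)
      ultimately show "x \<in> (\<lambda>\<alpha>. d \<alpha> n) ` {\<alpha> \<in> A. \<exists>m. d \<alpha> m \<in> K}" by auto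
    qed
    then have "finite (range s)" using cf [OF K] finite_surj by blast
    then have "closedin X (range s)" using haus s EX by (intro closedin_Hausdorff_finite) auto
    then have "p \<in> range s" by (rule limit_in_closed [OF _ p]) auto
    then show "p \<in> E" using s by auto
  qed
  have "\<forall>n. \<exists>B. (\<forall>y\<in>D n. openin X (B y) \<and> y \<in> B y) \<and> (\<forall>K. compactin X K \<longrightarrow> finite {y \<in> D n. B y \<inter> K \<noteq> {}})"
  proof
    fix n
    show "\<exists>B. (\<forall>y\<in>D n. openin X (B y) \<and> y \<in> B y) \<and> (\<forall>K. compactin X K \<longrightarrow> finite {y \<in> D n. B y \<inter> K \<noteq> {}})"
    proof (rule discrete_expansion [of "D n"])
      show "closedin X E" if "E \<subseteq> D n" for E using that by (rule clD)
    next
      fix B assume "\<And>y. y \<in> D n \<Longrightarrow> openin X (B y)" "\<And>y. y \<in> D n \<Longrightarrow> y \<in> B y"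
        "\<And>K. compactin X K \<Longrightarrow> finite {y \<in> D n. B y \<inter> K \<noteq> {}}"
      then show ?thesis by (intro exI [of _ B]) simp
    qed
  qed
  from choice [OF this] obtain B where B0: "\<forall>n. (\<forall>y\<in>D n. openin X (B n y) \<and> y \<in> B n y) \<and>
      (\<forall>K. compactin X K \<longrightarrow> finite {y \<in> D n. B n y \<inter> K \<noteq> {}})" ..
  have B: "\<And>n y. y \<in> D n \<Longrightarrow> openin X (B n y)" "\<And>n y. y \<in> D n \<Longrightarrow> y \<in> B n y"
    "\<And>n K. compactin X K \<Longrightarrow> finite {y \<in> D n. B n y \<inter> K \<noteq> {}}" using B0 by simp_all
  \<comment> \<open>The expansion \<open>B n\<close> controls infinitely many \<alpha> at one fixed
    position, and \<open>g n\<close> controls positions that tend to infinity; \<open>key\<close>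
    needs both.\<close>
  define W where "W n \<alpha> = B n (d \<alpha> n) \<inter> g n (d \<alpha> n)" for n \<alpha>
  have W: "openin X (W n \<alpha>)" "d \<alpha> n \<in> W n \<alpha>" if "\<alpha> \<in> A" for n \<alpha>
    unfolding W_def using that B(1,2) [of "d \<alpha> n" n] g_open g_self [OF dX [OF that]]
    by (auto simp: D_def)
  \<comment> \<open>The position \<open>m\<close> may depend arbitrarily on \<alpha>, because the
    position attached to a pair depends on both of its coordinates.\<close>
  have key: "finite {\<alpha> \<in> A. W (m \<alpha>) \<alpha> \<inter> K \<noteq> {}}" if K: "compactin X K" for m K
  proof (rule ccontr)
    define I where "I = {\<alpha> \<in> A. W (m \<alpha>) \<alpha> \<inter> K \<noteq> {}}"
    assume "infinite {\<alpha> \<in> A. W (m \<alpha>) \<alpha> \<inter> K \<noteq> {}}"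
    then have inf: "infinite I" by (simp add: I_def)
    have fib: "finite {\<alpha> \<in> I. m \<alpha> = n}" for n
    proof (rule finite_subset)
      define L where "L = {y \<in> D n. B n y \<inter> K \<noteq> {}}"
      have L: "finite L" unfolding L_def by (rule B(3) [OF K])
      show "{\<alpha> \<in> I. m \<alpha> = n} \<subseteq> {\<alpha> \<in> A. \<exists>m. d \<alpha> m \<in> L}"
        by (auto simp: I_def L_def W_def D_def)
      have "L \<subseteq> topspace X" using dX by (auto simp: L_def D_def)
      then show "finite {\<alpha> \<in> A. \<exists>m. d \<alpha> m \<in> L}" using cf finite_imp_compactin L by blast
    qed
    have "infinite (m ` I)"
    proof
      assume "finite (m ` I)"
      then have "finite (\<Union>n\<in>m ` I. {\<alpha> \<in> I. m \<alpha> = n})" using fib by blast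
      moreover have "I \<subseteq> (\<Union>n\<in>m ` I. {\<alpha> \<in> I. m \<alpha> = n})" by auto
      ultimately show False using inf finite_subset by blast
    qed
    then obtain r :: "nat \<Rightarrow> nat" where r0: "strict_mono r" "\<And>k. r k \<in> m ` I"
      using infinite_nat_subseq [of "m ` I"] by metis
    have r: "strict_mono r" "\<forall>k. \<exists>\<alpha>\<in>I. m \<alpha> = r k" using r0 by (auto simp: image_iff) metis
    obtain \<alpha> where \<alpha>: "\<And>k. \<alpha> k \<in> I" "\<And>k. m (\<alpha> k) = r k" using r(2) by metis
    have \<alpha>A: "\<alpha> k \<in> A" for k using \<alpha>(1) by (auto simp: I_def)
    have "\<forall>k. \<exists>x. x \<in> W (r k) (\<alpha> k) \<inter> K" using \<alpha> by (auto simp: I_def)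
    then obtain x where x: "\<And>k. x k \<in> W (r k) (\<alpha> k)" "\<And>k. x k \<in> K" by (metis Int_iff)
    have xK: "range x \<subseteq> K" using x by auto
    obtain s p where s: "strict_mono s" and p: "limitin X (\<lambda>k. x (s k)) p sequentially"
      using seq_compact [OF K xK] by metis
    have rs: "strict_mono (\<lambda>k. r (s k))" using r(1) s by (simp add: strict_mono_def)
    define y where "y k = d (\<alpha> (s k)) (r (s k))" for k
    have yX: "range y \<subseteq> topspace X" using dX [OF \<alpha>A] by (auto simp: y_def)
    have y: "limitin X y p sequentially"
      by (rule g_limit [OF rs _ yX p]) (use x(1) in \<open>auto simp: y_def W_def\<close>)
    have "finite {\<alpha> \<in> A. \<exists>m. d \<alpha> m \<in> insert p (range y)}" by (rule cf [OF compactin_limit_sequence [OF y yX]])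
    moreover have "range (\<lambda>k. \<alpha> (s k)) \<subseteq> {\<alpha> \<in> A. \<exists>m. d \<alpha> m \<in> insert p (range y)}"
      using \<alpha>A by (auto simp: y_def)
    moreover have "inj (\<lambda>k. \<alpha> (s k))"
    proof (rule injI)
      fix k l assume "\<alpha> (s k) = \<alpha> (s l)"
      then have "r (s k) = r (s l)" using \<alpha>(2) by metis
      then show "k = l" using rs strict_mono_eq by blast
    qed
    ultimately show False using finite_subset range_inj_infinite by blast
  qed
  \<comment> \<open>For given rates of convergence \<open>M\<close>, some \<open>\<alpha>\<close> has infinitely many predecessors \<open>\<beta>\<close> with the same
    rate; their indices below \<open>\<alpha>\<close> are unbounded, so it suffices that \<open>n \<ge> ix \<alpha> \<beta>\<close>.\<close>
  define ix where "ix \<alpha> \<beta> = to_nat_on {b \<in> A. (b, \<alpha>) \<in> R} \<beta>" for \<alpha> \<beta>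
  define J where "J = {(\<alpha>, \<beta>). \<alpha> \<in> A \<and> \<beta> \<in> A \<and> \<alpha> \<noteq> \<beta>}"
  have avoid: "\<forall>\<^sub>F n in sequentially. d \<alpha> n \<noteq> c \<beta>" if "\<alpha> \<in> A" for \<alpha> \<beta>
  proof (cases "c \<alpha> = c \<beta>")
    case False
    then have "\<forall>\<^sub>F m in sequentially. d \<alpha> m \<in> topspace X - {c \<beta>}"
      using lim [OF that] openin_delete [of "c \<beta>"] cX [OF that] by (auto simp: limitin_def)
    then show ?thesis by (rule eventually_mono) auto
  qed (use dc [OF that] in auto)
  have "\<exists>n. n \<ge> ix \<alpha> \<beta> \<and> d \<alpha> n \<noteq> c \<beta> \<and> d \<beta> n \<noteq> c \<alpha>" if "\<alpha> \<in> A" "\<beta> \<in> A" for \<alpha> \<beta>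
    using eventually_happens' [OF _ eventually_conj [OF eventually_ge_at_top [of "ix \<alpha> \<beta>"]
          eventually_conj [OF avoid [OF that(1), of \<beta>] avoid [OF that(2), of \<alpha>]]]] by auto
  then obtain nn where nn: "\<And>\<alpha> \<beta>. \<alpha> \<in> A \<Longrightarrow> \<beta> \<in> A \<Longrightarrow>
      ix \<alpha> \<beta> \<le> nn \<alpha> \<beta> \<and> d \<alpha> (nn \<alpha> \<beta>) \<noteq> c \<beta> \<and> d \<beta> (nn \<alpha> \<beta>) \<noteq> c \<alpha>" by metis
  define n where "n j = nn (fst j) (snd j)" for j
  have J: "fst j \<in> A" "snd j \<in> A" "d (fst j) (n j) \<noteq> c (snd j)" "d (snd j) (n j) \<noteq> c (fst j)" if "j \<in> J" for j
    using that nn by (auto simp: J_def n_def)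
  have "\<forall>j\<in>J. \<exists>\<phi>. avoiding_bump (W (n j) (fst j)) (d (fst j) (n j)) (c (fst j)) (c (snd j)) \<phi>"
    by (intro ballI avoiding_bump_exists W J dc cX)
  then obtain \<phi> where "\<forall>j\<in>J. avoiding_bump (W (n j) (fst j)) (d (fst j) (n j)) (c (fst j)) (c (snd j)) (\<phi> j)" by metis
  then have \<phi>: "\<And>j. j \<in> J \<Longrightarrow> continuous_map X euclideanreal (\<phi> j)"
      "\<And>j. j \<in> J \<Longrightarrow> \<phi> j (d (fst j) (n j)) = 1"
      "\<And>j x. j \<in> J \<Longrightarrow> x \<in> topspace X - W (n j) (fst j) \<Longrightarrow> \<phi> j x = 0"
      "\<And>j. j \<in> J \<Longrightarrow> \<phi> j (c (fst j)) = 0" "\<And>j. j \<in> J \<Longrightarrow> \<phi> j (c (snd j)) = 0"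
      "\<And>j x. j \<in> J \<Longrightarrow> 0 \<le> \<phi> j x"
    by (simp_all add: avoiding_bump_def)
  have "\<forall>j\<in>J. \<exists>\<psi>. avoiding_bump (W (n j) (snd j)) (d (snd j) (n j)) (c (fst j)) (c (snd j)) \<psi>"
    by (intro ballI avoiding_bump_exists W J dc cX)
  then obtain \<psi> where "\<forall>j\<in>J. avoiding_bump (W (n j) (snd j)) (d (snd j) (n j)) (c (fst j)) (c (snd j)) (\<psi> j)" by metis
  then have \<psi>: "\<And>j. j \<in> J \<Longrightarrow> continuous_map X euclideanreal (\<psi> j)"
      "\<And>j. j \<in> J \<Longrightarrow> \<psi> j (d (snd j) (n j)) = 1"
      "\<And>j x. j \<in> J \<Longrightarrow> x \<in> topspace X - W (n j) (snd j) \<Longrightarrow> \<psi> j x = 0"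
      "\<And>j. j \<in> J \<Longrightarrow> \<psi> j (c (fst j)) = 0" "\<And>j. j \<in> J \<Longrightarrow> \<psi> j (c (snd j)) = 0"
      "\<And>j x. j \<in> J \<Longrightarrow> 0 \<le> \<psi> j x"
    by (simp_all add: avoiding_bump_def)
  define e where "e j = diffs (d (fst j) (n j)) (c (fst j)) (d (snd j) (n j)) (c (snd j))" for j
  have finite_index: "finite {\<alpha>. \<exists>j\<in>J. \<pi> j = \<alpha> \<and> (\<exists>a\<in>K. ext (\<theta> j) a \<noteq> 0)}"
    if K: "compactin T K" and \<pi>: "\<And>j. j \<in> J \<Longrightarrow> \<pi> j \<in> A"
      and \<theta>: "\<And>j. j \<in> J \<Longrightarrow> continuous_map X euclideanreal (\<theta> j)"
      "\<And>j x. j \<in> J \<Longrightarrow> x \<in> topspace X - W (n j) (\<pi> j) \<Longrightarrow> \<theta> j x = 0"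
    for K \<pi> and \<theta> :: "'j \<times> 'j \<Rightarrow> 'a \<Rightarrow> real"
  proof -
    define N where "N = {\<alpha>. \<exists>j\<in>J. \<pi> j = \<alpha> \<and> (\<exists>a\<in>K. ext (\<theta> j) a \<noteq> 0)}"
    have "\<forall>\<alpha>\<in>N. \<exists>j\<in>J. \<pi> j = \<alpha> \<and> (\<exists>a\<in>K. ext (\<theta> j) a \<noteq> 0)" by (auto simp: N_def)
    then obtain h where h: "\<And>\<alpha>. \<alpha> \<in> N \<Longrightarrow> h \<alpha> \<in> J" "\<And>\<alpha>. \<alpha> \<in> N \<Longrightarrow> \<pi> (h \<alpha>) = \<alpha>"
        "\<And>\<alpha>. \<alpha> \<in> N \<Longrightarrow> \<exists>a\<in>K. ext (\<theta> (h \<alpha>)) a \<noteq> 0" by metis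
    have "compact_finite X N (\<lambda>\<alpha>. \<theta> (h \<alpha>))"
      unfolding compact_finite_def
    proof (intro allI impI)
      fix C assume C: "compactin X C"
      show "finite {\<alpha> \<in> N. \<exists>x\<in>C. \<theta> (h \<alpha>) x \<noteq> 0}"
      proof (rule finite_subset [OF _ key [OF C, of "\<lambda>\<alpha>. n (h \<alpha>)"]], rule subsetI)
        fix \<alpha> assume "\<alpha> \<in> {\<alpha> \<in> N. \<exists>x\<in>C. \<theta> (h \<alpha>) x \<noteq> 0}"
        then obtain x where x: "\<alpha> \<in> N" "x \<in> C" "\<theta> (h \<alpha>) x \<noteq> 0" by auto
        have "x \<in> topspace X" using x(2) compactin_subset_topspace [OF C] by auto
        then have "x \<in> W (n (h \<alpha>)) \<alpha>" using \<theta>(2) [OF h(1) [OF x(1)], of x] x h(2) by auto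
        moreover have "\<alpha> \<in> A" using \<pi> [OF h(1) [OF x(1)]] h(2) x(1) by simp
        ultimately show "\<alpha> \<in> {\<alpha> \<in> A. W (n (h \<alpha>)) \<alpha> \<inter> C \<noteq> {}}" using x(2) by auto
      qed
    qed
    then have "finite {\<alpha> \<in> N. \<exists>a\<in>K. ext (\<theta> (h \<alpha>)) a \<noteq> 0}"
      by (rule compact_finite_ext [OF kX _ _ K]) (use \<theta>(1) h(1) in auto)
    then have "finite {\<alpha> \<in> N. True}" using h(3) by (simp cong: conj_cong)
    then show ?thesis by (simp add: N_def)
  qed
  show ?thesis
  proof (rule not_kR_space [where J = J and \<phi> = \<phi> and \<psi> = \<psi> and e = e])
    show "\<one> \<in> Sub" using Sub(2) reduced_length_le_iff [of \<one> 4] length_le_one by auto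
    show "Sub \<subseteq> carrier G" by (rule Sub)
    show "continuous_map X euclideanreal (\<phi> j)" "continuous_map X euclideanreal (\<psi> j)" if "j \<in> J" for j
      using \<phi>(1) \<psi>(1) that by auto
    show "e j \<in> Sub" if "j \<in> J" for j
      using diffs_length [OF dX cX dX cX, OF J(1) J(1) J(2) J(2), OF that that that that] Sub(2)
      unfolding e_def by auto
    show "1 \<le> ext (\<phi> j) (e j)" "1 \<le> ext (\<psi> j) (e j)" if j: "j \<in> J" for j
      using \<phi> [OF j] \<psi> [OF j] dX cX J [OF j] by (simp_all add: e_def ext_diffs)
  next
    fix K assume K: "compactin T K"
    have "finite ({\<alpha>. \<exists>j\<in>J. fst j = \<alpha> \<and> (\<exists>a\<in>K. ext (\<phi> j) a \<noteq> 0)} \<times>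
        {\<alpha>. \<exists>j\<in>J. snd j = \<alpha> \<and> (\<exists>a\<in>K. ext (\<psi> j) a \<noteq> 0)})"
      by (intro finite_cartesian_product finite_index [OF K] J \<phi>(1,3) \<psi>(1,3))
    then show "finite {j \<in> J. \<exists>a\<in>K. ext (\<phi> j) a \<noteq> 0 \<and> ext (\<psi> j) a \<noteq> 0}"
    proof (rule rev_finite_subset, intro subsetI)
      fix j assume "j \<in> {j \<in> J. \<exists>a\<in>K. ext (\<phi> j) a \<noteq> 0 \<and> ext (\<psi> j) a \<noteq> 0}"
      then have "fst j \<in> {\<alpha>. \<exists>j\<in>J. fst j = \<alpha> \<and> (\<exists>a\<in>K. ext (\<phi> j) a \<noteq> 0)}"
        "snd j \<in> {\<alpha>. \<exists>j\<in>J. snd j = \<alpha> \<and> (\<exists>a\<in>K. ext (\<psi> j) a \<noteq> 0)}" by blast+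
      then show "j \<in> {\<alpha>. \<exists>j\<in>J. fst j = \<alpha> \<and> (\<exists>a\<in>K. ext (\<phi> j) a \<noteq> 0)} \<times>
          {\<alpha>. \<exists>j\<in>J. snd j = \<alpha> \<and> (\<exists>a\<in>K. ext (\<psi> j) a \<noteq> 0)}" by (simp only: mem_Times_iff)
    qed
  next
    fix U assume U: "openin T U" "\<one> \<in> U"
    obtain V where V: "openin T V" "\<one> \<in> V" "\<And>a b. a \<in> V \<Longrightarrow> b \<in> V \<Longrightarrow> a \<otimes> b \<in> U"
      using split_nbhd_one [OF U] by metis
    have "\<exists>M. \<forall>m\<ge>M. i (d \<alpha> m) \<otimes> inv (i (c \<alpha>)) \<in> V" if \<alpha>: "\<alpha> \<in> A" for \<alpha>
    proof -
      have "openin X {x \<in> topspace X. i x \<otimes> inv (i (c \<alpha>)) \<in> V}"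
        by (rule openin_difference_nbhd [OF V(1) cX [OF \<alpha>]])
      moreover have "c \<alpha> \<in> {x \<in> topspace X. i x \<otimes> inv (i (c \<alpha>)) \<in> V}" using cX [OF \<alpha>] V(2) by simp
      ultimately have "\<exists>M. \<forall>m\<ge>M. d \<alpha> m \<in> {x \<in> topspace X. i x \<otimes> inv (i (c \<alpha>)) \<in> V}"
        using lim [OF \<alpha>] unfolding limitin_sequentially by metis
      then show ?thesis by auto
    qed
    then obtain M where M: "\<And>\<alpha> m. \<alpha> \<in> A \<Longrightarrow> m \<ge> M \<alpha> \<Longrightarrow> i (d \<alpha> m) \<otimes> inv (i (c \<alpha>)) \<in> V" by metis
    have "\<exists>k. uncountable {\<alpha> \<in> A. M \<alpha> = k}"
    proof (rule ccontr)
      assume "\<nexists>k. uncountable {\<alpha> \<in> A. M \<alpha> = k}"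
      then have "countable (\<Union>k. {\<alpha> \<in> A. M \<alpha> = k})" by (intro countable_UN) auto
      moreover have "(\<Union>k. {\<alpha> \<in> A. M \<alpha> = k}) = A" by auto
      ultimately show False using A(2) by simp
    qed
    then obtain k where k: "uncountable {\<alpha> \<in> A. M \<alpha> = k}" ..
    define C where "C = {\<alpha> \<in> A. M \<alpha> = k}"
    have "infinite C" using k countable_finite by (auto simp: C_def)
    then obtain f :: "nat \<Rightarrow> 'j" where f: "inj f" "range f \<subseteq> C" using infinite_countable_subset by metis
    have fA: "f l \<in> A" "M (f l) = k" for l using f(2) by (auto simp: C_def)
    \<comment> \<open>The \<open>f l\<close> and all their predecessors are countably many, so the
      uncountable set \<open>C\<close> contains an element that comes after every
      \<open>f l\<close>.\<close>
    have "countable (range f \<union> (\<Union>l. {b \<in> A. (b, f l) \<in> R}))" 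
      by (intro countable_Un countable_UN seg fA(1)) auto
    then have "\<not> C \<subseteq> range f \<union> (\<Union>l. {b \<in> A. (b, f l) \<in> R})"
      using k countable_subset [of C "range f \<union> (\<Union>l. {b \<in> A. (b, f l) \<in> R})"] by (auto simp: C_def)
    then obtain \<alpha> where \<alpha>: "\<alpha> \<in> C" "\<alpha> \<notin> range f" "\<And>l. (\<alpha>, f l) \<notin> R" by (auto simp: C_def)
    have \<alpha>A: "\<alpha> \<in> A" "M \<alpha> = k" using \<alpha>(1) by (auto simp: C_def)
    have less: "(f l, \<alpha>) \<in> R" for l using tot [of "f l" \<alpha>] \<alpha>(2,3) by auto
    have "inj (\<lambda>l. ix \<alpha> (f l))"
    proof (rule injI)
      fix l l' assume "ix \<alpha> (f l) = ix \<alpha> (f l')"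
      then have "f l = f l'"
        using seg [OF \<alpha>A(1)] less fA(1) unfolding ix_def by (auto dest!: to_nat_on_inj [THEN iffD1, rotated 3])
      then show "l = l'" using f(1) by (simp add: inj_eq)
    qed
    then have "infinite (range (\<lambda>l. ix \<alpha> (f l)))" by (rule range_inj_infinite)
    then obtain l where l: "ix \<alpha> (f l) \<ge> k" unfolding infinite_nat_iff_unbounded_le by auto
    have nge: "nn \<alpha> (f l) \<ge> k" using nn [OF \<alpha>A(1) fA(1), of l] l by linarith
    show "\<exists>j\<in>J. e j \<in> U"
    proof
      show "(\<alpha>, f l) \<in> J" using \<alpha>A fA(1) \<alpha>(2) by (auto simp: J_def)
      show "e (\<alpha>, f l) \<in> U"
        unfolding e_def n_def using nge \<alpha>A fA by (auto intro!: V(3) M)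
    qed
  qed
qed

end

section \<open>The structure of \<open>X\<close>\<close>

context k_network_free_group begin

definition big :: "'a set \<Rightarrow> bool" where "big A \<longleftrightarrow> \<not> compactin X (X closure_of A)"

lemma big_mono: "big A \<Longrightarrow> A \<subseteq> B \<Longrightarrow> big B"
  unfolding big_def using closed_compactin [OF _ closure_of_mono closedin_closure_of] by metis

lemma not_big_Union:
  assumes "finite \<F>" "\<And>A. A \<in> \<F> \<Longrightarrow> \<not> big A"
  shows "\<not> big (\<Union>\<F>)"
proof -
  have "compactin X (\<Union>A\<in>\<F>. X closure_of A)"
    using assms by (intro compactin_Union) (auto simp: big_def)
  then show ?thesis using closure_of_Union [OF assms(1), of X] by (simp add: big_def)
qed

text \<open>Failure of compactness gives a bad sequence in the closure of \<open>A\<close>;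
  \<open>g_limit\<close> allows it to be moved into \<open>A\<close> itself.\<close>

lemma big_sequence:
  assumes "big A" "A \<subseteq> topspace X"
  shows "\<exists>s. range s \<subseteq> A \<and> no_convergent_subsequence X s"
proof -
  obtain t where t: "range t \<subseteq> X closure_of A" "no_convergent_subsequence X t"
    using compactin_if_sequentially_compact [of "X closure_of A"] assms(1) unfolding big_def by auto
  have tX: "range t \<subseteq> topspace X" using t(1) closure_of_subset_topspace by (rule subset_trans)
  have "\<exists>y. y \<in> A \<and> y \<in> g n (t n)" for n
  proof -
    have "t n \<in> X closure_of A" "t n \<in> g n (t n)" using t(1) tX g_self by auto
    then show ?thesis using g_open [of n "t n"] by (auto simp: in_closure_of)
  qed
  then obtain s where s: "\<And>n. s n \<in> A" "\<And>n. s n \<in> g n (t n)" by metis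
  have "no_convergent_subsequence X s"
    unfolding no_convergent_subsequence_def
  proof (intro allI impI notI)
    fix r :: "nat \<Rightarrow> nat" and p assume r: "strict_mono r" and p: "limitin X (\<lambda>k. s (r k)) p sequentially"
    have "limitin X (\<lambda>k. t (r k)) p sequentially"
      by (rule g_limit [OF r _ _ p]) (use s tX in auto)
    then show False using t(2) r by (auto simp: no_convergent_subsequence_def)
  qed
  then show ?thesis using s(1) by auto
qed

text \<open>Finite intersections are taken because \<open>k_network_rel_compact\<close> bounds an
  intersection of several covers, not a single member. Compact-countability survives: a compact set
  meeting the intersection meets every set in it.\<close>

definition rel_compact_members :: "'a set set" where
  "rel_compact_members = {R. \<exists>F. finite F \<and> F \<noteq> {} \<and> F \<subseteq> \<P> \<and> R = \<Inter>F \<and> \<not> big R}"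

lemma compact_countable_rel_compact: "compact_countable X rel_compact_members"
  unfolding compact_countable_def
proof (intro allI impI)
  fix K assume K: "compactin X K"
  have "countable {P \<in> \<P>. P \<inter> K \<noteq> {}}" using cc K by (simp add: compact_countable_def)
  then have "countable (Inter ` {F. finite F \<and> F \<subseteq> {P \<in> \<P>. P \<inter> K \<noteq> {}}})"
    by (intro countable_image countable_Collect_finite_subset)
  moreover have "{R \<in> rel_compact_members. R \<inter> K \<noteq> {}} \<subseteq> Inter ` {F. finite F \<and> F \<subseteq> {P \<in> \<P>. P \<inter> K \<noteq> {}}}"
  proof
    fix R assume "R \<in> {R \<in> rel_compact_members. R \<inter> K \<noteq> {}}"
    then obtain F where F: "finite F" "F \<subseteq> \<P>" "R = \<Inter>F" "R \<inter> K \<noteq> {}" by (auto simp: rel_compact_members_def)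
    then have "F \<subseteq> {P \<in> \<P>. P \<inter> K \<noteq> {}}" by auto
    then show "R \<in> Inter ` {F. finite F \<and> F \<subseteq> {P \<in> \<P>. P \<inter> K \<noteq> {}}}" using F by blast
  qed
  ultimately show "countable {R \<in> rel_compact_members. R \<inter> K \<noteq> {}}" by (rule countable_subset [rotated])
qed

lemma \<P>_sub: "P \<in> \<P> \<Longrightarrow> P \<subseteq> topspace X"
  using kn by (auto simp: k_network_def)

text \<open>Koenig's lemma for the tree of finite intersections of members of the \<open>Fc k\<close>.\<close>
lemma decreasing_big_sets:
  assumes fin: "\<And>n. finite (Fc n)" and big: "\<And>m. big (\<Inter>k\<le>m. \<Union>(Fc k))"
    and sub: "\<And>n. \<Union>(Fc n) \<subseteq> topspace X"
  shows "\<exists>Q. \<forall>n. Q n \<subseteq> topspace X \<and> big (Q n) \<and> (\<exists>P\<in>Fc n. Q n \<subseteq> P) \<and> Q (Suc n) \<subseteq> Q n"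
proof -
  define Gn where "Gn m = (\<Inter>k\<le>m. \<Union>(Fc k))" for m :: nat
  have Gmono: "Gn m' \<subseteq> Gn m" if "m \<le> m'" for m m' using that by (auto simp: Gn_def)
  have step: "\<exists>P\<in>Fc n. \<forall>m. big (Q \<inter> P \<inter> Gn m)" if h: "\<forall>m. big (Q \<inter> Gn m)" for n Q
  proof (rule ccontr)
    assume "\<not> ?thesis"
    then have "\<forall>P\<in>Fc n. \<exists>m. \<not> big (Q \<inter> P \<inter> Gn m)" by blast
    then obtain \<mu> where \<mu>: "\<And>P. P \<in> Fc n \<Longrightarrow> \<not> big (Q \<inter> P \<inter> Gn (\<mu> P))" by metis
    define m where "m = Max (insert n (\<mu> ` Fc n))"
    have m: "n \<le> m" "\<And>P. P \<in> Fc n \<Longrightarrow> \<mu> P \<le> m" using fin [of n] by (auto simp: m_def)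
    have "\<not> big (\<Union>((\<lambda>P. Q \<inter> P \<inter> Gn m) ` Fc n))"
    proof (rule not_big_Union)
      fix A assume "A \<in> (\<lambda>P. Q \<inter> P \<inter> Gn m) ` Fc n"
      then obtain P where P: "P \<in> Fc n" "A = Q \<inter> P \<inter> Gn m" by auto
      have "A \<subseteq> Q \<inter> P \<inter> Gn (\<mu> P)" using P Gmono [OF m(2) [OF P(1)]] by auto
      then show "\<not> big A" using \<mu> [OF P(1)] big_mono by metis
    qed (use fin in auto)
    moreover have "Q \<inter> Gn m \<subseteq> \<Union>((\<lambda>P. Q \<inter> P \<inter> Gn m) ` Fc n)"
      using m(1) by (auto simp: Gn_def)
    ultimately show False using h big_mono by metis
  qed
  have "\<exists>Q. \<forall>n. ((\<forall>m. big (Q n \<inter> Gn m)) \<and> (\<exists>P\<in>Fc n. Q n \<subseteq> P)) \<and> Q (Suc n) \<subseteq> Q n"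
  proof (rule dependent_nat_choice)
    have "\<forall>m. big (UNIV \<inter> Gn m)" using big by (simp add: Gn_def)
    from step [OF this, of 0] obtain P where "P \<in> Fc 0" "\<forall>m. big (UNIV \<inter> P \<inter> Gn m)" ..
    then show "\<exists>Q. (\<forall>m. big (Q \<inter> Gn m)) \<and> (\<exists>P\<in>Fc 0. Q \<subseteq> P)" by (intro exI [of _ P]) auto
  next
    fix Q n assume "(\<forall>m. big (Q \<inter> Gn m)) \<and> (\<exists>P\<in>Fc n. Q \<subseteq> P)"
    then have "\<forall>m. big (Q \<inter> Gn m)" ..
    from step [OF this, of "Suc n"] obtain P where "P \<in> Fc (Suc n)" "\<forall>m. big (Q \<inter> P \<inter> Gn m)" ..
    then show "\<exists>Q'. ((\<forall>m. big (Q' \<inter> Gn m)) \<and> (\<exists>P\<in>Fc (Suc n). Q' \<subseteq> P)) \<and> Q' \<subseteq> Q"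
      by (intro exI [of _ "Q \<inter> P"]) auto
  qed
  then obtain Q where Q: "\<And>n m. big (Q n \<inter> Gn m)" "\<And>n. \<exists>P\<in>Fc n. Q n \<subseteq> P" "\<And>n. Q (Suc n) \<subseteq> Q n"
    by metis
  have "Q n \<subseteq> topspace X" for n using Q(2) [of n] sub [of n] by auto
  moreover have "big (Q n)" for n using Q(1) [of n 0] by (rule big_mono) simp
  ultimately show ?thesis using Q(2,3) by (intro exI [of _ Q]) simp
qed

text \<open>The finite covers of \<open>K\<close> by members meeting \<open>K\<close> can be
  enumerated. If all finite intersections of their unions were big, the sets from
  \<open>decreasing_big_sets\<close> would shrink to a point of \<open>K\<close>; sequences without
  convergent subsequences inside them, together with the Q-array, would form the configuration of
  \<open>fan_obstruction\<close>. So finitely many of the covers already intersect in a relatively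
  compact set.\<close>

lemma k_network_rel_compact:
  assumes Q: "Q_array X c d"
    and Sub: "Sub \<subseteq> carrier G" "{a \<in> carrier G. reduced_length X G i a \<le> 4} \<subseteq> Sub"
    and kR: "k\<^sub>R_space (subtopology T Sub)"
  shows "k_network X rel_compact_members"
  unfolding k_network_def
proof (intro conjI allI impI)
  show "rel_compact_members \<subseteq> Pow (topspace X)"
    using \<P>_sub by (auto simp: rel_compact_members_def)
  fix K U assume "compactin X K \<and> openin X U \<and> K \<subseteq> U"
  then have K: "compactin X K" and U: "openin X U" "K \<subseteq> U" by auto
  define PK where "PK = {P \<in> \<P>. P \<inter> K \<noteq> {}}"
  have PKc: "countable PK" using cc K by (simp add: compact_countable_def PK_def)
  define \<C> where "\<C> = {F. finite F \<and> F \<subseteq> PK \<and> K \<subseteq> \<Union>F}"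
  have "\<C> \<subseteq> {F. finite F \<and> F \<subseteq> PK}" by (auto simp: \<C>_def)
  then have \<C>c: "countable \<C>" using countable_Collect_finite_subset [OF PKc] countable_subset by blast
  have mk: "{P \<in> F. P \<inter> K \<noteq> {}} \<in> \<C>" if "finite F" "F \<subseteq> \<P>" "K \<subseteq> \<Union>F" for F
  proof -
    have "K \<subseteq> \<Union>{P \<in> F. P \<inter> K \<noteq> {}}" using that(3) by blast
    then show ?thesis using that by (auto simp: \<C>_def PK_def)
  qed
  obtain F1 where F1: "F1 \<subseteq> \<P>" "finite F1" "K \<subseteq> \<Union>F1" "\<Union>F1 \<subseteq> U"
    by (rule k_networkD [OF kn K U])
  define F0 where "F0 = {P \<in> F1. P \<inter> K \<noteq> {}}"
  have F0: "F0 \<in> \<C>" "\<Union>F0 \<subseteq> U" using mk [OF F1(2,1,3)] F1(4) by (auto simp: F0_def)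
  define e where "e = from_nat_into \<C>"
  have e: "range e = \<C>" using F0 \<C>c by (auto simp: e_def intro!: range_from_nat_into)
  \<comment> \<open>Position 0 is reserved for a cover inside \<open>U\<close>, which keeps every
    later intersection inside \<open>U\<close>.\<close>
  define Fc where "Fc n = (case n of 0 \<Rightarrow> F0 | Suc k \<Rightarrow> e k)" for n
  have Fc: "Fc n \<in> \<C>" for n using F0 e by (auto simp: Fc_def split: nat.split)
  have Fc': "finite (Fc n)" "Fc n \<subseteq> \<P>" "K \<subseteq> \<Union>(Fc n)" for n using Fc [of n] by (auto simp: \<C>_def PK_def)
  have FcX: "\<Union>(Fc n) \<subseteq> topspace X" for n using Fc'(2) [of n] \<P>_sub by blast
  have "\<exists>m. \<not> big (\<Inter>k\<le>m. \<Union>(Fc k))"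
  proof (rule ccontr)
    assume "\<nexists>m. \<not> big (\<Inter>k\<le>m. \<Union>(Fc k))"
    then have "\<And>m. big (\<Inter>k\<le>m. \<Union>(Fc k))" by blast
    from decreasing_big_sets [OF Fc'(1) this FcX] obtain D where
      "\<forall>n. D n \<subseteq> topspace X \<and> big (D n) \<and> (\<exists>P\<in>Fc n. D n \<subseteq> P) \<and> D (Suc n) \<subseteq> D n" ..
    then have D: "\<And>n. D n \<subseteq> topspace X" "\<And>n. big (D n)" "\<And>n. \<exists>P\<in>Fc n. D n \<subseteq> P" by auto
    \<comment> \<open>Otherwise every point of \<open>K\<close> has a neighbourhood containing no
      \<open>D n\<close>. By regularity and the k-network, finitely many of these neighbourhoods are
      refined by a finite cover of \<open>K\<close>; it occurs in the enumeration, so some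
      \<open>D n\<close> lies in one of its members, a contradiction.\<close>
    have "\<exists>x\<in>K. \<forall>V. openin X V \<longrightarrow> x \<in> V \<longrightarrow> (\<exists>n. D n \<subseteq> V)"
    proof (rule ccontr)
      assume "\<not> ?thesis"
      then have "\<forall>x\<in>K. \<exists>V. openin X V \<and> x \<in> V \<and> (\<forall>n. \<not> D n \<subseteq> V)" by auto
      then obtain O' where O': "\<And>x. x \<in> K \<Longrightarrow> openin X (O' x)" "\<And>x. x \<in> K \<Longrightarrow> x \<in> O' x"
        "\<And>x n. x \<in> K \<Longrightarrow> \<not> D n \<subseteq> O' x" by metis
      have "\<forall>x\<in>K. \<exists>V. openin X V \<and> x \<in> V \<and> X closure_of V \<subseteq> O' x"
        using regular_space_closure_nbhd [OF reg O'(1,2)] by metis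
      then obtain V where V: "\<And>x. x \<in> K \<Longrightarrow> openin X (V x)" "\<And>x. x \<in> K \<Longrightarrow> x \<in> V x"
        "\<And>x. x \<in> K \<Longrightarrow> X closure_of (V x) \<subseteq> O' x" by metis
      have "\<And>C. C \<in> V ` K \<Longrightarrow> openin X C" "K \<subseteq> \<Union>(V ` K)" using V by auto
      then obtain \<D> where \<D>: "finite \<D>" "\<D> \<subseteq> V ` K" "K \<subseteq> \<Union>\<D>" using compactinD [OF K, of "V ` K"] by metis
      then obtain L where L: "finite L" "L \<subseteq> K" "\<D> = V ` L" using finite_subset_image [of \<D> V K] by metis
      have "\<exists>F. F \<subseteq> \<P> \<and> finite F \<and> K \<inter> X closure_of (V x) \<subseteq> \<Union>F \<and> \<Union>F \<subseteq> O' x" if x: "x \<in> L" for x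
      proof -
        have xK: "x \<in> K" using x L by auto
        have c: "compactin X (K \<inter> X closure_of (V x))"
          using closed_Int_compactin [OF closedin_closure_of K] by (simp add: Int_commute)
        have "K \<inter> X closure_of (V x) \<subseteq> O' x" using V(3) [OF xK] by auto
        then show ?thesis using k_networkD [OF kn c O'(1) [OF xK]] by metis
      qed
      then obtain Fx where Fx: "\<And>x. x \<in> L \<Longrightarrow> Fx x \<subseteq> \<P> \<and> finite (Fx x) \<and>
          K \<inter> X closure_of (V x) \<subseteq> \<Union>(Fx x) \<and> \<Union>(Fx x) \<subseteq> O' x" by metis
      define F where "F = (\<Union>x\<in>L. Fx x)"
      have "finite F" using L Fx by (auto simp: F_def)
      moreover have "F \<subseteq> \<P>" unfolding F_def using Fx by blast
      moreover have "K \<subseteq> \<Union>F"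
      proof
        fix y assume y: "y \<in> K"
        then obtain x where x: "x \<in> L" "y \<in> V x" using \<D>(3) L(3) by auto
        then have "V x \<subseteq> X closure_of (V x)" using V(1) L(2) by (intro closure_of_subset openin_subset) auto
        then have "y \<in> \<Union>(Fx x)" using Fx [OF x(1)] x y by auto
        then show "y \<in> \<Union>F" using x(1) by (auto simp: F_def)
      qed
      ultimately have "{P \<in> F. P \<inter> K \<noteq> {}} \<in> \<C>" by (rule mk)
      then have "{P \<in> F. P \<inter> K \<noteq> {}} \<in> range e" using e by simp
      then obtain n where n: "{P \<in> F. P \<inter> K \<noteq> {}} = e n" by (rule rangeE)
      have "Fc (Suc n) \<subseteq> F" by (simp add: Fc_def n [symmetric])
      then obtain P where "P \<in> F" "D (Suc n) \<subseteq> P" using D(3) [of "Suc n"] by auto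
      then obtain x where "x \<in> L" "D (Suc n) \<subseteq> O' x" using Fx by (fastforce simp: F_def)
      then show False using O'(3) L(2) by blast
    qed
    then obtain b where b: "b \<in> K" "\<And>V. openin X V \<Longrightarrow> b \<in> V \<Longrightarrow> \<exists>n. D n \<subseteq> V" by metis
    have "\<forall>n. \<exists>s. range s \<subseteq> D n \<and> no_convergent_subsequence X s"
      using big_sequence D(1,2) by simp
    then obtain B where B0: "\<And>n. range (B n) \<subseteq> D n" "\<And>n. no_convergent_subsequence X (B n)" by metis
    have BD: "B n m \<in> D n" for n m using B0(1) by (rule range_subsetD)
    have "\<not> k\<^sub>R_space (subtopology T Sub)"
    proof (rule fan_obstruction [OF Q _ _ _ B0(2) Sub])
      show "b \<in> topspace X" using b(1) compactin_subset_topspace [OF K] by auto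
      show "B n m \<in> topspace X" for n m using BD D(1) by blast
      show "\<exists>n. \<forall>m. B n m \<in> V" if "openin X V" "b \<in> V" for V
        using b(2) [OF that] BD by blast
    qed
    then show False using kR by simp
  qed
  then obtain m where m: "\<not> big (\<Inter>k\<le>m. \<Union>(Fc k))" by blast
  \<comment> \<open>By distributivity the intersection of the unions is the union of the
    intersections along choice functions.\<close>
  define \<H> where "\<H> = (\<lambda>f. \<Inter>(f ` {..m})) ` (PiE {..m} Fc)"
  have \<H>sub: "H \<subseteq> (\<Inter>k\<le>m. \<Union>(Fc k))" if "H \<in> \<H>" for H
  proof -
    obtain f where f: "f \<in> PiE {..m} Fc" "H = \<Inter>(f ` {..m})" using \<open>H \<in> \<H>\<close> by (auto simp: \<H>_def)
    have "H \<subseteq> \<Union>(Fc k)" if "k \<le> m" for k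
    proof -
      have "f k \<in> Fc k" using PiE_mem [OF f(1), of k] that by simp
      moreover have "H \<subseteq> f k" using f(2) that by auto
      ultimately show ?thesis by auto
    qed
    then show ?thesis by auto
  qed
  have \<H>cov: "(\<Inter>k\<le>m. \<Union>(Fc k)) \<subseteq> \<Union>\<H>"
  proof
    fix x assume "x \<in> (\<Inter>k\<le>m. \<Union>(Fc k))"
    then have "\<forall>k\<in>{..m}. \<exists>P. P \<in> Fc k \<and> x \<in> P" by auto
    then obtain f where f: "\<And>k. k \<le> m \<Longrightarrow> f k \<in> Fc k" "\<And>k. k \<le> m \<Longrightarrow> x \<in> f k" by (metis atMost_iff)
    have "restrict f {..m} \<in> PiE {..m} Fc" using f by auto
    then have "\<Inter>(restrict f {..m} ` {..m}) \<in> \<H>" unfolding \<H>_def by blast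
    moreover have "x \<in> \<Inter>(restrict f {..m} ` {..m})" using f by auto
    ultimately show "x \<in> \<Union>\<H>" by blast
  qed
  show "\<exists>\<F>\<subseteq>rel_compact_members. finite \<F> \<and> K \<subseteq> \<Union>\<F> \<and> \<Union>\<F> \<subseteq> U"
  proof (intro exI [of _ \<H>] conjI)
    show "finite \<H>" unfolding \<H>_def using Fc'(1) by (intro finite_imageI finite_PiE) auto
    show "K \<subseteq> \<Union>\<H>" using \<H>cov Fc'(3) by blast
    have "\<Union>\<H> \<subseteq> (\<Inter>k\<le>m. \<Union>(Fc k))" using \<H>sub by (rule Union_least)
    also have "\<dots> \<subseteq> \<Union>(Fc 0)" by blast
    also have "Fc 0 = F0" by (simp add: Fc_def)
    finally show "\<Union>\<H> \<subseteq> U" using F0(2) by (rule subset_trans)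
    show "\<H> \<subseteq> rel_compact_members"
    proof
      fix H assume H: "H \<in> \<H>"
      then obtain f where f: "f \<in> PiE {..m} Fc" "H = \<Inter>(f ` {..m})" by (auto simp: \<H>_def)
      have "\<not> big H" using m \<H>sub [OF H] big_mono by blast
      moreover have "f ` {..m} \<subseteq> \<P>" using f(1) Fc'(2) by (fastforce simp: PiE_iff)
      ultimately show "H \<in> rel_compact_members"
        unfolding rel_compact_members_def using f(2) by (intro CollectI exI [of _ "f ` {..m}"]) auto
    qed
  qed
qed

end

section \<open>Splitting the space into a k_omega-part and a discrete part\<close>

lemma openin_clopen_sum_homeomorphic:
  assumes Y: "openin X Y" and D: "\<And>E. E \<subseteq> topspace X - Y \<Longrightarrow> openin X E"
  shows "X homeomorphic_space
    sum_topology (\<lambda>b. if b then subtopology X Y else discrete_topology (topspace X - Y)) (UNIV :: bool set)"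
    (is "X homeomorphic_space ?S")
proof -
  define h where "h x = (x \<in> Y, x)" for x
  have YX: "Y \<subseteq> topspace X" using Y openin_subset by auto
  have "continuous_map X ?S h"
    unfolding continuous_map_def
  proof (intro conjI allI impI)
    show "h \<in> topspace X \<rightarrow> topspace ?S" using YX by (auto simp: h_def topspace_sum_topology)
    fix W assume "openin ?S W"
    then have Wb: "openin (if b then subtopology X Y else discrete_topology (topspace X - Y)) {x. (b, x) \<in> W}"
      for b unfolding openin_sum_topology by auto
    have W: "openin (subtopology X Y) {x. (True, x) \<in> W}" "{x. (False, x) \<in> W} \<subseteq> topspace X - Y"
      using Wb [of True] Wb [of False] by simp_all
    have eq: "{x \<in> topspace X. h x \<in> W} = {x. (True, x) \<in> W} \<union> {x. (False, x) \<in> W}"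
    proof (rule Set.set_eqI)
      fix x
      show "x \<in> {x \<in> topspace X. h x \<in> W} \<longleftrightarrow> x \<in> {x. (True, x) \<in> W} \<union> {x. (False, x) \<in> W}"
        using W(2) openin_subset [OF W(1)] YX by (cases "x \<in> Y") (auto simp: h_def)
    qed
    have "openin X {x. (True, x) \<in> W}" using W(1) openin_open_subtopology [OF Y] by simp
    then show "openin X {x \<in> topspace X. h x \<in> W}" unfolding eq by (rule openin_Un [OF _ D [OF W(2)]])
  qed
  moreover have "continuous_map ?S X snd"
    unfolding continuous_map_def
  proof (intro conjI allI impI)
    show "snd \<in> topspace ?S \<rightarrow> topspace X" using YX by (auto simp: topspace_sum_topology split: if_splits)
    fix U assume U: "openin X U"
    show "openin ?S {p \<in> topspace ?S. snd p \<in> U}"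
      unfolding openin_sum_topology
    proof (intro conjI ballI)
      show "{p \<in> topspace ?S. snd p \<in> U} \<subseteq> Sigma UNIV (topspace \<circ>
          (\<lambda>b. if b then subtopology X Y else discrete_topology (topspace X - Y)))"
        by (auto simp: topspace_sum_topology)
      fix b :: bool
      have "{x. (True, x) \<in> {p \<in> topspace ?S. snd p \<in> U}} = Y \<inter> U"
        using YX by (auto simp: topspace_sum_topology)
      moreover have "openin (subtopology X Y) (Y \<inter> U)" using U by (simp add: openin_subtopology_Int2)
      moreover have "{x. (False, x) \<in> {p \<in> topspace ?S. snd p \<in> U}} \<subseteq> topspace X - Y"
        by (auto simp: topspace_sum_topology)
      ultimately show "openin (if b then subtopology X Y else discrete_topology (topspace X - Y))
          {x. (b, x) \<in> {p \<in> topspace ?S. snd p \<in> U}}"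
        by (cases b) simp_all
    qed
  qed
  moreover have "snd (h x) = x" for x by (simp add: h_def)
  moreover have "h (snd p) = p" if "p \<in> topspace ?S" for p
    using that by (cases p) (auto simp: topspace_sum_topology h_def split: if_splits)
  ultimately show ?thesis unfolding homeomorphic_space_def homeomorphic_maps_def by blast
qed

context sequential_stratified begin

text \<open>A nontrivial convergent sequence outside \<open>Y\<close> would lie infinitely often in
  one member, which would then be in \<open>Act\<close> and hence part of \<open>Y\<close>. So all
  subsets of the complement are closed. \<open>Y\<close> is closed as well, since a convergent
  sequence in \<open>Y\<close> lies infinitely often in a member of \<open>Cl\<close>, whose closure
  stays in \<open>Y\<close>.\<close>

lemma sum_structure:
  assumes kn: "k_network X \<R>" and cc: "compact_countable X \<R>"
    and rc: "\<And>R. R \<in> \<R> \<Longrightarrow> compactin X (X closure_of R)"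
    and cnt: "\<And>(\<A> :: 'a set set) c d. (\<And>\<alpha>. \<alpha> \<in> \<A> \<Longrightarrow> limitin X (d \<alpha>) (c \<alpha>) sequentially) \<Longrightarrow>
      (\<And>\<alpha> m. \<alpha> \<in> \<A> \<Longrightarrow> d \<alpha> m \<in> topspace X - {c \<alpha>}) \<Longrightarrow>
      (\<And>K. compactin X K \<Longrightarrow> finite {\<alpha> \<in> \<A>. \<exists>m. d \<alpha> m \<in> K}) \<Longrightarrow> countable \<A>"
  shows "sum_of_k\<^sub>\<omega>_and_discrete X"
proof -
  have RX: "R \<subseteq> topspace X" if "R \<in> \<R>" for R using kn that by (auto simp: k_network_def)
  have Rcl: "R \<subseteq> X closure_of R" if "R \<in> \<R>" for R using RX [OF that] by (rule closure_of_subset)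
  have cov: "\<exists>F. finite F \<and> F \<subseteq> \<R> \<and> K \<subseteq> \<Union>F" if K: "compactin X K" for K
    using k_networkD [OF kn K openin_topspace compactin_subset_topspace [OF K]] by metis
  have covp: "\<exists>R\<in>\<R>. p \<in> R" if "p \<in> topspace X" for p
    using cov [of "{p}"] that by auto
  have cntR: "countable {R' \<in> \<R>. R' \<inter> X closure_of R \<noteq> {}}" if "R \<in> \<R>" for R
    using cc rc [OF that] by (simp add: compact_countable_def)
  define Act where "Act = {R \<in> \<R>. \<exists>c d. limitin X d c sequentially \<and> (\<forall>m::nat. d m \<in> R - {c})}"
  have pig: "\<exists>R\<in>\<R>. infinite {n. s n \<in> R} \<and> p \<in> X closure_of R"
    if p: "limitin X s p sequentially" and s: "range s \<subseteq> topspace X" for s p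
  proof -
    obtain F where F: "finite F" "F \<subseteq> \<R>" "insert p (range s) \<subseteq> \<Union>F"
      using cov [OF compactin_limit_sequence [OF p s]] by auto
    have "\<exists>R\<in>F. infinite {n. s n \<in> R}"
    proof (rule ccontr)
      assume "\<not> (\<exists>R\<in>F. infinite {n. s n \<in> R})"
      then have "finite (\<Union>R\<in>F. {n. s n \<in> R})" using F(1) by blast
      moreover have "(\<Union>R\<in>F. {n. s n \<in> R}) = UNIV" using F(3) by auto
      ultimately show False by simp
    qed
    then obtain R where R: "R \<in> F" "infinite {n. s n \<in> R}" by blast
    then obtain r :: "nat \<Rightarrow> nat" where r: "strict_mono r" "\<And>k. r k \<in> {n. s n \<in> R}"
      using infinite_nat_subseq [of "{n. s n \<in> R}"] by metis
    have RR: "R \<in> \<R>" using R F by auto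
    have "p \<in> X closure_of R"
      by (rule limit_in_closed [OF closedin_closure_of limit_subseq [OF r(1) p], of 0]) (use r(2) Rcl [OF RR] in auto)
    then show ?thesis using R RR by blast
  qed
  have Actc: "countable Act"
  proof (rule ccontr)
    assume unc: "uncountable Act"
    \<comment> \<open>A member meets only countably many others, since its closure is compact. The
      classes of members connected by chains are therefore countable, and an uncountable
      \<open>Act\<close> would meet uncountably many of them.\<close>
    define E where "E = {(R, R'). R \<in> \<R> \<and> R' \<in> \<R> \<and> R \<inter> R' \<noteq> {}}"
    have symE: "sym (E\<^sup>*)" by (intro sym_rtrancl) (auto simp: E_def sym_def)
    have Ec: "countable (E `` Z)" if "countable Z" for Z
    proof (rule countable_subset)
      show "E `` Z \<subseteq> (\<Union>R\<in>Z \<inter> \<R>. {R' \<in> \<R>. R' \<inter> X closure_of R \<noteq> {}})"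
        using Rcl by (fastforce simp: E_def)
      show "countable (\<Union>R\<in>Z \<inter> \<R>. {R' \<in> \<R>. R' \<inter> X closure_of R \<noteq> {}})"
        using that cntR by (intro countable_UN) auto
    qed
    have compc: "countable (E\<^sup>* `` {R})" for R by (rule countable_rtrancl [OF Ec]) auto
    \<comment> \<open>A member of \<open>\<R>\<close> meets at most one of the sets chosen from different classes.\<close>
    define rp where "rp R = (SOME R'. R' \<in> Act \<and> (R, R') \<in> E\<^sup>*)" for R
    have rp: "rp R \<in> Act \<and> (R, rp R) \<in> E\<^sup>*" if "R \<in> Act" for R
      unfolding rp_def by (rule someI [of _ R]) (use that in auto)
    define \<A> where "\<A> = rp ` Act"
    have "Act \<subseteq> (\<Union>R\<in>\<A>. E\<^sup>* `` {R})" using rp symE by (fastforce simp: \<A>_def sym_def)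
    then have Aunc: "uncountable \<A>" using unc compc countable_UN countable_subset by (metis (no_types, lifting))
    have AAct: "\<A> \<subseteq> Act" using rp by (auto simp: \<A>_def)
    have Aeq: "R1 = R2" if h: "R1 \<in> \<A>" "R2 \<in> \<A>" "(R1, R2) \<in> E\<^sup>*" for R1 R2
    proof -
      obtain R1' R2' where R': "R1' \<in> Act" "R1 = rp R1'" "R2' \<in> Act" "R2 = rp R2'" using h by (auto simp: \<A>_def)
      have tr: "trans (E\<^sup>*)" by (rule trans_rtrancl)
      have "(R1', R2') \<in> E\<^sup>*"
        using rp [OF R'(1)] rp [OF R'(3)] R' h(3) symE by (meson rtrancl_trans symD)
      then have "(R1', R) \<in> E\<^sup>* \<longleftrightarrow> (R2', R) \<in> E\<^sup>*" for R using symE by (meson rtrancl_trans symD)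
      then show ?thesis using R' by (simp add: rp_def)
    qed
    have "\<forall>R\<in>\<A>. \<exists>c d. limitin X d c sequentially \<and> (\<forall>m::nat. d m \<in> R - {c})"
      using AAct by (auto simp: Act_def)
    then obtain c d where cd: "\<And>R. R \<in> \<A> \<Longrightarrow> limitin X (d R) (c R) sequentially"
      "\<And>R m. R \<in> \<A> \<Longrightarrow> d R m \<in> R - {c R}" by metis
    have AR: "R \<in> \<R>" if "R \<in> \<A>" for R using AAct that by (auto simp: Act_def)
    have "countable \<A>"
    proof (rule cnt [of \<A> d c])
      show "limitin X (d R) (c R) sequentially" if "R \<in> \<A>" for R using cd(1) that .
      show "d R m \<in> topspace X - {c R}" if "R \<in> \<A>" for R m using cd(2) [OF that] RX [OF AR [OF that]] by auto
      fix K assume K: "compactin X K"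
      obtain F where F: "finite F" "F \<subseteq> \<R>" "K \<subseteq> \<Union>F" using cov [OF K] by auto
      have "finite {R \<in> \<A>. (R0, R) \<in> E\<^sup>*}" for R0
      proof (cases "\<exists>R1. R1 \<in> \<A> \<and> (R0, R1) \<in> E\<^sup>*")
        case True
        then obtain R1 where R1: "R1 \<in> \<A>" "(R0, R1) \<in> E\<^sup>*" by blast
        have "{R \<in> \<A>. (R0, R) \<in> E\<^sup>*} \<subseteq> {R1}"
          using Aeq [OF R1(1)] R1(2) symE by (auto dest: symD intro: rtrancl_trans)
        then show ?thesis using finite_subset by blast
      next
        case False
        then have "{R \<in> \<A>. (R0, R) \<in> E\<^sup>*} = {}" by auto
        then show ?thesis by (metis finite.emptyI)
      qed
      then have "finite (\<Union>R0\<in>F. {R \<in> \<A>. (R0, R) \<in> E\<^sup>*})" using F(1) by blast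
      moreover have "{R \<in> \<A>. \<exists>m. d R m \<in> K} \<subseteq> (\<Union>R0\<in>F. {R \<in> \<A>. (R0, R) \<in> E\<^sup>*})"
      proof
        fix R assume "R \<in> {R \<in> \<A>. \<exists>m. d R m \<in> K}"
        then obtain m where R: "R \<in> \<A>" "d R m \<in> K" by auto
        then obtain R0 where R0: "R0 \<in> F" "d R m \<in> R0" using F(3) by auto
        then have "(R0, R) \<in> E" using R F(2) AR cd(2) [OF R(1), of m] by (auto simp: E_def)
        then show "R \<in> (\<Union>R0\<in>F. {R \<in> \<A>. (R0, R) \<in> E\<^sup>*})" using R0 R by auto
      qed
      ultimately show "finite {R \<in> \<A>. \<exists>m. d R m \<in> K}" by (rule finite_subset [rotated])
    qed
    then show False using Aunc by simp
  qed
  \<comment> \<open>Unlike \<open>E\<close>, this relation looks at the closure of the first member,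
    so that the union of a family closed under it contains the closures of all its members
    (\<open>clY\<close>).\<close>
  define N where "N = {(R, R'). R \<in> \<R> \<and> R' \<in> \<R> \<and> R' \<inter> X closure_of R \<noteq> {}}"
  have Nc: "countable (N `` Z)" if "countable Z" for Z
  proof (rule countable_subset)
    show "N `` Z \<subseteq> (\<Union>R\<in>Z \<inter> \<R>. {R' \<in> \<R>. R' \<inter> X closure_of R \<noteq> {}})" by (auto simp: N_def)
    show "countable (\<Union>R\<in>Z \<inter> \<R>. {R' \<in> \<R>. R' \<inter> X closure_of R \<noteq> {}})"
      using that cntR by (intro countable_UN) auto
  qed
  define Cl where "Cl = N\<^sup>* `` Act"
  have Clc: "countable Cl" unfolding Cl_def by (rule countable_rtrancl [OF Nc Actc])
  have ActCl: "Act \<subseteq> Cl" by (auto simp: Cl_def)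
  have ClN: "R' \<in> Cl" if "R \<in> Cl" "(R, R') \<in> N" for R R'
    using that by (auto simp: Cl_def intro: rtrancl_into_rtrancl)
  have ClR: "R \<in> \<R>" if "R \<in> Cl" for R
    using that unfolding Cl_def by (auto simp: Act_def N_def elim: rtranclE)
  define Y where "Y = \<Union>Cl"
  have YX: "Y \<subseteq> topspace X" using ClR RX by (auto simp: Y_def)
  have clY: "X closure_of R \<subseteq> Y" if R: "R \<in> Cl" for R
  proof
    fix y assume y: "y \<in> X closure_of R"
    then obtain R' where R': "R' \<in> \<R>" "y \<in> R'" using covp in_closure_of by metis
    then have "(R, R') \<in> N" using y ClR [OF R] by (auto simp: N_def)
    then have "R' \<in> Cl" by (rule ClN [OF R])
    then show "y \<in> Y" using R' by (auto simp: Y_def)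
  qed
  have meetY: "R' \<in> Cl" if h: "R' \<in> \<R>" "y \<in> R'" "y \<in> Y" for R' y
  proof -
    obtain R where R: "R \<in> Cl" "y \<in> R" using h(3) by (auto simp: Y_def)
    then have "(R, R') \<in> N" using h ClR [OF R(1)] Rcl [OF ClR [OF R(1)]] by (auto simp: N_def)
    then show ?thesis by (rule ClN [OF R(1)])
  qed
  have pigY: "\<exists>R\<in>Cl. infinite {n. s n \<in> R} \<and> p \<in> X closure_of R"
    if p: "limitin X s p sequentially" and s: "range s \<subseteq> Y" for s p
  proof -
    obtain R where R: "R \<in> \<R>" "infinite {n. s n \<in> R}" "p \<in> X closure_of R"
      using pig [OF p subset_trans [OF s YX]] by blast
    then obtain n where "s n \<in> R" using not_finite_existsD by blast
    then have "R \<in> Cl" using meetY [OF R(1)] s by auto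
    then show ?thesis using R by blast
  qed
  have Dcl: "closedin X E" if E: "E \<subseteq> topspace X - Y" for E
  proof (rule seq_closed)
    show "E \<subseteq> topspace X" using E by auto
    fix s p assume s: "range s \<subseteq> E" and p: "limitin X s p sequentially"
    show "p \<in> E"
    proof (rule ccontr)
      assume pE: "p \<notin> E"
      have sX: "range s \<subseteq> topspace X" using s E by auto
      obtain R where R: "R \<in> \<R>" "infinite {n. s n \<in> R}" using pig [OF p sX] by blast
      then obtain r :: "nat \<Rightarrow> nat" where r: "strict_mono r" "\<And>k. r k \<in> {n. s n \<in> R}"
        using infinite_nat_subseq [of "{n. s n \<in> R}"] by metis
      have "\<forall>m. s (r m) \<in> R - {p}" using r(2) s pE by auto
      then have "R \<in> Act" using R(1) limit_subseq [OF r(1) p] unfolding Act_def by blast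
      then have "s (r 0) \<in> Y" using ActCl r(2) [of 0] by (auto simp: Y_def)
      then show False using s E by auto
    qed
  qed
  have "openin X (topspace X - (topspace X - Y))" using Dcl [of "topspace X - Y"] by (intro openin_diff) auto
  then have openY: "openin X Y" using YX by (simp add: double_diff)
  have closedY: "closedin X Y"
  proof (rule seq_closed [OF YX])
    fix s p assume "range s \<subseteq> Y" "limitin X s p sequentially"
    then show "p \<in> Y" using pigY clY by blast
  qed
  have openD: "openin X E" if E: "E \<subseteq> topspace X - Y" for E
  proof -
    have "closedin X ((topspace X - Y - E) \<union> Y)" using Dcl [of "topspace X - Y - E"] closedY by (intro closedin_Un) auto
    then have "openin X (topspace X - ((topspace X - Y - E) \<union> Y))" by (simp add: openin_diff)
    moreover have "topspace X - ((topspace X - Y - E) \<union> Y) = E" using E by auto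
    ultimately show ?thesis by simp
  qed
  have "k\<^sub>\<omega>_space (subtopology X Y)"
  proof -
    define C where "C n = (if Cl = {} then {} else X closure_of (from_nat_into Cl n))" for n
    have C: "compactin (subtopology X Y) (C n)" for n
      using from_nat_into [of Cl n] rc ClR clY by (auto simp: C_def compactin_subtopology)
    moreover have "closedin (subtopology X Y) F"
      if F: "F \<subseteq> topspace (subtopology X Y)"
        and FC: "\<forall>n. closedin (subtopology (subtopology X Y) (C n)) (F \<inter> C n)" for F
    proof -
      have FY: "F \<subseteq> Y" using F by auto
      have FR: "closedin X (F \<inter> X closure_of R)" if R: "R \<in> Cl" for R
      proof -
        obtain n where n: "from_nat_into Cl n = R" using from_nat_into_surj [OF Clc R] by blast
        then have CR: "C n = X closure_of R" using R by (auto simp: C_def)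
        have "subtopology (subtopology X Y) (C n) = subtopology X (X closure_of R)"
          using clY [OF R] by (simp add: CR subtopology_subtopology Int_absorb1)
        then have "closedin (subtopology X (X closure_of R)) (F \<inter> X closure_of R)" using FC CR by metis
        then show ?thesis using closedin_closed_subtopology [OF closedin_closure_of] by metis
      qed
      have "closedin X F"
      proof (rule seq_closed)
        show "F \<subseteq> topspace X" using FY YX by auto
        fix s p assume s: "range s \<subseteq> F" and p: "limitin X s p sequentially"
        obtain R where R: "R \<in> Cl" "infinite {n. s n \<in> R}" using pigY [OF p] s FY by blast
        then obtain r :: "nat \<Rightarrow> nat" where r: "strict_mono r" "\<And>k. r k \<in> {n. s n \<in> R}"
          using infinite_nat_subseq [of "{n. s n \<in> R}"] by metis
        have "p \<in> F \<inter> X closure_of R"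
          by (rule limit_in_closed [OF FR [OF R(1)] limit_subseq [OF r(1) p], of 0])
            (use r(2) s Rcl [OF ClR [OF R(1)]] in auto)
        then show "p \<in> F" by simp
      qed
      then show ?thesis using FY by (simp add: closedin_subset_topspace)
    qed
    ultimately show ?thesis unfolding k\<^sub>\<omega>_space_def by blast
  qed
  then show ?thesis
    unfolding sum_of_k\<^sub>\<omega>_and_discrete_def
    by (intro exI [of _ "subtopology X Y"] exI [of _ "topspace X - Y"] conjI
        openin_clopen_sum_homeomorphic [OF openY openD])
qed

end

context k_network_free_group begin

lemma kR_imp_sum:
  assumes nm: "\<not> metrizable_space X"
    and Sub: "Sub \<subseteq> carrier G" "{a \<in> carrier G. reduced_length X G i a \<le> 4} \<subseteq> Sub"
    and kR: "k\<^sub>R_space (subtopology T Sub)"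
  shows "sum_of_k\<^sub>\<omega>_and_discrete X"
proof -
  obtain c d where Q: "Q_array X c d" using no_Q_array_imp_metrizable nm by blast
  show ?thesis
  proof (rule sum_structure)
    show "k_network X rel_compact_members" by (rule k_network_rel_compact [OF Q Sub kR])
    show "compact_countable X rel_compact_members" by (rule compact_countable_rel_compact)
    show "compactin X (X closure_of R)" if "R \<in> rel_compact_members" for R
      using that by (auto simp: rel_compact_members_def big_def)
    show "countable \<A>"
      if "\<And>\<alpha>. \<alpha> \<in> \<A> \<Longrightarrow> limitin X (d \<alpha>) (c \<alpha>) sequentially"
        "\<And>\<alpha> m. \<alpha> \<in> \<A> \<Longrightarrow> d \<alpha> m \<in> topspace X - {c \<alpha>}"
        "\<And>K. compactin X K \<Longrightarrow> finite {\<alpha> \<in> \<A>. \<exists>m. d \<alpha> m \<in> K}"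
      for \<A> :: "'a set set" and c d
      using uncountable_obstruction [OF _ that Sub] kR by blast
  qed
qed

end

section \<open>The group topology determined by a filtration\<close>

locale compact_filtration = abelian_top_group G T
  for G :: "('g, 'm) monoid_scheme" (structure) and T :: "'g topology" +
  fixes H :: "nat \<Rightarrow> 'g set"
  assumes H_compact: "compactin T (H n)"
    and H_mono: "m \<le> n \<Longrightarrow> H m \<subseteq> H n"
    and H_0: "H 0 = {\<one>}"
    and H_mult: "a \<in> H m \<Longrightarrow> b \<in> H n \<Longrightarrow> a \<otimes> b \<in> H (m + n)"
    and H_inv: "a \<in> H n \<Longrightarrow> inv a \<in> H n"
begin

definition translate :: "'g \<Rightarrow> 'g set \<Rightarrow> 'g set" where
  "translate a U = {x \<in> carrier G. inv a \<otimes> x \<in> U}"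

text \<open>Relative openness in every translate of every \<open>H n\<close>, stated as closedness
  of the difference because these translates are closed. All translates are included since the
  \<open>H n\<close> need not exhaust the group; this also makes translations continuous by
  construction.\<close>

definition weak_open :: "'g set \<Rightarrow> bool" where
  "weak_open U \<longleftrightarrow> U \<subseteq> carrier G \<and> (\<forall>a\<in>carrier G. \<forall>n. closedin T (translate a (H n) - U))"

definition weak_top :: "'g topology" where
  "weak_top = topology weak_open"

lemma H_carrier: "H n \<subseteq> carrier G"
  using compactin_subset_topspace [OF H_compact] by simp

lemma H_closed: "closedin T (H n)"
  using compactin_imp_closedin [OF hausT H_compact] .

lemma one_H: "\<one> \<in> H n"
  using H_mono [of 0 n] H_0 by simp

lemma translation_cont: "a \<in> carrier G \<Longrightarrow> continuous_map T T (\<lambda>x. a \<otimes> x)"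
  by (intro continuous_map_mult) auto

lemma closedin_translate:
  assumes "a \<in> carrier G" "closedin T C"
  shows "closedin T (translate a C)"
  using closedin_continuous_map_preimage [OF translation_cont [OF inv_closed [OF assms(1)]] assms(2)]
  by (simp add: translate_def)

lemma translate_H_closed: "a \<in> carrier G \<Longrightarrow> closedin T (translate a (H n))"
  by (intro closedin_translate H_closed)

lemma mult_interchange:
  assumes "a \<in> carrier G" "b \<in> carrier G" "c \<in> carrier G" "d \<in> carrier G"
  shows "(a \<otimes> b) \<otimes> (c \<otimes> d) = (a \<otimes> c) \<otimes> (b \<otimes> d)"
  using assms by (simp add: m_ac)

lemma translate_cancel:
  assumes "a \<in> carrier G" "b \<in> carrier G" "x \<in> carrier G"
  shows "inv (inv a \<otimes> b) \<otimes> (inv a \<otimes> x) = inv b \<otimes> x"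
proof -
  have "inv (inv a \<otimes> b) = a \<otimes> inv b" using assms by (simp add: inv_mult)
  then show ?thesis using mult_interchange [of a "inv b" "inv a" x] assms by simp
qed

lemma istopology_weak_open: "istopology weak_open"
  unfolding istopology_def
proof (intro conjI allI impI)
  fix U V assume "weak_open U" "weak_open V"
  moreover have "A - (U \<inter> V) = (A - U) \<union> (A - V)" for A by auto
  ultimately show "weak_open (U \<inter> V)" by (auto simp: weak_open_def)
next
  fix \<U> assume U: "\<forall>U\<in>\<U>. weak_open U"
  show "weak_open (\<Union>\<U>)"
    unfolding weak_open_def
  proof (intro conjI ballI allI)
    show "\<Union>\<U> \<subseteq> carrier G" using U by (auto simp: weak_open_def)
    fix a n assume a: "a \<in> carrier G"
    show "closedin T (translate a (H n) - \<Union>\<U>)"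
    proof (cases "\<U> = {}")
      case False
      then have "translate a (H n) - \<Union>\<U> = (\<Inter>U\<in>\<U>. translate a (H n) - U)" by auto
      moreover have "closedin T (\<Inter>U\<in>\<U>. translate a (H n) - U)"
        using False U a by (intro closedin_Inter) (auto simp: weak_open_def)
      ultimately show ?thesis by simp
    qed (use translate_H_closed [OF a] in simp)
  qed
qed

lemma openin_weak_top: "openin weak_top U \<longleftrightarrow> weak_open U"
  unfolding weak_top_def using istopology_weak_open by (simp add: topology_inverse')

lemma weak_open_if_open:
  assumes "openin T U" shows "weak_open U"
  unfolding weak_open_def using openin_subset [OF assms] translate_H_closed assms
  by (auto intro: closedin_diff)

lemma topspace_weak_top [simp]: "topspace weak_top = carrier G"
proof
  show "topspace weak_top \<subseteq> carrier G"
    using openin_topspace [of weak_top] unfolding openin_weak_top by (simp add: weak_open_def)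
  show "carrier G \<subseteq> topspace weak_top"
    using weak_open_if_open [OF openin_topspace] openin_weak_top openin_subset by auto
qed

lemma weak_open_translate:
  assumes U: "weak_open U" and a: "a \<in> carrier G"
  shows "weak_open (translate a U)"
  unfolding weak_open_def
proof (intro conjI ballI allI)
  show "translate a U \<subseteq> carrier G" by (auto simp: translate_def)
  fix b n assume b: "b \<in> carrier G"
  have "closedin T (translate (inv a \<otimes> b) (H n) - U)"
    using U a b by (simp add: weak_open_def)
  then have "closedin T (translate a (translate (inv a \<otimes> b) (H n) - U))"
    by (rule closedin_translate [OF a])
  moreover have "translate a (translate (inv a \<otimes> b) (H n) - U) = translate b (H n) - translate a U"
    using a b translate_cancel by (auto simp: translate_def)
  ultimately show "closedin T (translate b (H n) - translate a U)" by simp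
qed

lemma weak_open_inv:
  assumes U: "weak_open U"
  shows "weak_open {x \<in> carrier G. inv x \<in> U}"
  unfolding weak_open_def
proof (intro conjI ballI allI)
  fix b n assume b: "b \<in> carrier G"
  have "closedin T (translate (inv b) (H n) - U)" using U b by (simp add: weak_open_def)
  moreover have "continuous_map T T (\<lambda>x. inv x)" by (rule continuous_map_inv) simp
  ultimately have "closedin T {x \<in> topspace T. inv x \<in> translate (inv b) (H n) - U}"
    by (rule closedin_continuous_map_preimage [rotated])
  moreover have "inv b \<otimes> x \<in> H n \<longleftrightarrow> b \<otimes> inv x \<in> H n" if "x \<in> carrier G" for x
  proof -
    have "inv (inv b \<otimes> x) = b \<otimes> inv x" "inv (b \<otimes> inv x) = inv b \<otimes> x"
      using b that by (simp_all add: inv_mult)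
    then show ?thesis using H_inv by metis
  qed
  ultimately show "closedin T (translate b (H n) - {x \<in> carrier G. inv x \<in> U})"
    using b by (elim back_subst [of "closedin T"]) (auto simp: translate_def)
qed auto

lemma weak_open_diff_H:
  assumes "weak_open U" shows "closedin T (H n - U)"
proof -
  have "translate \<one> (H n) = H n" using H_carrier [of n] by (auto simp: translate_def)
  then show ?thesis using assms one_closed unfolding weak_open_def by metis
qed

text \<open>The inductive step of \<open>weak_split\<close>. Products of two elements of
  \<open>H (Suc n)\<close> lie in \<open>H (Suc n + Suc n)\<close>, so that inside it
  \<open>U\<close> may be replaced by the complement of \<open>E\<close>, which is open in
  \<open>T\<close>. Wallace's theorem and regularity then yield a neighbourhood of \<open>C\<close>;
  the claim is about closures, so that the step can be repeated.\<close>

lemma thicken_compact: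
  assumes U: "weak_open U" and C: "compactin T C" "C \<subseteq> H n"
    and CU: "\<And>a b. a \<in> C \<Longrightarrow> b \<in> C \<Longrightarrow> a \<otimes> b \<in> U"
  shows "\<exists>V. C \<subseteq> V \<and> V \<subseteq> H (Suc n) \<and> closedin T (H (Suc n) - V) \<and>
    (\<forall>a\<in>T closure_of V. \<forall>b\<in>T closure_of V. a \<otimes> b \<in> U)"
proof -
  define Z where "Z = H (Suc n)"
  define E where "E = H (Suc n + Suc n) - U"
  have E: "closedin T E" unfolding E_def by (rule weak_open_diff_H [OF U])
  have c: "continuous_map (prod_topology T T) T (\<lambda>p. fst p \<otimes> snd p)"
    by (intro continuous_map_mult continuous_map_fst continuous_map_snd)
  define W where "W = {p \<in> topspace (prod_topology T T). fst p \<otimes> snd p \<in> topspace T - E}"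
  have W: "openin (prod_topology T T) W"
    unfolding W_def using c by (rule openin_continuous_map_preimage) (rule openin_diff [OF openin_topspace E])
  have CC: "C \<subseteq> carrier G" using C H_carrier by blast
  have "C \<times> C \<subseteq> W" using CU CC by (auto simp: W_def E_def subset_iff)
  then obtain O1 O2 where O12: "openin T O1" "openin T O2" "C \<subseteq> O1" "C \<subseteq> O2" "O1 \<times> O2 \<subseteq> W"
    using Wallace_theorem_prod_topology [OF C(1) C(1) W] by metis
  define O3 where "O3 = O1 \<inter> O2"
  have O3: "openin T O3" "C \<subseteq> O3" "O3 \<times> O3 \<subseteq> W" using O12 by (auto simp: O3_def)
  have reg: "regular_space T" using TychT by (simp add: Tychonoff_space_def completely_regular_imp_regular_space)
  have "closedin T (topspace T - O3)" "disjnt C (topspace T - O3)"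
    using O3 by (auto simp: disjnt_def openin_closedin_eq)
  then obtain N M where N: "openin T N" "openin T M" "C \<subseteq> N" "topspace T - O3 \<subseteq> M" "disjnt N M"
    using regular_space_compact_closed_separation [OF reg C(1)] by metis
  have clN: "T closure_of N \<subseteq> topspace T - M"
  proof (rule closure_of_minimal)
    show "N \<subseteq> topspace T - M" using N(5) openin_subset [OF N(1)] by (auto simp: disjnt_def)
    show "closedin T (topspace T - M)" by (rule closedin_diff [OF closedin_topspace N(2)])
  qed
  define V where "V = N \<inter> Z"
  have clV: "T closure_of V \<subseteq> Z" unfolding V_def Z_def by (intro closure_of_minimal H_closed) simp
  have "T closure_of V \<subseteq> T closure_of N" by (rule closure_of_mono) (simp add: V_def)
  then have clV': "T closure_of V \<subseteq> O3" using clN N(4) by blast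
  show ?thesis
  proof (intro exI [of _ V] conjI ballI)
    show "C \<subseteq> V" using N(3) C(2) H_mono [of n "Suc n"] by (auto simp: V_def Z_def)
    show "V \<subseteq> H (Suc n)" by (simp add: V_def Z_def)
    have "H (Suc n) - V = H (Suc n) - N" by (auto simp: V_def Z_def)
    then show "closedin T (H (Suc n) - V)" using H_closed N(1) by (simp add: closedin_diff)
    fix a b assume ab: "a \<in> T closure_of V" "b \<in> T closure_of V"
    then have "(a, b) \<in> W" using clV' O3(3) by blast
    then have "a \<otimes> b \<notin> E" by (simp add: W_def)
    moreover have "a \<otimes> b \<in> H (Suc n + Suc n)" using ab clV H_mult unfolding Z_def by blast
    ultimately show "a \<otimes> b \<in> U" by (simp add: E_def)
  qed
qed

text \<open>Continuity of the multiplication at the unit, where a filtration by a sequence of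
  compact sets is essential: \<open>V n\<close> is relatively open in \<open>H n\<close>, its
  closure is compact, and \<open>thicken_compact\<close> applied to this closure gives
  \<open>V (Suc n)\<close>.\<close>

lemma weak_split:
  assumes U: "weak_open U" "\<one> \<in> U"
  shows "\<exists>V. weak_open V \<and> \<one> \<in> V \<and> (\<forall>a\<in>V. \<forall>b\<in>V. a \<otimes> b \<in> U)"
proof -
  define P where "P n V \<longleftrightarrow> \<one> \<in> V \<and> V \<subseteq> H n \<and> closedin T (H n - V) \<and>
    (\<forall>a\<in>T closure_of V. \<forall>b\<in>T closure_of V. a \<otimes> b \<in> U)" for n V
  have "\<exists>V. \<forall>n. P n (V n) \<and> V n \<subseteq> V (Suc n)"
  proof (rule dependent_nat_choice)
    have "T closure_of {\<one>} = {\<one>}" using H_closed [of 0] by (simp add: H_0 closure_of_closedin)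
    then show "\<exists>V. P 0 V" using U by (intro exI [of _ "{\<one>}"]) (simp add: P_def H_0)
  next
    fix V n assume P: "P n V"
    have cl: "T closure_of V \<subseteq> H n" using P by (intro closure_of_minimal H_closed) (simp add: P_def)
    have "compactin T (T closure_of V)" by (rule closed_compactin [OF H_compact cl]) simp
    from thicken_compact [OF U(1) this cl] P obtain V' where V': "T closure_of V \<subseteq> V'" "V' \<subseteq> H (Suc n)"
      "closedin T (H (Suc n) - V')" "\<forall>a\<in>T closure_of V'. \<forall>b\<in>T closure_of V'. a \<otimes> b \<in> U"
      unfolding P_def by blast
    have "V \<subseteq> T closure_of V" using P H_carrier [of n] by (intro closure_of_subset) (auto simp: P_def)
    then show "\<exists>V'. P (Suc n) V' \<and> V \<subseteq> V'" using V' P by (intro exI [of _ V']) (auto simp: P_def)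
  qed
  then obtain V where "\<forall>n. P n (V n) \<and> V n \<subseteq> V (Suc n)" ..
  then have V: "\<And>n. P n (V n)" "\<And>n. V n \<subseteq> V (Suc n)" by auto
  have Vmono: "V m \<subseteq> V n" if "m \<le> n" for m n using that V(2) by (rule lift_Suc_mono_le [rotated])
  have VH: "V n \<subseteq> H n" for n using V(1) by (simp add: P_def)
  define W where "W = (\<Union>n. V n)"
  have WH: "closedin T (H k - W)" for k
  proof -
    have "H k - W = (\<Inter>n\<in>{k..}. H k \<inter> (H n - V n))"
    proof
      show "H k - W \<subseteq> (\<Inter>n\<in>{k..}. H k \<inter> (H n - V n))" using H_mono by (auto simp: W_def)
      show "(\<Inter>n\<in>{k..}. H k \<inter> (H n - V n)) \<subseteq> H k - W"
      proof
        fix x assume x: "x \<in> (\<Inter>n\<in>{k..}. H k \<inter> (H n - V n))"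
        have "x \<notin> V m" for m using x Vmono [of m "max k m"] by auto
        then show "x \<in> H k - W" using x by (auto simp: W_def)
      qed
    qed
    moreover have "closedin T (\<Inter>n\<in>{k..}. H k \<inter> (H n - V n))"
      using V(1) H_closed by (intro closedin_Inter) (auto simp: P_def)
    ultimately show ?thesis by simp
  qed
  have "weak_open W"
    unfolding weak_open_def
  proof (intro conjI ballI allI)
    show "W \<subseteq> carrier G" using VH H_carrier by (fastforce simp: W_def)
    fix a n assume a: "a \<in> carrier G"
    show "closedin T (translate a (H n) - W)"
    \<comment> \<open>A translate that meets \<open>W\<close> has its base point \<open>a\<close> in
      some \<open>H (m + n)\<close>, so it lies in \<open>H (m + n + n)\<close>, where
      \<open>WH\<close> applies.\<close>
    proof (cases "translate a (H n) \<inter> W = {}")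
      case True
      then have "translate a (H n) - W = translate a (H n)" by auto
      then show ?thesis using translate_H_closed [OF a] by simp
    next
      case False
      then obtain x m where x: "x \<in> carrier G" "inv a \<otimes> x \<in> H n" "x \<in> H m"
        using VH by (fastforce simp: W_def translate_def)
      have "x \<otimes> inv (inv a \<otimes> x) = a" using a x(1)
        by (simp add: inv_mult m_lcomm)
      then have "a \<in> H (m + n)" using H_mult [OF x(3) H_inv [OF x(2)]] by simp
      have "translate a (H n) \<subseteq> H (m + n + n)"
      proof
        fix y assume "y \<in> translate a (H n)"
        then have y: "y \<in> carrier G" "inv a \<otimes> y \<in> H n" by (auto simp: translate_def)
        have "a \<otimes> (inv a \<otimes> y) = y" using a y by (simp add: m_assoc [symmetric])
        then show "y \<in> H (m + n + n)" using H_mult [OF \<open>a \<in> H (m + n)\<close> y(2)] by simp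
      qed
      then have "translate a (H n) - W = translate a (H n) \<inter> (H (m + n + n) - W)" by auto
      then show ?thesis using translate_H_closed [OF a] WH by (simp add: closedin_Int)
    qed
  qed
  moreover have "\<one> \<in> W" using V(1) [of 0] by (auto simp: W_def P_def)
  moreover have "a \<otimes> b \<in> U" if ab: "a \<in> W" "b \<in> W" for a b
  proof -
    obtain m n where "a \<in> V m" "b \<in> V n" using ab by (auto simp: W_def)
    then have "a \<in> V (max m n)" "b \<in> V (max m n)"
      using Vmono [of m "max m n"] Vmono [of n "max m n"] by auto
    moreover have "V (max m n) \<subseteq> T closure_of V (max m n)"
      using VH [of "max m n"] H_carrier [of "max m n"] by (intro closure_of_subset) auto
    ultimately show ?thesis using V(1) [of "max m n"] unfolding P_def by blast
  qed
  ultimately show ?thesis by blast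
qed

lemma weak_mult_cont: "continuous_map (prod_topology weak_top weak_top) weak_top (\<lambda>(x, y). x \<otimes> y)"
  unfolding continuous_map_def
proof (intro conjI allI impI)
  show "(\<lambda>(x, y). x \<otimes> y) \<in> topspace (prod_topology weak_top weak_top) \<rightarrow> topspace weak_top" by auto
  fix U assume "openin weak_top U"
  then have U: "weak_open U" by (simp add: openin_weak_top)
  show "openin (prod_topology weak_top weak_top)
      {p \<in> topspace (prod_topology weak_top weak_top). (case p of (x, y) \<Rightarrow> x \<otimes> y) \<in> U}"
    unfolding openin_prod_topology_alt
  proof (intro allI impI)
    fix a b
    assume "(a, b) \<in> {p \<in> topspace (prod_topology weak_top weak_top). (case p of (x, y) \<Rightarrow> x \<otimes> y) \<in> U}"
    then have ab: "a \<in> carrier G" "b \<in> carrier G" "a \<otimes> b \<in> U" by auto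
    have 1: "weak_open (translate (inv (a \<otimes> b)) U)" by (rule weak_open_translate [OF U]) (use ab in simp)
    have 2: "\<one> \<in> translate (inv (a \<otimes> b)) U" using ab by (simp add: translate_def)
    obtain V where V: "weak_open V" "\<one> \<in> V" "\<And>x y. x \<in> V \<Longrightarrow> y \<in> V \<Longrightarrow> x \<otimes> y \<in> translate (inv (a \<otimes> b)) U"
      using weak_split [OF 1 2] by blast
    show "\<exists>A B. openin weak_top A \<and> openin weak_top B \<and> a \<in> A \<and> b \<in> B \<and>
        A \<times> B \<subseteq> {p \<in> topspace (prod_topology weak_top weak_top). (case p of (x, y) \<Rightarrow> x \<otimes> y) \<in> U}"
    proof (intro exI conjI)
      show "openin weak_top (translate a V)" "openin weak_top (translate b V)"
        using V(1) ab by (simp_all add: openin_weak_top weak_open_translate)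
      show "a \<in> translate a V" "b \<in> translate b V" using ab V(2) by (simp_all add: translate_def)
      show "translate a V \<times> translate b V \<subseteq>
          {p \<in> topspace (prod_topology weak_top weak_top). (case p of (x, y) \<Rightarrow> x \<otimes> y) \<in> U}"
      proof clarsimp
        fix x y assume "x \<in> translate a V" "y \<in> translate b V"
        then have xy: "x \<in> carrier G" "y \<in> carrier G" "inv a \<otimes> x \<in> V" "inv b \<otimes> y \<in> V" by (auto simp: translate_def)
        then have "(a \<otimes> b) \<otimes> ((inv a \<otimes> x) \<otimes> (inv b \<otimes> y)) \<in> U"
          using V(3) ab by (force simp: translate_def)
        moreover have "(a \<otimes> b) \<otimes> ((inv a \<otimes> x) \<otimes> (inv b \<otimes> y)) = x \<otimes> y"
        proof -
          have "(a \<otimes> b) \<otimes> ((inv a \<otimes> x) \<otimes> (inv b \<otimes> y)) = (a \<otimes> (inv a \<otimes> x)) \<otimes> (b \<otimes> (inv b \<otimes> y))"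
            using ab xy by (intro mult_interchange) simp_all
          then show ?thesis using ab xy by (simp add: m_assoc [symmetric])
        qed
        ultimately show "x \<in> carrier G \<and> y \<in> carrier G \<and> x \<otimes> y \<in> U" using xy by simp
      qed
    qed
  qed
qed

lemma weak_inv_cont: "continuous_map weak_top weak_top (\<lambda>x. inv x)"
  unfolding continuous_map_def using weak_open_inv by (auto simp: openin_weak_top)

lemma weak_translation_cont:
  assumes "a \<in> carrier G" shows "continuous_map weak_top weak_top (\<lambda>x. inv a \<otimes> x)"
  unfolding continuous_map_def using weak_open_translate [OF _ assms] assms
  by (auto simp: openin_weak_top translate_def)

lemma weak_Hausdorff: "Hausdorff_space weak_top"
  unfolding Hausdorff_space_def
proof (intro allI impI)
  fix x y assume "x \<in> topspace weak_top \<and> y \<in> topspace weak_top \<and> x \<noteq> y"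
  then obtain U V where "openin T U" "openin T V" "x \<in> U" "y \<in> V" "disjnt U V"
    using hausT unfolding Hausdorff_space_def by (metis topspace_T topspace_weak_top)
  then show "\<exists>U V. openin weak_top U \<and> openin weak_top V \<and> x \<in> U \<and> y \<in> V \<and> disjnt U V"
    using weak_open_if_open openin_weak_top by blast
qed

text \<open>As in any topological group: if products of two elements of \<open>V\<close> stay in the
  complement of \<open>C\<close> translated by the inverse of \<open>x\<close>, the translate of
  \<open>V\<close> to \<open>x\<close> is disjoint from the translates of its inverse to points of
  \<open>C\<close>.\<close>

lemma weak_regular: "regular_space weak_top"
  unfolding regular_space_def
proof (intro allI impI)
  fix C x assume "closedin weak_top C \<and> x \<in> topspace weak_top - C"
  then have C: "closedin weak_top C" and x: "x \<in> carrier G" "x \<notin> C" by auto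
  have CG: "C \<subseteq> carrier G" using closedin_subset [OF C] by simp
  have U: "weak_open (carrier G - C)" using C by (simp add: closedin_def openin_weak_top)
  have 1: "weak_open (translate (inv x) (carrier G - C))" by (rule weak_open_translate [OF U]) (use x in simp)
  have 2: "\<one> \<in> translate (inv x) (carrier G - C)" using x by (simp add: translate_def)
  obtain V where V: "weak_open V" "\<one> \<in> V"
      "\<And>a b. a \<in> V \<Longrightarrow> b \<in> V \<Longrightarrow> a \<otimes> b \<in> translate (inv x) (carrier G - C)"
    using weak_split [OF 1 2] by blast
  define V' where "V' = {a \<in> carrier G. inv a \<in> V}"
  have V': "weak_open V'" unfolding V'_def by (rule weak_open_inv [OF V(1)])
  show "\<exists>A B. openin weak_top A \<and> openin weak_top B \<and> x \<in> A \<and> C \<subseteq> B \<and> disjnt A B"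
  proof (intro exI conjI)
    show "openin weak_top (translate x V)"
      using V(1) x by (simp add: openin_weak_top weak_open_translate)
    show "openin weak_top (\<Union>c\<in>C. translate c V')"
      using V' CG by (intro openin_Union) (auto simp: openin_weak_top weak_open_translate)
    show "x \<in> translate x V" using x V(2) by (simp add: translate_def)
    show "C \<subseteq> (\<Union>c\<in>C. translate c V')"
      using CG V(2) by (fastforce simp: translate_def V'_def)
    show "disjnt (translate x V) (\<Union>c\<in>C. translate c V')"
      unfolding disjnt_iff
    proof clarsimp
      fix y c assume y: "y \<in> translate x V" "y \<in> translate c V'" and c: "c \<in> C"
      have cG: "c \<in> carrier G" using c CG by auto
      have y': "y \<in> carrier G" "inv x \<otimes> y \<in> V" "inv (inv c \<otimes> y) \<in> V" using y by (auto simp: translate_def V'_def)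
      then have "x \<otimes> ((inv x \<otimes> y) \<otimes> inv (inv c \<otimes> y)) \<notin> C"
        using V(3) [OF y'(2,3)] x(1) by (simp add: translate_def)
      moreover have "x \<otimes> ((inv x \<otimes> y) \<otimes> inv (inv c \<otimes> y)) = c"
      proof -
        have 1: "inv (inv c \<otimes> y) = c \<otimes> inv y" using cG y' by (simp add: inv_mult)
        have 2: "x \<otimes> (inv x \<otimes> y) = y" using x y' by (simp add: m_assoc [symmetric])
        have "x \<otimes> ((inv x \<otimes> y) \<otimes> inv (inv c \<otimes> y)) = (x \<otimes> (inv x \<otimes> y)) \<otimes> (c \<otimes> inv y)"
          unfolding 1 using cG y' x by (intro m_assoc [symmetric]) simp_all
        also have "\<dots> = c \<otimes> (y \<otimes> inv y)" unfolding 2 using cG y' by (intro m_lcomm) simp_all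
        finally show ?thesis using cG y' by simp
      qed
      ultimately show False using c by simp
    qed
  qed
qed

section \<open>The union of the filtration as a clopen subgroup, and complete regularity\<close>

definition core :: "'g set" where "core = (\<Union>n. H n)"

lemma core_mult: "a \<in> core \<Longrightarrow> b \<in> core \<Longrightarrow> a \<otimes> b \<in> core"
  using H_mult by (fastforce simp: core_def)

lemma core_inv: "a \<in> core \<Longrightarrow> inv a \<in> core"
  using H_inv by (fastforce simp: core_def)

lemma core_carrier: "core \<subseteq> carrier G"
  using H_carrier by (auto simp: core_def)

lemma translate_H_core:
  assumes a: "a \<in> carrier G"
  shows "if a \<in> core then translate a (H n) \<subseteq> core else translate a (H n) \<inter> core = {}"
proof -
  have "y \<in> core \<longleftrightarrow> a \<in> core" if y: "y \<in> translate a (H n)" for y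
  proof -
    have y': "y \<in> carrier G" "inv a \<otimes> y \<in> core" using y by (auto simp: translate_def core_def)
    have "a \<otimes> (inv a \<otimes> y) = y" using a y' by (simp add: m_assoc [symmetric])
    moreover have "y \<otimes> inv (inv a \<otimes> y) = a" using a y' by (simp add: inv_mult m_lcomm)
    ultimately show ?thesis using core_mult core_inv y'(2) by metis
  qed
  then show ?thesis by auto
qed

lemma weak_open_core: "weak_open core" "weak_open (carrier G - core)"
proof -
  have *: "closedin T (translate a (H n) - core) \<and> closedin T (translate a (H n) - (carrier G - core))"
    if a: "a \<in> carrier G" for a n
  proof (cases "a \<in> core")
    case True
    then have 1: "translate a (H n) - core = {}" and 2: "translate a (H n) - (carrier G - core) = translate a (H n)"
      using translate_H_core [OF a, of n] by auto
    show ?thesis unfolding 1 2 using translate_H_closed [OF a, of n] by simp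
  next
    case False
    then have 1: "translate a (H n) - core = translate a (H n)" and 2: "translate a (H n) - (carrier G - core) = {}"
      using translate_H_core [OF a, of n] by (auto simp: translate_def)
    show ?thesis unfolding 1 2 using translate_H_closed [OF a, of n] by simp
  qed
  then show "weak_open core" "weak_open (carrier G - core)"
    using core_carrier by (auto simp: weak_open_def)
qed

text \<open>On \<open>H n\<close> a weakly open set \<open>U\<close> agrees with the complement of
  \<open>H n - U\<close>, which is open in \<open>T\<close>.\<close>

lemma weak_compact_H: "compactin weak_top (H n)"
  unfolding compactin_def
proof (intro conjI allI impI)
  show "H n \<subseteq> topspace weak_top" using H_carrier by simp
  fix \<U> assume U: "Ball \<U> (openin weak_top) \<and> H n \<subseteq> \<Union>\<U>"
  have "openin T C" if C: "C \<in> (\<lambda>U. topspace T - (H n - U)) ` \<U>" for C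
  proof -
    obtain V where V: "V \<in> \<U>" "C = topspace T - (H n - V)" using C by auto
    show ?thesis
      unfolding V(2) using U V(1) by (intro openin_diff openin_topspace weak_open_diff_H) (auto simp: openin_weak_top)
  qed
  moreover have "H n \<subseteq> \<Union>((\<lambda>U. topspace T - (H n - U)) ` \<U>)" using U H_carrier [of n] by auto
  ultimately obtain F where F: "finite F" "F \<subseteq> (\<lambda>U. topspace T - (H n - U)) ` \<U>" "H n \<subseteq> \<Union>F"
    using compactinD [OF H_compact [of n], of "(\<lambda>U. topspace T - (H n - U)) ` \<U>"] by metis
  then obtain F' where F': "finite F'" "F' \<subseteq> \<U>" "F = (\<lambda>U. topspace T - (H n - U)) ` F'"
    using finite_subset_image [OF F(1,2)] by metis
  have "H n \<subseteq> \<Union>F'"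
  proof
    fix x assume x: "x \<in> H n"
    then obtain C where "C \<in> F" "x \<in> C" using F(3) by auto
    then show "x \<in> \<Union>F'" using F'(3) x by auto
  qed
  then show "\<exists>\<F>. finite \<F> \<and> \<F> \<subseteq> \<U> \<and> H n \<subseteq> \<Union>\<F>" using F' by blast
qed

text \<open>The subgroup \<open>core\<close> is sigma-compact, hence Lindelof, and, being regular,
  normal. As it is clopen, separating functions at the unit extend by the value 1, and translations
  carry them to the other points.\<close>

lemma weak_completely_regular: "completely_regular_space weak_top"
proof -
  have "Lindelof_space (subtopology weak_top (\<Union>(range H)))"
    using weak_compact_H
    by (intro Lindelof_space_Union) (auto simp: compactin_subspace intro: compact_imp_Lindelof_space)
  then have lin: "Lindelof_space (subtopology weak_top core)" by (simp add: core_def)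
  have reg: "regular_space (subtopology weak_top core)" by (rule regular_space_subtopology [OF weak_regular])
  then have "normal_space (subtopology weak_top core)" using lin by (rule regular_Lindelof_imp_normal_space)
  then have cr: "completely_regular_space (subtopology weak_top core)"
    using reg by (rule normal_imp_completely_regular_space_B)
  have ts: "topspace (subtopology weak_top core) = core" using core_carrier by auto
  have oneC: "\<one> \<in> core" using one_H by (auto simp: core_def)
  show ?thesis
    unfolding completely_regular_space_alt'
  proof (intro allI impI)
    fix U x assume U: "openin weak_top U" and x: "x \<in> U"
    have xG: "x \<in> carrier G" using openin_subset [OF U] x by auto
    define U1 where "U1 = translate (inv x) U"
    have U1: "weak_open U1" unfolding U1_def using U xG by (simp add: weak_open_translate openin_weak_top)
    have "\<one> \<in> U1" using x xG by (simp add: U1_def translate_def)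
    have "openin (subtopology weak_top core) (U1 \<inter> core)"
      using U1 by (auto simp: openin_subtopology openin_weak_top)
    moreover have "\<one> \<in> U1 \<inter> core" using \<open>\<one> \<in> U1\<close> oneC by simp
    ultimately obtain f0 where f0: "continuous_map (subtopology weak_top core) euclideanreal f0" "f0 \<one> = (0::real)"
      "f0 ` (topspace (subtopology weak_top core) - U1 \<inter> core) \<subseteq> {1}"
      using cr unfolding completely_regular_space_alt' by meson
    define f1 where "f1 a = (if a \<in> core then f0 a else 1)" for a
    have f1: "continuous_map weak_top euclideanreal f1"
      unfolding continuous_map_def
    proof (intro conjI allI impI)
      fix W :: "real set" assume W: "openin euclideanreal W"
      have eq: "{a \<in> topspace weak_top. f1 a \<in> W} =
          {a \<in> core. f0 a \<in> W} \<union> (if 1 \<in> W then carrier G - core else {})"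
        using core_carrier by (auto simp: f1_def)
      have "openin (subtopology weak_top core) {a \<in> topspace (subtopology weak_top core). f0 a \<in> W}"
        using f0(1) W by (rule openin_continuous_map_preimage)
      then have "openin weak_top {a \<in> core. f0 a \<in> W}"
        using weak_open_core(1) unfolding ts by (simp add: openin_open_subtopology openin_weak_top)
      moreover have "openin weak_top (if 1 \<in> W then carrier G - core else {})"
        using weak_open_core(2) by (simp add: openin_weak_top [symmetric])
      ultimately show "openin weak_top {a \<in> topspace weak_top. f1 a \<in> W}" unfolding eq by (rule openin_Un)
    qed simp
    show "\<exists>f. continuous_map weak_top euclideanreal f \<and> f x = 0 \<and> f ` (topspace weak_top - U) \<subseteq> {1}"
    proof (intro exI [of _ "\<lambda>a. f1 (inv x \<otimes> a)"] conjI)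
      show "continuous_map weak_top euclideanreal (\<lambda>a. f1 (inv x \<otimes> a))"
        using continuous_map_compose [OF weak_translation_cont [OF xG] f1] by (simp add: o_def)
      show "f1 (inv x \<otimes> x) = 0" using xG oneC f0(2) by (simp add: f1_def)
      have "f1 (inv x \<otimes> a) = 1" if a: "a \<in> carrier G" "a \<notin> U" for a
      proof (cases "inv x \<otimes> a \<in> core")
        case True
        have "x \<otimes> (inv x \<otimes> a) = a" using xG a by (simp add: m_assoc [symmetric])
        then have "inv x \<otimes> a \<notin> U1" using a xG by (simp add: U1_def translate_def)
        then have "f0 (inv x \<otimes> a) = 1" using f0(3) True unfolding ts by auto
        then show ?thesis using True by (simp add: f1_def)
      qed (simp add: f1_def)
      then show "(\<lambda>a. f1 (inv x \<otimes> a)) ` (topspace weak_top - U) \<subseteq> {1}" by auto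
    qed
  qed
qed

lemma weak_top_group: "Abelian_topological_group G weak_top"
  unfolding Abelian_topological_group_def Tychonoff_space_def
  using comm_group_axioms weak_completely_regular weak_Hausdorff weak_mult_cont weak_inv_cont by simp

end

section \<open>Sequentiality\<close>

context abelian_top_group begin

definition seq_closed_set :: "'g set \<Rightarrow> bool" where
  "seq_closed_set F \<longleftrightarrow> F \<subseteq> carrier G \<and>
     (\<forall>s p. range s \<subseteq> F \<longrightarrow> limitin T s p sequentially \<longrightarrow> p \<in> F)"

text \<open>Compact, sequentially compact and sequential, the last tested with sequentially closed
  subsets of the whole group. Compactness and sequentiality alone would not carry the argument for
  \<open>seq_compact_mult\<close>, which extracts subsequences in both factors.\<close>

definition seq_compact_set :: "'g set \<Rightarrow> bool" where
  "seq_compact_set C \<longleftrightarrow> compactin T C \<and>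
     (\<forall>s. range s \<subseteq> C \<longrightarrow> (\<exists>r p. strict_mono (r :: nat \<Rightarrow> nat) \<and> p \<in> C \<and> limitin T (\<lambda>k. s (r k)) p sequentially)) \<and>
     (\<forall>F. seq_closed_set F \<longrightarrow> closedin T (F \<inter> C))"

lemma limitin_compose:
  assumes "continuous_map T T f" "limitin T s p sequentially"
  shows "limitin T (\<lambda>k. f (s k)) (f p) sequentially"
  using continuous_map_limit [OF assms] by (simp add: o_def)

lemma limitin_mult:
  assumes "limitin T a x sequentially" "limitin T b y sequentially"
  shows "limitin T (\<lambda>k. a k \<otimes> b k) (x \<otimes> y) sequentially"
proof -
  have "limitin (prod_topology T T) (\<lambda>k. (a k, b k)) (x, y) sequentially"
    using assms by (simp add: limitin_pairwise o_def)
  moreover have "continuous_map (prod_topology T T) T (\<lambda>p. fst p \<otimes> snd p)"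
    by (intro continuous_map_mult continuous_map_fst continuous_map_snd)
  ultimately show ?thesis
    using continuous_map_limit [of "prod_topology T T" T "\<lambda>p. fst p \<otimes> snd p" "\<lambda>k. (a k, b k)" "(x, y)" sequentially]
    by (simp add: o_def)
qed

lemma seq_closed_vimage:
  assumes "seq_closed_set F" "continuous_map T T f"
  shows "seq_closed_set {a \<in> carrier G. f a \<in> F}"
  unfolding seq_closed_set_def
proof (intro conjI allI impI)
  fix s p assume s: "range s \<subseteq> {a \<in> carrier G. f a \<in> F}" and p: "limitin T s p sequentially"
  have "range (\<lambda>k. f (s k)) \<subseteq> F" using s by auto
  then have "f p \<in> F" using limitin_compose [OF assms(2) p] assms(1) unfolding seq_closed_set_def by blast
  moreover have "p \<in> carrier G" using limitin_topspace [OF p] by simp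
  ultimately show "p \<in> {a \<in> carrier G. f a \<in> F}" by simp
qed auto

lemma seq_compact_carrier: "seq_compact_set C \<Longrightarrow> C \<subseteq> carrier G"
  using compactin_subset_topspace [of T C] by (auto simp: seq_compact_set_def)

lemma closed_inter_seq_compact:
  assumes C: "seq_compact_set C" and F: "closedin T (F \<inter> C)"
  shows "compactin T (F \<inter> C)"
  using closed_compactin [OF _ _ F, of C] C by (simp add: seq_compact_set_def)

lemma seq_compact_image:
  assumes C: "seq_compact_set C" and f: "continuous_map T T f"
  shows "seq_compact_set (f ` C)"
  unfolding seq_compact_set_def
proof (intro conjI allI impI)
  show "compactin T (f ` C)" using C f by (auto simp: seq_compact_set_def intro: image_compactin)
next
  fix s :: "nat \<Rightarrow> 'g" assume "range s \<subseteq> f ` C"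
  then have "\<forall>k. \<exists>c\<in>C. s k = f c" by auto
  then obtain c where c: "\<And>k. c k \<in> C" "\<And>k. s k = f (c k)" by metis
  have "range c \<subseteq> C" using c(1) by auto
  then obtain r p where r: "strict_mono (r :: nat \<Rightarrow> nat)" "p \<in> C" "limitin T (\<lambda>k. c (r k)) p sequentially"
    using C unfolding seq_compact_set_def by blast
  have "limitin T (\<lambda>k. s (r k)) (f p) sequentially" using limitin_compose [OF f r(3)] by (simp add: c(2))
  then show "\<exists>r p. strict_mono (r :: nat \<Rightarrow> nat) \<and> p \<in> f ` C \<and> limitin T (\<lambda>k. s (r k)) p sequentially"
    using r by blast
next
  fix F assume F: "seq_closed_set F"
  define F' where "F' = {a \<in> carrier G. f a \<in> F}"
  have "closedin T (F' \<inter> C)"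
    using C seq_closed_vimage [OF F f] unfolding seq_compact_set_def F'_def by blast
  then have "compactin T (f ` (F' \<inter> C))"
    using closed_inter_seq_compact [OF C] f by (blast intro: image_compactin)
  moreover have "f ` (F' \<inter> C) = F \<inter> f ` C" using seq_compact_carrier [OF C] by (auto simp: F'_def)
  ultimately show "closedin T (F \<inter> f ` C)" using compactin_imp_closedin [OF hausT] by metis
qed

lemma seq_compact_Un:
  assumes C: "seq_compact_set C" and D: "seq_compact_set D"
  shows "seq_compact_set (C \<union> D)"
  unfolding seq_compact_set_def
proof (intro conjI allI impI)
  show "compactin T (C \<union> D)" using C D by (simp add: seq_compact_set_def compactin_Un)
next
  fix F assume "seq_closed_set F"
  then have "closedin T (F \<inter> C)" "closedin T (F \<inter> D)" using C D unfolding seq_compact_set_def by blast+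
  then show "closedin T (F \<inter> (C \<union> D))" by (simp add: Int_Un_distrib closedin_Un)
next
  fix s :: "nat \<Rightarrow> 'g" assume s: "range s \<subseteq> C \<union> D"
  have *: "\<exists>r p. strict_mono (r :: nat \<Rightarrow> nat) \<and> p \<in> C \<union> D \<and> limitin T (\<lambda>k. s (r k)) p sequentially"
    if inf: "infinite {k. s k \<in> E}" and E: "seq_compact_set E" "E \<subseteq> C \<union> D" for E
  proof -
    obtain r :: "nat \<Rightarrow> nat" where r: "strict_mono r" "\<And>k. r k \<in> {k. s k \<in> E}"
      using infinite_nat_subseq [OF inf] by metis
    have "range (\<lambda>k. s (r k)) \<subseteq> E" using r(2) by auto
    then obtain q p where q: "strict_mono (q :: nat \<Rightarrow> nat)" "p \<in> E" "limitin T (\<lambda>k. s (r (q k))) p sequentially"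
      using E(1) unfolding seq_compact_set_def by blast
    have "strict_mono (\<lambda>k. r (q k))" using r(1) q(1) by (simp add: strict_mono_def)
    then show ?thesis using q E(2) by (intro exI [of _ "\<lambda>k. r (q k)"] exI [of _ p]) auto
  qed
  have "{k. s k \<in> C} \<union> {k. s k \<in> D} = UNIV" using s by auto
  then have "infinite {k. s k \<in> C} \<or> infinite {k. s k \<in> D}" by (metis finite_Un infinite_UNIV_nat)
  then show "\<exists>r p. strict_mono (r :: nat \<Rightarrow> nat) \<and> p \<in> C \<union> D \<and> limitin T (\<lambda>k. s (r k)) p sequentially"
    using * [of C] * [of D] C D by blast
qed

lemma seq_compact_singleton:
  assumes "a \<in> carrier G" shows "seq_compact_set {a}"
  unfolding seq_compact_set_def
proof (intro conjI allI impI)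
  fix s :: "nat \<Rightarrow> 'g" assume "range s \<subseteq> {a}"
  then have "s = (\<lambda>_. a)" by auto
  then show "\<exists>r p. strict_mono (r :: nat \<Rightarrow> nat) \<and> p \<in> {a} \<and> limitin T (\<lambda>k. s (r k)) p sequentially"
    using assms by (intro exI [of _ id] exI [of _ a]) (simp add: strict_mono_id)
next
  fix F show "closedin T (F \<inter> {a})" using hausT assms by (intro closedin_Hausdorff_finite) auto
qed (use assms in simp)

text \<open>Boehme's argument for the sequentiality of products of compact sequential spaces.\<close>
lemma seq_compact_mult:
  assumes C: "seq_compact_set C" and D: "seq_compact_set D"
  shows "seq_compact_set ((\<lambda>p. fst p \<otimes> snd p) ` (C \<times> D))"
proof -
  have mc: "continuous_map (prod_topology T T) T (\<lambda>p. fst p \<otimes> snd p)"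
    by (intro continuous_map_mult continuous_map_fst continuous_map_snd)
  have CC: "C \<subseteq> carrier G" and DC: "D \<subseteq> carrier G" using seq_compact_carrier C D by auto
  have CD: "compactin (prod_topology T T) (C \<times> D)"
    using C D by (simp add: compactin_Times seq_compact_set_def)
  show ?thesis
    unfolding seq_compact_set_def
  proof (intro conjI allI impI)
    show "compactin T ((\<lambda>p. fst p \<otimes> snd p) ` (C \<times> D))" by (rule image_compactin [OF CD mc])
  next
    fix s :: "nat \<Rightarrow> 'g" assume "range s \<subseteq> (\<lambda>p. fst p \<otimes> snd p) ` (C \<times> D)"
    then have "\<forall>k. \<exists>c d. c \<in> C \<and> d \<in> D \<and> s k = c \<otimes> d" by fastforce
    then obtain c d where cd: "\<And>k. c k \<in> C" "\<And>k. d k \<in> D" "\<And>k. s k = c k \<otimes> d k" by metis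
    have "range c \<subseteq> C" using cd by auto
    then obtain r p where r: "strict_mono (r :: nat \<Rightarrow> nat)" "p \<in> C" "limitin T (\<lambda>k. c (r k)) p sequentially"
      using C unfolding seq_compact_set_def by blast
    have "range (\<lambda>k. d (r k)) \<subseteq> D" using cd by auto
    then obtain q p' where q: "strict_mono (q :: nat \<Rightarrow> nat)" "p' \<in> D" "limitin T (\<lambda>k. d (r (q k))) p' sequentially"
      using D unfolding seq_compact_set_def by blast
    have "limitin T (\<lambda>k. c (r (q k))) p sequentially" by (rule limit_subseq [OF q(1) r(3)])
    then have "limitin T (\<lambda>k. s (r (q k))) (p \<otimes> p') sequentially"
      using limitin_mult q(3) by (simp add: cd(3))
    moreover have "strict_mono (\<lambda>k. r (q k))" using r(1) q(1) by (simp add: strict_mono_def)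
    moreover have "p \<otimes> p' \<in> (\<lambda>p. fst p \<otimes> snd p) ` (C \<times> D)" using r(2) q(2) by force
    ultimately show "\<exists>r p. strict_mono (r :: nat \<Rightarrow> nat) \<and> p \<in> (\<lambda>p. fst p \<otimes> snd p) ` (C \<times> D) \<and>
        limitin T (\<lambda>k. s (r k)) p sequentially" by blast
  next
    fix F assume F: "seq_closed_set F"
    define W where "W = {(c, d). \<exists>A B. openin T A \<and> openin T B \<and> c \<in> A \<and> d \<in> B \<and>
        (\<forall>x\<in>A \<inter> C. \<forall>y\<in>B \<inter> D. x \<otimes> y \<notin> F)}"
    have W: "openin (prod_topology T T) W"
      unfolding openin_prod_topology_alt by (auto simp: W_def)
    have in_W: "(c, d) \<in> W" if c: "c \<in> C" and d: "d \<in> D" and cd: "c \<otimes> d \<notin> F" for c d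
    proof -
      have cG: "c \<in> carrier G" and dG: "d \<in> carrier G" using c d CC DC by auto
      define Fc where "Fc = {y \<in> carrier G. c \<otimes> y \<in> F}"
      have "seq_closed_set Fc"
        unfolding Fc_def by (rule seq_closed_vimage [OF F]) (intro continuous_map_mult, use cG in auto)
      then have "closedin T (Fc \<inter> D)" using D by (simp add: seq_compact_set_def)
      then have N0: "openin T (topspace T - Fc \<inter> D)" by (rule openin_diff [OF openin_topspace])
      have "d \<in> topspace T - Fc \<inter> D" using dG cd by (simp add: Fc_def)
      moreover have "regular_space T"
        using TychT by (simp add: Tychonoff_space_def completely_regular_imp_regular_space)
      ultimately obtain N where N: "openin T N" "d \<in> N" "T closure_of N \<subseteq> topspace T - Fc \<inter> D"
        using regular_space_closure_nbhd [OF _ N0] by metis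
      \<comment> \<open>A projection along the sequentially compact set
        \<open>T closure_of N \<inter> D\<close>, so it is again sequentially closed. Its complement
        in \<open>C\<close> supplies the first side of a box around \<open>(c, d)\<close> that
        avoids \<open>F\<close>.\<close>
      define B where "B = {x \<in> carrier G. \<exists>y\<in>T closure_of N \<inter> D. x \<otimes> y \<in> F}"
      have "seq_closed_set B"
        unfolding seq_closed_set_def
      proof (intro conjI allI impI)
        fix s p assume s: "range s \<subseteq> B" and p: "limitin T s p sequentially"
        have "\<forall>k. \<exists>y. y \<in> T closure_of N \<and> y \<in> D \<and> s k \<otimes> y \<in> F" using s by (auto simp: B_def)
        then obtain y where y: "\<And>k. y k \<in> T closure_of N" "\<And>k. y k \<in> D" "\<And>k. s k \<otimes> y k \<in> F" by metis
        have "range y \<subseteq> D" using y(2) by auto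
        then obtain r q where r: "strict_mono (r :: nat \<Rightarrow> nat)" "q \<in> D" "limitin T (\<lambda>k. y (r k)) q sequentially"
          using D unfolding seq_compact_set_def by blast
        have "q \<in> T closure_of N"
          by (rule limitin_closedin [OF r(3)]) (use y(1) in auto)
        have "limitin T (\<lambda>k. s (r k) \<otimes> y (r k)) (p \<otimes> q) sequentially"
          by (rule limitin_mult [OF limit_subseq [OF r(1) p] r(3)])
        moreover have "range (\<lambda>k. s (r k) \<otimes> y (r k)) \<subseteq> F" using y(3) by auto
        ultimately have "p \<otimes> q \<in> F" using F unfolding seq_closed_set_def by blast
        moreover have "p \<in> carrier G" using limitin_topspace [OF p] by simp
        ultimately show "p \<in> B" using r(2) \<open>q \<in> T closure_of N\<close> by (auto simp: B_def)
      qed (auto simp: B_def)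
      then have "closedin T (B \<inter> C)" using C by (simp add: seq_compact_set_def)
      then have M: "openin T (topspace T - B \<inter> C)" by (rule openin_diff [OF openin_topspace])
      have "c \<notin> B" using N(3) by (auto simp: B_def Fc_def)
      moreover have "x \<otimes> y \<notin> F" if "x \<in> (topspace T - B \<inter> C) \<inter> C" "y \<in> N \<inter> D" for x y
        using that closure_of_subset [OF openin_subset [OF N(1)]] by (auto simp: B_def)
      ultimately show ?thesis
        unfolding W_def using M N(1,2) cG
        by (intro CollectI case_prodI exI [of _ "topspace T - B \<inter> C"] exI [of _ N]) auto
    qed
    have "F \<inter> (\<lambda>p. fst p \<otimes> snd p) ` (C \<times> D) =
        (\<lambda>p. fst p \<otimes> snd p) ` ((topspace (prod_topology T T) - W) \<inter> (C \<times> D))"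
    proof
      show "F \<inter> (\<lambda>p. fst p \<otimes> snd p) ` (C \<times> D) \<subseteq>
          (\<lambda>p. fst p \<otimes> snd p) ` ((topspace (prod_topology T T) - W) \<inter> (C \<times> D))"
      proof
        fix a assume "a \<in> F \<inter> (\<lambda>p. fst p \<otimes> snd p) ` (C \<times> D)"
        then obtain c d where cd: "c \<in> C" "d \<in> D" "a = c \<otimes> d" "a \<in> F" by auto
        then have "(c, d) \<notin> W" unfolding W_def by blast
        then have "(c, d) \<in> (topspace (prod_topology T T) - W) \<inter> (C \<times> D)" using cd CC DC by auto
        then show "a \<in> (\<lambda>p. fst p \<otimes> snd p) ` ((topspace (prod_topology T T) - W) \<inter> (C \<times> D))"
          using cd(3) by force
      qed
      show "(\<lambda>p. fst p \<otimes> snd p) ` ((topspace (prod_topology T T) - W) \<inter> (C \<times> D)) \<subseteq>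
          F \<inter> (\<lambda>p. fst p \<otimes> snd p) ` (C \<times> D)"
      proof
        fix a assume "a \<in> (\<lambda>p. fst p \<otimes> snd p) ` ((topspace (prod_topology T T) - W) \<inter> (C \<times> D))"
        then obtain c d where cd: "c \<in> C" "d \<in> D" "(c, d) \<notin> W" "a = c \<otimes> d" by auto
        then have "a \<in> F" using in_W by blast
        then show "a \<in> F \<inter> (\<lambda>p. fst p \<otimes> snd p) ` (C \<times> D)" using cd by force
      qed
    qed
    moreover have "compactin (prod_topology T T) ((topspace (prod_topology T T) - W) \<inter> (C \<times> D))"
      using W CD by (intro closed_Int_compactin closedin_diff closedin_topspace)
    then have "compactin T ((\<lambda>p. fst p \<otimes> snd p) ` ((topspace (prod_topology T T) - W) \<inter> (C \<times> D)))"
      by (rule image_compactin [OF _ mc])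
    ultimately show "closedin T (F \<inter> (\<lambda>p. fst p \<otimes> snd p) ` (C \<times> D))"
      using compactin_imp_closedin [OF hausT] by metis
  qed
qed

end

text \<open>A convergent sequence with its limit is compact, so continuity on compact sets includes
  sequential continuity. Closedness of \<open>A\<close> keeps the limits of sequences from
  \<open>A\<close> inside the subspace.\<close>

lemma sequential_imp_kR_closed:
  assumes T: "Tychonoff_space T" and seq: "sequential_space T" and A: "closedin T A"
  shows "k\<^sub>R_space (subtopology T A)"
  unfolding k\<^sub>R_space_def
proof (intro conjI allI impI)
  show "Tychonoff_space (subtopology T A)"
    using T by (simp add: Tychonoff_space_def completely_regular_space_subtopology Hausdorff_space_subtopology)
  fix f :: "'a \<Rightarrow> real"
  assume f: "\<forall>K. compactin (subtopology T A) K \<longrightarrow>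
      continuous_map (subtopology (subtopology T A) K) euclideanreal f"
  have AT: "A \<subseteq> topspace T" using A closedin_subset by auto
  have "closedin (subtopology T A) {a \<in> topspace (subtopology T A). f a \<in> C}"
    if C: "closedin euclideanreal C" for C
  proof -
    define B where "B = {a \<in> A. f a \<in> C}"
    have "sequentially_open_in T (topspace T - B)"
      unfolding sequentially_open_in_def
    proof (intro conjI allI impI)
      fix s x assume *: "range s \<subseteq> topspace T \<and> x \<in> topspace T - B \<and> limitin T s x sequentially"
      show "\<forall>\<^sub>F n in sequentially. s n \<in> topspace T - B"
      proof (rule ccontr)
        assume "\<not> ?thesis"
        moreover have "s n \<in> topspace T" for n using * by auto
        ultimately have "infinite {n. s n \<in> B}"
          unfolding eventually_sequentially infinite_nat_iff_unbounded_le by auto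
        then obtain r :: "nat \<Rightarrow> nat" where r: "strict_mono r" "\<And>k. r k \<in> {n. s n \<in> B}"
          using infinite_nat_subseq [of "{n. s n \<in> B}"] by metis
        define t where "t k = s (r k)" for k
        have t: "limitin T t x sequentially" "\<And>k. t k \<in> B"
          unfolding t_def using limit_subseq [OF r(1), of T s x] * r(2) by simp_all
        have xA: "x \<in> A" by (rule limitin_closedin [OF t(1) A]) (use t(2) in \<open>auto simp: B_def\<close>)
        define K where "K = insert x (range t)"
        have "compactin T K" unfolding K_def using t AT by (intro compactin_limit_sequence) (auto simp: B_def)
        then have "compactin (subtopology T A) K"
          using xA t(2) by (auto simp: compactin_subtopology K_def B_def)
        then have "continuous_map (subtopology (subtopology T A) K) euclideanreal f" using f by blast
        moreover have "limitin (subtopology (subtopology T A) K) t x sequentially"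
          using t xA by (auto simp: limitin_subtopology K_def B_def)
        ultimately have "limitin euclideanreal (f \<circ> t) (f x) sequentially" by (rule continuous_map_limit)
        then have "f x \<in> C"
          by (rule limitin_closedin [OF _ C]) (use t(2) in \<open>auto simp: B_def\<close>)
        then show False using * xA by (simp add: B_def)
      qed
    qed auto
    then have "openin T (topspace T - B)" using seq by (simp add: sequential_space_def)
    then have "closedin T B" using AT by (auto simp: closedin_def B_def)
    then have "closedin (subtopology T A) B" by (simp add: closedin_subset_topspace B_def)
    moreover have "B = {a \<in> topspace (subtopology T A). f a \<in> C}" using AT by (auto simp: B_def)
    ultimately show ?thesis by simp
  qed
  then show "continuous_map (subtopology T A) euclideanreal f"
    by (simp add: continuous_map_closedin)
qed

section \<open>Sequentiality of \<open>A(X)\<close> over a sum of a k_omega-space and a discrete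
  space\<close>

lemma sum_of_k\<omega>_and_discreteE:
  assumes sum: "sum_of_k\<^sub>\<omega>_and_discrete X" and haus: "Hausdorff_space X"
  shows "\<exists>Y K. Y \<subseteq> topspace X \<and> (\<forall>n. compactin X (K n) \<and> K n \<subseteq> Y) \<and>
    (\<forall>F. F \<subseteq> Y \<longrightarrow> (\<forall>n::nat. closedin X (F \<inter> K n)) \<longrightarrow> closedin X F) \<and>
    (\<forall>E. E \<subseteq> topspace X - Y \<longrightarrow> closedin X E)"
proof -
  obtain Y' :: "'a topology" and D where Y': "k\<^sub>\<omega>_space Y'" and hs: "X homeomorphic_space
      sum_topology (\<lambda>b. if b then Y' else discrete_topology D) (UNIV :: bool set)"
    using sum unfolding sum_of_k\<^sub>\<omega>_and_discrete_def by metis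
  define Z where "Z = sum_topology (\<lambda>b. if b then Y' else discrete_topology D) (UNIV :: bool set)"
  obtain h k where hk: "homeomorphic_maps X Z h k" using hs unfolding homeomorphic_space_def Z_def by metis
  then have h: "continuous_map X Z h" and k: "continuous_map Z X k"
    and kh: "\<And>x. x \<in> topspace X \<Longrightarrow> k (h x) = x" and hkz: "\<And>z. z \<in> topspace Z \<Longrightarrow> h (k z) = z"
    by (auto simp: homeomorphic_maps_def)
  have hZ: "h x \<in> topspace Z" if "x \<in> topspace X" for x
    using continuous_map_image_subset_topspace [OF h] that by auto
  have tZ: "topspace Z = {p. if fst p then snd p \<in> topspace Y' else snd p \<in> D}"
    by (auto simp: Z_def topspace_sum_topology split: if_splits)
  have clZ: "closedin Z W \<longleftrightarrow> W \<subseteq> topspace Z \<and> closedin Y' {y. (True, y) \<in> W}" for W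
    unfolding Z_def closedin_sum_topology topspace_sum_topology
    by (auto simp: all_bool_eq)
  obtain K' :: "nat \<Rightarrow> 'a set" where K': "\<And>n. compactin Y' (K' n)"
    "\<And>F. F \<subseteq> topspace Y' \<Longrightarrow> (\<forall>n. closedin (subtopology Y' (K' n)) (F \<inter> K' n)) \<Longrightarrow> closedin Y' F"
    using Y' unfolding k\<^sub>\<omega>_space_def by metis
  define e where "e y = k (True, y)" for y
  have e: "continuous_map Y' X e"
  proof -
    have "continuous_map Y' Z (\<lambda>y. (True, y))"
      using continuous_map_component_injection [of True UNIV "\<lambda>b. if b then Y' else discrete_topology D"]
      by (simp add: Z_def)
    from continuous_map_compose [OF this k] show ?thesis by (simp add: o_def e_def [abs_def])
  qed
  have he: "h (e y) = (True, y)" if "y \<in> topspace Y'" for y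
    unfolding e_def by (rule hkz) (simp add: tZ that)
  have eX: "e y \<in> topspace X" if "y \<in> topspace Y'" for y
    using continuous_map_image_subset_topspace [OF e] that by auto
  define Y where "Y = e ` topspace Y'"
  have Yh: "x \<in> Y \<longleftrightarrow> fst (h x)" if x: "x \<in> topspace X" for x
  proof
    assume "x \<in> Y" then show "fst (h x)" using he by (auto simp: Y_def)
  next
    assume "fst (h x)"
    then obtain y where y: "h x = (True, y)" by (cases "h x") auto
    then have "y \<in> topspace Y'" using hZ [OF x] by (simp add: tZ)
    moreover have "e y = x" using kh [OF x] y by (simp add: e_def)
    ultimately show "x \<in> Y" by (auto simp: Y_def)
  qed
  have clX: "closedin X {x \<in> topspace X. h x \<in> W}" if "closedin Z W" for W
    using h that by (rule closedin_continuous_map_preimage)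
  show ?thesis
  proof (intro exI [of _ Y] exI [of _ "\<lambda>n. e ` K' n"] conjI allI impI)
    show "Y \<subseteq> topspace X" using eX by (auto simp: Y_def)
    show "compactin X (e ` K' n)" for n by (rule image_compactin [OF K'(1) e])
    show "e ` K' n \<subseteq> Y" for n using compactin_subset_topspace [OF K'(1)] by (auto simp: Y_def)
  next
    fix F assume FY: "F \<subseteq> Y" and FK: "\<forall>n. closedin X (F \<inter> e ` K' n)"
    define F' where "F' = {y \<in> topspace Y'. e y \<in> F}"
    have "closedin Y' F'"
    proof (rule K'(2))
      show "F' \<subseteq> topspace Y'" by (auto simp: F'_def)
      show "\<forall>n. closedin (subtopology Y' (K' n)) (F' \<inter> K' n)"
      proof
        fix n
        have KY: "K' n \<subseteq> topspace Y'" using compactin_subset_topspace [OF K'(1)] .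
        have "closedin Y' {y \<in> topspace Y'. e y \<in> F \<inter> e ` K' n}"
          by (rule closedin_continuous_map_preimage [OF e]) (use FK in simp)
        moreover have "{y \<in> topspace Y'. e y \<in> F \<inter> e ` K' n} = F' \<inter> K' n"
          using KY he by (auto simp: F'_def) (metis prod.inject subsetD)
        ultimately have "closedin Y' (F' \<inter> K' n)" by simp
        then show "closedin (subtopology Y' (K' n)) (F' \<inter> K' n)" by (simp add: closedin_subset_topspace)
      qed
    qed
    then have "closedin Z ({True} \<times> F')" by (simp add: clZ tZ F'_def subset_iff)
    then have "closedin X {x \<in> topspace X. h x \<in> {True} \<times> F'}" by (rule clX)
    moreover have "{x \<in> topspace X. h x \<in> {True} \<times> F'} = F"
    proof
      show "{x \<in> topspace X. h x \<in> {True} \<times> F'} \<subseteq> F"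
      proof
        fix x assume "x \<in> {x \<in> topspace X. h x \<in> {True} \<times> F'}"
        then have x: "x \<in> topspace X" "h x \<in> {True} \<times> F'" by auto
        then obtain y where "h x = (True, y)" "y \<in> F'" by auto
        then show "x \<in> F" using kh [OF x(1)] by (auto simp: e_def F'_def)
      qed
      show "F \<subseteq> {x \<in> topspace X. h x \<in> {True} \<times> F'}"
        using FY he eX by (fastforce simp: Y_def F'_def)
    qed
    ultimately show "closedin X F" by simp
  next
    fix E assume E: "E \<subseteq> topspace X - Y"
    have hE: "h ` E \<subseteq> {p \<in> topspace Z. \<not> fst p}" using E hZ Yh by auto
    have "\<not> (True, y) \<in> h ` E" for y using subsetD [OF hE, of "(True, y)"] by auto
    then have "{y. (True, y) \<in> h ` E} = {}" by blast
    moreover have "h ` E \<subseteq> topspace Z" using hE by blast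
    ultimately have "closedin Z (h ` E)" by (simp add: clZ)
    then have "closedin X {x \<in> topspace X. h x \<in> h ` E}" by (rule clX)
    moreover have "{x \<in> topspace X. h x \<in> h ` E} = E"
      using E kh by (auto simp: image_iff) (metis DiffD1 subsetD)
    ultimately show "closedin X E" by simp
  qed
qed

context free_abelian_top_group begin

lemma seq_compact_generators:
  assumes K: "compactin X K" and m: "metrizable_space (subtopology X K)"
  shows "seq_compact_set (i ` K)"
  unfolding seq_compact_set_def
proof (intro conjI allI impI)
  show "compactin T (i ` K)" by (rule image_compactin [OF K i_cont])
next
  fix s :: "nat \<Rightarrow> 'g" assume "range s \<subseteq> i ` K"
  then have "\<forall>k. \<exists>c\<in>K. s k = i c" by auto
  then obtain c where c: "\<And>k. c k \<in> K" "\<And>k. s k = i (c k)" by metis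
  have "range c \<subseteq> K" using c(1) by auto
  then obtain r p where r: "strict_mono (r :: nat \<Rightarrow> nat)" "p \<in> K" "limitin X (\<lambda>k. c (r k)) p sequentially"
    using compact_metrizable_convergent_subsequence [OF K m] by metis
  have "limitin T (\<lambda>k. s (r k)) (i p) sequentially"
    using continuous_map_limit [OF i_cont r(3)] by (simp add: c(2) o_def)
  then show "\<exists>r p. strict_mono (r :: nat \<Rightarrow> nat) \<and> p \<in> i ` K \<and> limitin T (\<lambda>k. s (r k)) p sequentially"
    using r by blast
next
  fix F assume F: "seq_closed_set F"
  define C where "C = {x \<in> K. i x \<in> F}"
  have KX: "K \<subseteq> topspace X" using compactin_subset_topspace [OF K] .
  have "closedin (subtopology X K) C"
  proof (rule metrizable_sequentially_closed [OF m KX])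
    fix t l assume t: "range t \<subseteq> C" and l: "limitin X t l sequentially" "l \<in> K"
    have "limitin T (\<lambda>k. i (t k)) (i l) sequentially"
      using continuous_map_limit [OF i_cont l(1)] by (simp add: o_def)
    moreover have "range (\<lambda>k. i (t k)) \<subseteq> F" using t by (auto simp: C_def)
    ultimately have "i l \<in> F" using F unfolding seq_closed_set_def by blast
    then show "l \<in> C" using l by (simp add: C_def)
  qed (auto simp: C_def)
  moreover have "compact_space (subtopology X K)" using K by (simp add: compact_space_subtopology)
  ultimately have "compactin (subtopology X K) C" by (rule closedin_compact_space [rotated])
  then have "compactin X C" by (simp add: compactin_subtopology)
  then have "compactin T (i ` C)" by (rule image_compactin [OF _ i_cont])
  moreover have "i ` C = F \<inter> i ` K" by (auto simp: C_def)
  ultimately show "closedin T (F \<inter> i ` K)" using compactin_imp_closedin [OF hausT] by metis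
qed

text \<open>The universal property makes the identity continuous from \<open>T\<close> to the weak
  topology, so weakly open sets are open. A sequentially open set is weakly open, because all
  translates of the sets \<open>H n\<close> are sequential compact sets.\<close>

lemma sequential_if_sum:
  assumes sum: "sum_of_k\<^sub>\<omega>_and_discrete X"
    and m: "\<And>K. compactin X K \<Longrightarrow> metrizable_space (subtopology X K)"
  shows "sequential_space T"
proof -
  have hausX: "Hausdorff_space X" using TychX by (simp add: Tychonoff_space_def)
  obtain Y K where YK: "Y \<subseteq> topspace X \<and> (\<forall>n. compactin X (K n) \<and> K n \<subseteq> Y) \<and>
      (\<forall>F. F \<subseteq> Y \<longrightarrow> (\<forall>n::nat. closedin X (F \<inter> K n)) \<longrightarrow> closedin X F) \<and>
      (\<forall>E. E \<subseteq> topspace X - Y \<longrightarrow> closedin X E)"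
    using sum_of_k\<omega>_and_discreteE [OF sum hausX] by (elim exE)
  then have K: "\<And>n. compactin X (K n)" and closed_Y: "\<And>F. F \<subseteq> Y \<Longrightarrow> (\<And>n. closedin X (F \<inter> K n)) \<Longrightarrow> closedin X F"
    and closed_D: "\<And>E. E \<subseteq> topspace X - Y \<Longrightarrow> closedin X E" by simp_all
  define L where "L n = (\<Union>k\<le>n. K k)" for n
  have L: "compactin X (L n)" for n unfolding L_def using K by (intro compactin_Union) auto
  have Lmono: "L m \<subseteq> L n" if "m \<le> n" for m n using that by (fastforce simp: L_def)
  define E where "E n = {\<one>} \<union> (i ` L n \<union> (\<lambda>x. inv x) ` (i ` L n))" for n
  have E: "seq_compact_set (E n)" for n
    unfolding E_def
    by (intro seq_compact_Un seq_compact_singleton seq_compact_image seq_compact_generators L m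
        continuous_map_inv) auto
  have Emono: "E m \<subseteq> E n" if "m \<le> n" for m n using Lmono [OF that] by (auto simp: E_def)
  have EG: "E n \<subseteq> carrier G" for n using seq_compact_carrier [OF E] .
  have Einv: "inv a \<in> E n" if "a \<in> E n" for a n
    using that compactin_subset_topspace [OF L, of n] by (auto simp: E_def)
  \<comment> \<open>\<open>H n\<close> consists of the products with one factor from each of
    \<open>E 0\<close> up to \<open>E (n - 1)\<close>. Since the \<open>E n\<close> increase and
    contain the unit and inverses, the filtration laws follow by induction.\<close>
  define H where "H = rec_nat {\<one>} (\<lambda>n A. (\<lambda>p. fst p \<otimes> snd p) ` (A \<times> E n))"
  have H0: "H 0 = {\<one>}" by (simp add: H_def)
  have HS: "H (Suc n) = (\<lambda>p. fst p \<otimes> snd p) ` (H n \<times> E n)" for n by (simp add: H_def)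
  have H: "seq_compact_set (H n)" for n
    by (induction n) (simp_all add: H0 HS seq_compact_singleton seq_compact_mult E)
  have HG: "H n \<subseteq> carrier G" for n using seq_compact_carrier [OF H] .
  have HSuc: "H n \<subseteq> H (Suc n)" for n
  proof
    fix a assume a: "a \<in> H n"
    then have "a = a \<otimes> \<one>" using HG by (metis r_one subsetD)
    moreover have "\<one> \<in> E n" by (simp add: E_def)
    ultimately show "a \<in> H (Suc n)" using a unfolding HS by force
  qed
  interpret W: compact_filtration G T H
  proof
    show "compactin T (H n)" for n using H by (simp add: seq_compact_set_def)
    show "H m \<subseteq> H n" if "m \<le> n" for m n using that HSuc by (rule lift_Suc_mono_le [rotated])
    show "H 0 = {\<one>}" by (rule H0)
    show "a \<otimes> b \<in> H (m + n)" if "a \<in> H m" "b \<in> H n" for a b m n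
      using that(2)
    proof (induction n arbitrary: b)
      case 0
      then show ?case using that(1) HG [of m] by (auto simp: H0)
    next
      case (Suc n)
      then obtain c d where cd: "c \<in> H n" "d \<in> E n" "b = c \<otimes> d" by (auto simp: HS)
      have "(a \<otimes> c) \<otimes> d \<in> H (Suc (m + n))"
        unfolding HS using Suc.IH [OF cd(1)] subsetD [OF Emono [of n "m + n"] cd(2)]
        by (intro image_eqI [of _ _ "(a \<otimes> c, d)"]) auto
      moreover have "(a \<otimes> c) \<otimes> d = a \<otimes> b"
        unfolding cd(3) by (rule m_assoc) (use cd that(1) HG EG in auto)
      ultimately show ?case by simp
    qed
    show "inv a \<in> H n" if "a \<in> H n" for a n
      using that
    proof (induction n arbitrary: a)
      case 0
      then show ?case by (simp add: H0)
    next
      case (Suc n)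
      then obtain c d where cd: "c \<in> H n" "d \<in> E n" "a = c \<otimes> d" by (auto simp: HS)
      have "inv a = inv c \<otimes> inv d" unfolding cd(3) by (rule inv_mult) (use cd HG EG in auto)
      then show ?case
        unfolding HS using Suc.IH [OF cd(1)] Einv [OF cd(2)]
        by (intro image_eqI [of _ _ "(inv c, inv d)"]) auto
    qed
  qed
  have icont: "continuous_map X W.weak_top i"
    unfolding continuous_map_def
  proof (intro conjI allI impI)
    show "i \<in> topspace X \<rightarrow> topspace W.weak_top" by auto
    fix U assume "openin W.weak_top U"
    then have U: "W.weak_open U" by (simp add: W.openin_weak_top)
    define F where "F = {x \<in> topspace X. i x \<notin> U}"
    have "closedin X (F \<inter> Y)"
    proof -
      have "closedin X (F \<inter> Y \<inter> K n)" for n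
      proof -
        \<comment> \<open>The recursion uses \<open>E n\<close> only in forming
          \<open>H (Suc n)\<close>, hence the successor.\<close>
        have KL: "i x \<in> H (Suc n)" if "x \<in> K n" for x
        proof -
          have "i x \<in> E n" using that by (auto simp: E_def L_def)
          moreover have "\<one> \<in> H n" using W.one_H .
          moreover have "\<one> \<otimes> i x = i x" using EG \<open>i x \<in> E n\<close> by (metis l_one subsetD)
          ultimately show ?thesis
            unfolding HS using \<open>i x \<in> E n\<close> by (intro image_eqI [of _ _ "(\<one>, i x)"]) auto
        qed
        have "closedin X {x \<in> topspace X. i x \<in> H (Suc n) - U}"
          by (rule closedin_continuous_map_preimage [OF i_cont W.weak_open_diff_H [OF U]])
        moreover have "closedin X (K n)" by (rule compactin_imp_closedin [OF hausX K])
        moreover have "F \<inter> Y \<inter> K n = {x \<in> topspace X. i x \<in> H (Suc n) - U} \<inter> K n"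
          using KL YK by (auto simp: F_def)
        ultimately show ?thesis by (simp add: closedin_Int)
      qed
      then show ?thesis by (rule closed_Y [OF Int_lower2])
    qed
    moreover have "closedin X (F - Y)" by (rule closed_D) (auto simp: F_def)
    ultimately have "closedin X ((F \<inter> Y) \<union> (F - Y))" by (rule closedin_Un)
    moreover have "(F \<inter> Y) \<union> (F - Y) = F" by auto
    ultimately have "openin X (topspace X - F)" by (simp add: openin_diff)
    moreover have "topspace X - F = {x \<in> topspace X. i x \<in> U}" by (auto simp: F_def)
    ultimately show "openin X {x \<in> topspace X. i x \<in> U}" by simp
  qed
  obtain h where h: "h \<in> hom G G" "continuous_map T W.weak_top h" "\<And>x. x \<in> topspace X \<Longrightarrow> h (i x) = i x"
    using free_Abelian_topological_group_universal [OF free W.weak_top_group icont] by metis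
  \<comment> \<open>The fixed points of \<open>h\<close> form a subgroup containing the
    generators.\<close>
  have hid: "h a = a" if a: "a \<in> carrier G" for a
  proof -
    interpret h: group_hom G G h using h(1) by (simp add: group_hom_def group_hom_axioms_def)
    have sg: "subgroup {a \<in> carrier G. h a = a} G"
      by (rule subgroupI) (auto intro: exI [of _ \<one>])
    have "i ` topspace X \<subseteq> {a \<in> carrier G. h a = a}" using h(3) by auto
    then have "generate G (i ` topspace X) \<subseteq> {a \<in> carrier G. h a = a}"
      by (rule generate_subgroup_incl [OF _ sg])
    moreover have "generate G (i ` topspace X) = carrier G"
      using free by (simp add: free_Abelian_topological_group_def)
    ultimately show ?thesis using a by auto
  qed
  show ?thesis
    unfolding sequential_space_def
  proof (intro allI impI)
    fix U assume U: "sequentially_open_in T U"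
    have UG: "U \<subseteq> carrier G" using U by (simp add: sequentially_open_in_def)
    have "seq_closed_set (carrier G - U)"
      unfolding seq_closed_set_def
    proof (intro conjI allI impI)
      fix s p assume s: "range s \<subseteq> carrier G - U" and p: "limitin T s p sequentially"
      show "p \<in> carrier G - U"
      proof (rule ccontr)
        assume "p \<notin> carrier G - U"
        then have "p \<in> U" using limitin_topspace [OF p] by simp
        moreover have "range s \<subseteq> topspace T" using s by auto
        ultimately have "\<forall>\<^sub>F n in sequentially. s n \<in> U"
          using U [unfolded sequentially_open_in_def, THEN conjunct2, rule_format, of s p] p by simp
        then obtain n where "s n \<in> U" using eventually_happens' [OF sequentially_bot] by blast
        then show False using s by auto
      qed
    qed auto
    have "W.weak_open U"
      unfolding W.weak_open_def
    proof (intro conjI ballI allI UG)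
      fix a n assume a: "a \<in> carrier G"
      have "seq_compact_set ((\<lambda>x. a \<otimes> x) ` H n)"
        by (rule seq_compact_image [OF H W.translation_cont [OF a]])
      then have "closedin T ((carrier G - U) \<inter> (\<lambda>x. a \<otimes> x) ` H n)"
        using \<open>seq_closed_set (carrier G - U)\<close> by (simp add: seq_compact_set_def)
      moreover have "(\<lambda>x. a \<otimes> x) ` H n = W.translate a (H n)"
      proof
        show "(\<lambda>x. a \<otimes> x) ` H n \<subseteq> W.translate a (H n)"
          using a HG [of n] by (auto simp: W.translate_def m_assoc [symmetric])
        show "W.translate a (H n) \<subseteq> (\<lambda>x. a \<otimes> x) ` H n"
        proof
          fix x assume "x \<in> W.translate a (H n)"
          then have x: "x \<in> carrier G" "inv a \<otimes> x \<in> H n" by (auto simp: W.translate_def)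
          have "x = a \<otimes> (inv a \<otimes> x)" using a x by (simp add: m_assoc [symmetric])
          then show "x \<in> (\<lambda>x. a \<otimes> x) ` H n" using x by blast
        qed
      qed
      moreover have "(carrier G - U) \<inter> W.translate a (H n) = W.translate a (H n) - U"
        by (auto simp: W.translate_def)
      ultimately show "closedin T (W.translate a (H n) - U)" by simp
    qed
    then have "openin W.weak_top U" by (simp add: W.openin_weak_top)
    then have "openin T {a \<in> topspace T. h a \<in> U}"
      by (rule openin_continuous_map_preimage [OF h(2)])
    moreover have "{a \<in> topspace T. h a \<in> U} = U" using UG hid by auto
    ultimately show "openin T U" by simp
  qed
qed

end

theorem theorem4p8:
  fixes X :: "'a topology"
    and A :: "('g, 'm) monoid_scheme" and T :: "'g topology" and i :: "'a \<Rightarrow> 'g"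
  assumes "Tychonoff_space X" and "topspace X \<noteq> {}"
    and "\<not> metrizable_space X"
    and "stratifiable_space X"
    and "k_space X"
    and "\<exists>\<P>. k_network X \<P> \<and> compact_countable X \<P>"
    and "free_Abelian_topological_group X A T i"
  shows "(sequential_space T \<longleftrightarrow> k\<^sub>R_space T) \<and>
         (k\<^sub>R_space T \<longleftrightarrow> (\<forall>n\<ge>1. k\<^sub>R_space (A_sub X A T i n))) \<and>
         ((\<forall>n\<ge>1. k\<^sub>R_space (A_sub X A T i n)) \<longleftrightarrow> k\<^sub>R_space (A_sub X A T i 4)) \<and>
         (k\<^sub>R_space (A_sub X A T i 4) \<longleftrightarrow> sum_of_k\<^sub>\<omega>_and_discrete X)"
proof -
  have haus: "Hausdorff_space X" using assms(1) by (simp add: Tychonoff_space_def)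
  obtain S where S: "stratified X S" using stratifiable_imp_stratified [OF haus assms(4)] .
  obtain \<P> where P: "k_network X \<P>" "compact_countable X \<P>" using assms(6) by blast
  have m: "metrizable_space (subtopology X K)" if "compactin X K" for K
    by (rule metrizable_space_compact_k_network [OF assms(1) P that])
  have top: "Abelian_topological_group A T" using assms(7) by (simp add: free_Abelian_topological_group_def)
  interpret k_network_free_group X S \<P> A T i
  proof (intro k_network_free_group.intro k_network_stratified.intro sequential_stratified.intro S
      sequential_stratified_axioms.intro k_network_stratified_axioms.intro
      free_abelian_top_group.intro abelian_top_group.intro abelian_top_group_axioms.intro
      free_abelian_top_group_axioms.intro k_network_free_group_axioms.intro assms P top)
    show "\<exists>r p. strict_mono (r :: nat \<Rightarrow> nat) \<and> p \<in> K \<and> limitin X (\<lambda>k. s (r k)) p sequentially"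
      if "compactin X K" "range s \<subseteq> K" for K s
      using compact_metrizable_convergent_subsequence [OF that(1) m [OF that(1)] that(2)] by metis
    show "closedin X C" if "C \<subseteq> topspace X"
      "\<And>s p. range s \<subseteq> C \<Longrightarrow> limitin X s p sequentially \<Longrightarrow> p \<in> C" for C
      by (rule k_space_sequentially_closed [OF assms(5) m that])
    show "comm_group A" using top by (simp add: Abelian_topological_group_def)
  qed
  \<comment> \<open>All implications pass through the sum decomposition: the k_R-property of
    \<open>A(X)\<close> or of A_4(X) gives the sum, the sum gives sequentiality, and sequentiality
    gives the k_R-property of \<open>A(X)\<close> and of the closed subspaces A_n(X).\<close>
  have seq_kR: "k\<^sub>R_space T" if "sequential_space T"
    using sequential_imp_kR_closed [OF TychT that closedin_topspace] by (simp only: subtopology_topspace)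
  have kR_sum: "sum_of_k\<^sub>\<omega>_and_discrete X" if "k\<^sub>R_space T"
  proof (rule kR_imp_sum [OF assms(3)])
    show "k\<^sub>R_space (subtopology T (carrier A))" using that subtopology_topspace [of T] by (simp only: topspace_T)
  qed auto
  have kR4_sum: "sum_of_k\<^sub>\<omega>_and_discrete X" if "k\<^sub>R_space (A_sub X A T i 4)"
    by (rule kR_imp_sum [OF assms(3) _ _ that [unfolded A_sub_def]]) auto
  have sum_seq: "sequential_space T" if "sum_of_k\<^sub>\<omega>_and_discrete X"
    by (rule sequential_if_sum [OF that m])
  have seq_kRn: "k\<^sub>R_space (A_sub X A T i n)" if "sequential_space T" for n
    unfolding A_sub_def by (rule sequential_imp_kR_closed [OF TychT that closedin_length_le])
  have kRn_kR4: "k\<^sub>R_space (A_sub X A T i 4)" if "\<forall>n\<ge>1. k\<^sub>R_space (A_sub X A T i n)" using that by simp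
  show ?thesis using seq_kR kR_sum kR4_sum sum_seq seq_kRn kRn_kR4 by blast
qed

end
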